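(* Let $(R,\mathfrak m)$ be a $d$-dimensional Cohen-Macaulay Noetherian local ring and let $I=(x_1,\dots,x_d)$ be an ideal generated by an $R$-regular sequence $x_1,\dots,x_d$. Let $\mathcal F=\{I_n\}_{n\in\mathbb Z}$ be an $I$-admissible filtration with reduction number $r(\mathcal F)$. Suppose that $\mathcal F$ satisfies the condition $HI_p$ for all $p\le r(\mathcal F)-2$. Then for all $i=1,\dots,d$, $$e_i(\mathcal F)=\sum_{k=i-1}^{\infty}\binom{k}{i-1}\,\ell\left(\frac{I_{k+1}}{I I_k}\right).$$
   Context: $\ell(M)$ denotes the length of an $R$-module $M$. For an $\mathfrak m$-primary ideal $I$, an $I$-filtration is a sequence of ideals $\mathcal F=\{I_n\}_{n\in\mathbb Z}$ with $I_n=R$ for $n\le 0$, $I_{n+1}\subseteq I_n$, $I_mI_n\subseteq I_{m+n}$ and $I^n\subseteq I_n$ for all $m,n$ (with $I^n=R$ for $n\le 0$). It is $I$-admissible if moreover there is $k\in\mathbb N$ with $I_n\subseteq I^{n-k}$ for all $n$. For an $I$-admissible filtration $\mathcal F$, $\ell(R/I_n)$ agrees for all large $n$ with a polynomial of degree $d$ written $$P_{\mathcal F}(n)=e_0(\mathcal F)\binom{n+d-1}{d}-e_1(\mathcal F)\binom{n+d-2}{d-1}+\cdots+(-1)^d e_d(\mathcal F),$$ and the integers $e_i(\mathcal F)$ are the Hilbert coefficients of $\mathcal F$. A reduction of $\mathcal F$ is an ideal $J\subseteq I_1$ with $JI_n=I_{n+1}$ for all large $n$; $r_J(\mathcal F)$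 is the smallest integer $n$ such that $JI_m=I_{m+1}$ for all $m\ge n$. The reduction number is $r(\mathcal F)=\min\{r_J(\mathcal F)\mid J\text{ a minimal reduction of } I\}$ (here $I$ is generated by a system of parameters of a Cohen-Macaulay ring, so $J=I$). For $I$ generated by a regular sequence, the $I$-admissible filtration $\mathcal F$ satisfies the condition $HI_p$ if for all $n\ge p$, $I_{n+1}\cap I^{n-p}=I_{p+1}I^{n-p}$. *)

theory Defs
  imports
    "HOL-Analysis.Infinite_Sum"
    "HOL-Library.Extended_Real"
    "HOL-Algebra.Module"
    "HOL-Algebra.Ideal_Product"
    "HOL-Algebra.QuotRing"
    "HOL-Algebra.Ring_Divisibility"
begin

section \<open>Modules of the form A/B and length\<close>

definition self_module :: "('a, 'b) ring_scheme \<Rightarrow> ('a, 'a) module" where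
  "self_module R = \<lparr>carrier = carrier R, mult = mult R, one = one R,
     zero = zero R, add = add R, smult = mult R\<rparr>"

text \<open>The fields \<open>mult\<close> and \<open>one\<close> play no role for modules; they are only there because
  the record of modules extends the record of rings.\<close>

definition quot_module :: "('a, 'c) module \<Rightarrow> 'c set \<Rightarrow> ('a, 'c set) module" where
  "quot_module M N = \<lparr>carrier = a_rcosets\<^bsub>M\<^esub> N, mult = rcoset_mult M N, one = N +>\<^bsub>M\<^esub> one M,
     zero = N, add = set_add M, smult = (\<lambda>r X. \<Union>x\<in>X. N +>\<^bsub>M\<^esub> (r \<odot>\<^bsub>M\<^esub> x))\<rparr>"

definition ideal_quot :: "('a, 'b) ring_scheme \<Rightarrow> 'a set \<Rightarrow> 'a set \<Rightarrow> ('a, 'a set) module" where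
  "ideal_quot R A B = quot_module ((self_module R)\<lparr>carrier := A\<rparr>) B"

definition module_length :: "('a, 'b) ring_scheme \<Rightarrow> ('a, 'c) module \<Rightarrow> enat" where
  "module_length R M =
     Sup {enat n | n. \<exists>N. (\<forall>j\<le>n. submodule (N j) R M) \<and> (\<forall>j<n. N j \<subset> N (Suc j))}"


section \<open>Cohen-Macaulay local rings\<close>

locale noetherian_local_ring = cring R + noetherian_ring R for R (structure) +
  fixes \<mm> :: "'a set"
  assumes maximal: "maximalideal \<mm> R"
    and maximal_unique: "maximalideal M R \<Longrightarrow> M = \<mm>"

definition krull_dim :: "('a, 'b) ring_scheme \<Rightarrow> enat" where
  "krull_dim R =
     Sup {enat n | n. \<exists>P. (\<forall>j\<le>n. primeideal (P j) R) \<and> (\<forall>j<n. P j \<subset> P (Suc j))}"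

text \<open>The second condition says that \<open>x\<^sub>j\<close> is a nonzerodivisor on \<open>R/(x\<^sub>1,\<dots>,x\<^sub>j\<^sub>-\<^sub>1)\<close>.\<close>

definition regular_sequence :: "('a, 'b) ring_scheme \<Rightarrow> 'a list \<Rightarrow> bool" where
  "regular_sequence R xs \<longleftrightarrow>
     set xs \<subseteq> carrier R \<and>
     (\<forall>j<length xs. \<forall>a\<in>carrier R.
        xs ! j \<otimes>\<^bsub>R\<^esub> a \<in> Idl\<^bsub>R\<^esub> (set (take j xs)) \<longrightarrow> a \<in> Idl\<^bsub>R\<^esub> (set (take j xs))) \<and>
     Idl\<^bsub>R\<^esub> (set xs) \<noteq> carrier R"

definition depth :: "('a, 'b) ring_scheme \<Rightarrow> 'a set \<Rightarrow> enat" where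
  "depth R \<mm> = Sup {enat (length xs) | xs. regular_sequence R xs \<and> set xs \<subseteq> \<mm>}"

locale cohen_macaulay_local_ring = noetherian_local_ring +
  assumes depth_eq_dim: "depth R \<mm> = krull_dim R"


section \<open>Filtrations\<close>

text \<open>Since \<open>nat n = 0\<close> for \<open>n \<le> 0\<close>, this gives \<open>I\<^sup>n = R\<close> for \<open>n \<le> 0\<close>.\<close>

definition ideal_power :: "('a, 'b) ring_scheme \<Rightarrow> 'a set \<Rightarrow> int \<Rightarrow> 'a set" where
  "ideal_power R I n = I [^]\<^bsub>ideals_set R\<^esub> nat n"

definition radical :: "('a, 'b) ring_scheme \<Rightarrow> 'a set \<Rightarrow> 'a set" where
  "radical R I = {a \<in> carrier R. \<exists>n::nat. a [^]\<^bsub>R\<^esub> n \<in> I}"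

definition primary_ideal :: "('a, 'b) ring_scheme \<Rightarrow> 'a set \<Rightarrow> bool" where
  "primary_ideal R I \<longleftrightarrow> ideal I R \<and> I \<noteq> carrier R \<and>
     (\<forall>a\<in>carrier R. \<forall>b\<in>carrier R. a \<otimes>\<^bsub>R\<^esub> b \<in> I \<longrightarrow> a \<in> I \<or> b \<in> radical R I)"

definition m_primary :: "('a, 'b) ring_scheme \<Rightarrow> 'a set \<Rightarrow> 'a set \<Rightarrow> bool" where
  "m_primary R \<mm> I \<longleftrightarrow> primary_ideal R I \<and> radical R I = \<mm>"

definition I_filtration ::
    "('a, 'b) ring_scheme \<Rightarrow> 'a set \<Rightarrow> 'a set \<Rightarrow> (int \<Rightarrow> 'a set) \<Rightarrow> bool" where
  "I_filtration R \<mm> I F \<longleftrightarrow>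
     m_primary R \<mm> I \<and>
     (\<forall>n. ideal (F n) R) \<and>
     (\<forall>n\<le>0. F n = carrier R) \<and>
     (\<forall>n. F (n + 1) \<subseteq> F n) \<and>
     (\<forall>m n. ideal_prod R (F m) (F n) \<subseteq> F (m + n)) \<and>
     (\<forall>n. ideal_power R I n \<subseteq> F n)"

definition I_admissible ::
    "('a, 'b) ring_scheme \<Rightarrow> 'a set \<Rightarrow> 'a set \<Rightarrow> (int \<Rightarrow> 'a set) \<Rightarrow> bool" where
  "I_admissible R \<mm> I F \<longleftrightarrow>
     I_filtration R \<mm> I F \<and> (\<exists>k::nat. \<forall>n. F n \<subseteq> ideal_power R I (n - int k))"

definition is_reduction :: "('a, 'b) ring_scheme \<Rightarrow> (int \<Rightarrow> 'a set) \<Rightarrow> 'a set \<Rightarrow> bool" where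
  "is_reduction R F J \<longleftrightarrow>
     ideal J R \<and> J \<subseteq> F 1 \<and> (\<forall>\<^sub>F n in at_top. ideal_prod R J (F n) = F (n + 1))"

text \<open>A reduction of the ideal \<open>I\<close> is a reduction of its adic filtration.\<close>

definition is_minimal_reduction :: "('a, 'b) ring_scheme \<Rightarrow> 'a set \<Rightarrow> 'a set \<Rightarrow> bool" where
  "is_minimal_reduction R I J \<longleftrightarrow>
     is_reduction R (ideal_power R I) J \<and>
     (\<forall>K. is_reduction R (ideal_power R I) K \<and> K \<subseteq> J \<longrightarrow> K = J)"

definition reduction_number_wrt ::
    "('a, 'b) ring_scheme \<Rightarrow> (int \<Rightarrow> 'a set) \<Rightarrow> 'a set \<Rightarrow> int" where
  "reduction_number_wrt R F J = (LEAST n. \<forall>m\<ge>n. ideal_prod R J (F m) = F (m + 1))"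

definition reduction_number ::
    "('a, 'b) ring_scheme \<Rightarrow> 'a set \<Rightarrow> (int \<Rightarrow> 'a set) \<Rightarrow> int" where
  "reduction_number R I F =
     (LEAST r. r \<in> {reduction_number_wrt R F J | J. is_minimal_reduction R I J})"

definition HI :: "('a, 'b) ring_scheme \<Rightarrow> 'a set \<Rightarrow> (int \<Rightarrow> 'a set) \<Rightarrow> int \<Rightarrow> bool" where
  "HI R I F p \<longleftrightarrow>
     (\<forall>n\<ge>p. F (n + 1) \<inter> ideal_power R I (n - p) =
            ideal_prod R (F (p + 1)) (ideal_power R I (n - p)))"


section \<open>Hilbert coefficients\<close>

text \<open>\<open>e\<^sub>0, \<dots>, e\<^sub>d\<close> are the coefficients of the polynomial that agrees with \<open>\<ell>(R/I\<^sub>n)\<close> for large \<open>n\<close>,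
  in the basis of the binomials \<open>n + d - 1 - i\<close> over \<open>d - i\<close>. For \<open>n \<ge> 1\<close> and \<open>i \<le> d\<close> the
  subtractions on natural numbers do not truncate. Setting \<open>e\<^sub>i = 0\<close> for \<open>i > d\<close> makes the sequence
  unique.\<close>

definition hilbert_coeff ::
    "('a, 'b) ring_scheme \<Rightarrow> nat \<Rightarrow> (int \<Rightarrow> 'a set) \<Rightarrow> nat \<Rightarrow> int" where
  "hilbert_coeff R d F = (THE e.
     (\<forall>i>d. e i = 0) \<and>
     (\<forall>\<^sub>F n in sequentially.
        ereal_of_enat (module_length R (ideal_quot R (carrier R) (F (int n)))) =
        ereal (real_of_int (\<Sum>i\<le>d. (-1) ^ i * e i * int ((n + d - 1 - i) choose (d - i))))))"

end

theory Submission
  imports Defs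
begin

text \<open>Filter \<open>R/I\<^sub>n\<^sub>+\<^sub>1\<close> by the images of the powers of \<open>I\<close>. All the conditions \<open>HI\<^sub>p\<close> hold, those with
  \<open>p \<ge> r - 1\<close> because \<open>I I\<^sub>m = I\<^sub>m\<^sub>+\<^sub>1\<close> for \<open>m \<ge> r\<close>; so with \<open>A = I\<^sub>n\<^sub>+\<^sub>1\<^sub>-\<^sub>j\<close> we have
  \<open>I\<^sub>n\<^sub>+\<^sub>1 \<inter> I\<^sup>j = A I\<^sup>j\<close>, \<open>I\<^sub>n\<^sub>+\<^sub>1 \<inter> I\<^sup>j\<^sup>+\<^sup>1 = (A \<inter> I) I\<^sup>j\<close> and \<open>A \<inter> I = I I\<^sub>n\<^sub>-\<^sub>j\<close>. Quasi-regularity of the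
  sequence makes \<open>A I\<^sup>j / (A \<inter> I) I\<^sup>j\<close> a direct sum of copies of \<open>A/(A \<inter> I)\<close>, one for each monomial
  of degree \<open>j\<close> in \<open>d\<close> variables. Hence, with \<open>v\<^sub>k = \<ell>(I\<^sub>k\<^sub>+\<^sub>1/I I\<^sub>k)\<close>, the length \<open>\<ell>(R/I\<^sub>n\<^sub>+\<^sub>1)\<close> is
  \<open>\<ell>(R/I)\<close> times the binomial \<open>n + d\<close> over \<open>d\<close>, minus the sum over \<open>k\<close> of \<open>v\<^sub>k\<close> times the binomial
  \<open>n - k + d - 1\<close> over \<open>d - 1\<close>; expanding in \<open>k\<close> gives the coefficients. That \<open>r\<close> is the reduction
  number with respect to \<open>I\<close> itself follows from comparing growth rates: a smaller reduction of \<open>I\<close>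
  would, up to Nakayama, be generated by \<open>d - 1\<close> elements.\<close>

text \<open>Every module that occurs is a subquotient of \<open>R\<close>, and every map needed
  between them is multiplication by one ring element, so lengths are counted by chains of ideals.
  The associated graded ring is never built. Instead, with \<open>K m\<close> generated by the first
  \<open>m\<close> elements, a power of \<open>K (Suc m)\<close> is the sum of the same power of
  \<open>K m\<close> and \<open>x m\<close> times the preceding power of \<open>K (Suc m)\<close>.
  Pascal's rule applied to these two pieces counts the monomials. The obstacle is that the pieces
  overlap; regularity controls the overlap. Two facts hidden in the definitions must be supplied.
  The number \<open>r\<close> is a \<open>LEAST\<close> over the integers and says something only
  once \<open>I I\<^sub>n = I\<^sub>n\<^sub>+\<^sub>1\<close> is known for large \<open>n\<close>.
  This is finite generation of a graded submodule of the Rees algebra of \<open>I\<close>, proved by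
  induction on the number of generators. Moreover \<open>r\<close> refers to minimal reductions of
  \<open>I\<close>; a reduction other than \<open>I\<close> would force the lengths of
  \<open>I\<^sup>n/I\<^sup>n\<^sup>+\<^sup>1\<close> to grow no faster than for \<open>d - 1\<close>
  generators.\<close>

no_notation Sum_Type.Plus (infixr \<open><+>\<close> 65)

section \<open>Lengths of chains of ideals\<close>

text \<open>Stands for the length of \<open>A/B\<close>. Ideals in place of submodules avoid cosets;
  \<open>module_length_ideal_quot\<close> makes the link once.\<close>

definition ideal_length :: "('a, 'b) ring_scheme \<Rightarrow> 'a set \<Rightarrow> 'a set \<Rightarrow> enat" where
  "ideal_length R A B =
     Sup {enat n | n. \<exists>N. (\<forall>j\<le>n. ideal (N j) R \<and> B \<subseteq> N j \<and> N j \<subseteq> A) \<and> (\<forall>j<n. N j \<subset> N (Suc j))}"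

text \<open>No length is known to be finite at the start. Comparing finite lower bounds reduces
  every inequality between lengths to transporting one finite chain.\<close>

lemma enat_le_by_nat:
  assumes "\<And>k. enat k \<le> a \<Longrightarrow> enat k \<le> b"
  shows "a \<le> b"
proof (cases a)
  case (enat n)
  then show ?thesis using assms by simp
next
  case infinity
  then have "enat k \<le> b" for k using assms by simp
  then show ?thesis
    by (metis Suc_ile_eq enat.exhaust enat_ord_simps(1) not_less_eq_eq order_refl enat_ord_code(3))
qed

lemma enat_le_add_split:
  assumes "enat k \<le> a + b"
  obtains i j where "k = i + j" "enat i \<le> a" "enat j \<le> b"
proof (cases a)
  case (enat n)
  show thesis
  proof (cases "k \<le> n")
    case True
    then show ?thesis using that[of k 0] enat by (simp add: zero_enat_def[symmetric])
  next
    case False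
    have "enat (k - n) \<le> b" using assms enat by (cases b) auto
    then show ?thesis using that[of n "k - n"] enat False by simp
  qed
next
  case infinity
  then show thesis using that[of k 0] by (simp add: zero_enat_def[symmetric])
qed

text \<open>If the supremum lies above \<open>k - 1\<close>, so does some member of the set, and its
  chain truncates to length \<open>k\<close>. The hypothesis \<open>P B\<close> serves
  \<open>k = 0\<close>, where a chain still needs one member.\<close>

lemma chain_length_ge_iff:
  fixes P :: "'c set \<Rightarrow> bool"
  assumes "P B"
  shows "enat k \<le> Sup {enat n | n. \<exists>N. (\<forall>j\<le>n. P (N j)) \<and> (\<forall>j<n. N j \<subset> N (Suc j))} \<longleftrightarrow>
     (\<exists>N. (\<forall>j\<le>k. P (N j)) \<and> (\<forall>j<k. N j \<subset> N (Suc j)))"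
    (is "_ \<le> Sup ?S \<longleftrightarrow> ?C k")
proof
  have down: "?C m" if "?C n" "m \<le> n" for m n
    using that by (meson le_trans less_le_trans)
  assume le: "enat k \<le> Sup ?S"
  show "?C k"
  proof (cases k)
    case 0
    then show ?thesis using assms by (intro exI[of _ "\<lambda>_. B"]) auto
  next
    case (Suc k')
    have "enat k' < enat k" using Suc by simp
    with le have "enat k' < Sup ?S" by (rule less_le_trans[rotated])
    then obtain s where "s \<in> ?S" "enat k' < s" by (auto simp: less_Sup_iff)
    from \<open>s \<in> ?S\<close> obtain n where "s = enat n" "?C n" by blast
    with \<open>enat k' < s\<close> have "?C n" "k' < n" by simp_all
    then show ?thesis using down Suc by (simp add: Suc_leI)
  qed
next
  assume "?C k"
  then have "enat k \<in> ?S" by blast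
  then show "enat k \<le> Sup ?S" by (rule Sup_upper)
qed

text \<open>Repetitions are dropped one at a time. The last conjunct, which fixes the top member, is
  there for the induction: the next strict step is appended to it.\<close>

lemma strict_chain_of_weak_chain:
  fixes N :: "nat \<Rightarrow> 'c set"
  assumes "\<And>j. j \<le> n \<Longrightarrow> P (N j)" "\<And>j. j < n \<Longrightarrow> N j \<subseteq> N (Suc j)"
  shows "\<exists>M. (\<forall>j\<le>card {j. j < n \<and> N j \<noteq> N (Suc j)}. P (M j)) \<and>
     (\<forall>j<card {j. j < n \<and> N j \<noteq> N (Suc j)}. M j \<subset> M (Suc j)) \<and>
     M (card {j. j < n \<and> N j \<noteq> N (Suc j)}) = N n"
  using assms
proof (induction n)
  case 0
  then show ?case by (intro exI[of _ "\<lambda>_. N 0"]) auto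
next
  case (Suc n)
  define c where "c = card {j. j < n \<and> N j \<noteq> N (Suc j)}"
  obtain M where M: "\<forall>j\<le>c. P (M j)" "\<forall>j<c. M j \<subset> M (Suc j)" "M c = N n"
    using Suc.IH Suc.prems unfolding c_def by auto
  show ?case
  proof (cases "N n = N (Suc n)")
    case True
    then have "{j. j < Suc n \<and> N j \<noteq> N (Suc j)} = {j. j < n \<and> N j \<noteq> N (Suc j)}"
      using less_Suc_eq by auto
    then show ?thesis using M True c_def by auto
  next
    case False
    then have "{j. j < Suc n \<and> N j \<noteq> N (Suc j)} = insert n {j. j < n \<and> N j \<noteq> N (Suc j)}"
      using less_Suc_eq by auto
    then have c: "card {j. j < Suc n \<and> N j \<noteq> N (Suc j)} = Suc c" by (simp add: c_def)
    have sub: "N n \<subset> N (Suc n)" using False Suc.prems(2)[of n] by auto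
    show ?thesis
      unfolding c
      using M sub Suc.prems(1)[of "Suc n"]
      by (intro exI[of _ "M(Suc c := N (Suc n))"]) (auto simp: le_Suc_eq less_Suc_eq)
  qed
qed

context ring
begin

lemma ideal_length_ge_iff:
  assumes "ideal B R" "B \<subseteq> A"
  shows "enat k \<le> ideal_length R A B \<longleftrightarrow>
     (\<exists>N. (\<forall>j\<le>k. ideal (N j) R \<and> B \<subseteq> N j \<and> N j \<subseteq> A) \<and> (\<forall>j<k. N j \<subset> N (Suc j)))"
  unfolding ideal_length_def using assms by (intro chain_length_ge_iff) auto

lemma ideal_length_geE:
  assumes "ideal B R" "B \<subseteq> A" "enat k \<le> ideal_length R A B"
  obtains N where "\<forall>j\<le>k. ideal (N j) R" "\<forall>j\<le>k. B \<subseteq> N j"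
    "\<forall>j\<le>k. N j \<subseteq> A" "\<forall>j<k. N j \<subset> N (Suc j)"
proof -
  obtain N where "(\<forall>j\<le>k. ideal (N j) R \<and> B \<subseteq> N j \<and> N j \<subseteq> A) \<and> (\<forall>j<k. N j \<subset> N (Suc j))"
    using iffD1[OF ideal_length_ge_iff[OF assms(1,2)] assms(3)] by (rule exE)
  then show thesis by (intro that[of N]) simp_all
qed

lemma ideal_length_geI:
  assumes "ideal B R" "B \<subseteq> A" "\<And>j. j \<le> k \<Longrightarrow> ideal (N j) R" "\<And>j. j \<le> k \<Longrightarrow> B \<subseteq> N j"
    "\<And>j. j \<le> k \<Longrightarrow> N j \<subseteq> A" "\<And>j. j < k \<Longrightarrow> N j \<subset> N (Suc j)"
  shows "enat k \<le> ideal_length R A B"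
  unfolding ideal_length_ge_iff[OF assms(1,2)] using assms(3-) by (intro exI[of _ N]) simp

lemma ideal_length_le_of_strict_mono:
  assumes "ideal B R" "B \<subseteq> A" "ideal D R" "D \<subseteq> C"
    and f: "\<And>N. ideal N R \<Longrightarrow> B \<subseteq> N \<Longrightarrow> N \<subseteq> A \<Longrightarrow> ideal (f N) R \<and> D \<subseteq> f N \<and> f N \<subseteq> C"
    and mono: "\<And>N N'. ideal N R \<Longrightarrow> B \<subseteq> N \<Longrightarrow> N \<subset> N' \<Longrightarrow> ideal N' R \<Longrightarrow> N' \<subseteq> A \<Longrightarrow> f N \<subset> f N'"
  shows "ideal_length R A B \<le> ideal_length R C D"
proof (rule enat_le_by_nat)
  fix k assume "enat k \<le> ideal_length R A B"
  with assms(1,2) obtain N where N: "\<forall>j\<le>k. ideal (N j) R" "\<forall>j\<le>k. B \<subseteq> N j"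
    "\<forall>j\<le>k. N j \<subseteq> A" "\<forall>j<k. N j \<subset> N (Suc j)"
    by (rule ideal_length_geE)
    note N = N[rule_format]
  show "enat k \<le> ideal_length R C D"
  proof (rule ideal_length_geI[OF assms(3,4), where N = "\<lambda>j. f (N j)"])
    show "f (N j) \<subset> f (N (Suc j))" if "j < k" for j
      using N(1)[of j] N(2)[of j] N(1)[of "Suc j"] N(3)[of "Suc j"] N(4)[OF that] that
      by (intro mono) simp_all
  qed (use f N in simp_all)
qed

lemma ideal_length_weak_chain:
  assumes "ideal B R" "B \<subseteq> A"
    and "\<And>j. j \<le> n \<Longrightarrow> ideal (N j) R \<and> B \<subseteq> N j \<and> N j \<subseteq> A" "\<And>j. j < n \<Longrightarrow> N j \<subseteq> N (Suc j)"
  shows "enat (card {j. j < n \<and> N j \<noteq> N (Suc j)}) \<le> ideal_length R A B"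
  unfolding ideal_length_ge_iff[OF assms(1,2)]
  using strict_chain_of_weak_chain[of n "\<lambda>X. ideal X R \<and> B \<subseteq> X \<and> X \<subseteq> A" N] assms(3,4) by blast

lemma set_add_memI: "a \<in> A \<Longrightarrow> b \<in> B \<Longrightarrow> a \<oplus> b \<in> A <+> B"
  by (auto simp: set_add_def')

lemma set_add_memE:
  assumes "z \<in> A <+> B"
  obtains a b where "a \<in> A" "b \<in> B" "z = a \<oplus> b"
  using assms by (auto simp: set_add_def')

lemma ideal_zero_mem: "ideal J R \<Longrightarrow> \<zero> \<in> J"
  by (simp add: additive_subgroup.zero_closed ideal.axioms(1))

lemma ideal_add_mem: "ideal J R \<Longrightarrow> a \<in> J \<Longrightarrow> b \<in> J \<Longrightarrow> a \<oplus> b \<in> J"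
  by (simp add: additive_subgroup.a_closed ideal.axioms(1))

lemma ideal_minus_mem: "ideal J R \<Longrightarrow> a \<in> J \<Longrightarrow> b \<in> J \<Longrightarrow> a \<ominus> b \<in> J"
  unfolding a_minus_def
  by (simp add: additive_subgroup.a_closed additive_subgroup.a_inv_closed ideal.axioms(1))

lemma ideal_subset_carrier: "ideal J R \<Longrightarrow> J \<subseteq> carrier R"
  using ideal.Icarr by fast

lemma set_add_ub1:
  assumes "ideal A R" "ideal B R"
  shows "A \<subseteq> A <+> B"
proof
  fix a assume "a \<in> A"
  then have "a \<oplus> \<zero> \<in> A <+> B" "a \<in> carrier R"
    using assms set_add_memI ideal_zero_mem ideal_subset_carrier by blast+
  then show "a \<in> A <+> B" by simp
qed

lemma set_add_ub2:
  assumes "ideal A R" "ideal B R"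
  shows "B \<subseteq> A <+> B"
proof
  fix b assume "b \<in> B"
  then have "\<zero> \<oplus> b \<in> A <+> B" "b \<in> carrier R"
    using assms set_add_memI ideal_zero_mem ideal_subset_carrier by blast+
  then show "b \<in> A <+> B" by simp
qed

lemma set_add_lub: "ideal C R \<Longrightarrow> A \<subseteq> C \<Longrightarrow> B \<subseteq> C \<Longrightarrow> A <+> B \<subseteq> C"
  by (auto simp: set_add_def' intro: ideal_add_mem)

lemma ideal_sum_mem_cancel:
  assumes "ideal J R" "a \<in> J" "a \<oplus> b \<in> J" "b \<in> carrier R"
  shows "b \<in> J"
proof -
  have "a \<in> carrier R" using assms ideal_subset_carrier by blast
  then have "(a \<oplus> b) \<ominus> a = b" using assms(4) by (simp add: a_minus_def a_comm[of a b] a_assoc r_neg)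
  then show ?thesis using ideal_minus_mem[OF assms(1,3,2)] by simp
qed

text \<open>For one inequality chains are stacked. For the other, a chain is sent to
  \<open>N <+> B\<close> and to \<open>N \<inter> B\<close>; by the modular law a strict step stays
  strict in at least one of the two.\<close>

lemma ideal_length_add:
  assumes A: "ideal A R" and B: "ideal B R" and C: "ideal C R" and CB: "C \<subseteq> B" and BA: "B \<subseteq> A"
  shows "ideal_length R A C = ideal_length R A B + ideal_length R B C"
proof (rule antisym)
  show "ideal_length R A B + ideal_length R B C \<le> ideal_length R A C"
  proof (rule enat_le_by_nat)
    fix k assume "enat k \<le> ideal_length R A B + ideal_length R B C"
    then obtain i j where k: "k = i + j" and i: "enat i \<le> ideal_length R A B"
      and j: "enat j \<le> ideal_length R B C" by (rule enat_le_add_split)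
    obtain N where N: "\<forall>l\<le>i. ideal (N l) R" "\<forall>l\<le>i. B \<subseteq> N l"
      "\<forall>l\<le>i. N l \<subseteq> A" "\<forall>l<i. N l \<subset> N (Suc l)"
      using B BA i by (rule ideal_length_geE)
    note N = N[rule_format]
    obtain M where M: "\<forall>l\<le>j. ideal (M l) R" "\<forall>l\<le>j. C \<subseteq> M l"
      "\<forall>l\<le>j. M l \<subseteq> B" "\<forall>l<j. M l \<subset> M (Suc l)"
      using C CB j by (rule ideal_length_geE)
    note M = M[rule_format]
    \<comment> \<open>The top of the lower chain and the bottom of the upper one may coincide, so
      \<open>M j\<close> is left out in favour of \<open>N 0\<close>; \<open>i + j\<close> strict
      steps remain.\<close>
    define L where "L l = (if l < j then M l else N (l - j))" for l
    have "L l \<subset> L (Suc l)" if "l < k" for l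
    proof -
      consider "Suc l < j" | "Suc l = j" | "j \<le> l" by linarith
      then show ?thesis
      proof cases
        case 2
        then have "M l \<subset> M j" using M(4)[of l] by force
        moreover have "M j \<subseteq> B" "B \<subseteq> N 0" using M(3) N(2) by simp_all
        ultimately have "M l \<subset> N 0" by order
        then show ?thesis using 2 by (auto simp: L_def)
      next
        case 3
        then have "Suc l - j = Suc (l - j)" by simp
        then show ?thesis using 3 N(4) that k by (simp add: L_def)
      qed (use M(4) in \<open>auto simp: L_def\<close>)
    qed
    moreover have "ideal (L l) R \<and> C \<subseteq> L l \<and> L l \<subseteq> A" if "l \<le> k" for l
    proof (cases "l < j")
      case True
      then show ?thesis using M(1,2)[of l] subset_trans[OF M(3)[of l] BA] by (simp add: L_def)
    next
      case False
      then have "l - j \<le> i" using that k by simp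
      then show ?thesis using N(1,3)[of "l - j"] subset_trans[OF CB N(2)[of "l - j"]] False
        by (simp add: L_def)
    qed
    ultimately show "enat k \<le> ideal_length R A C"
      using CB BA by (intro ideal_length_geI[OF C, where N = L]) auto
  qed
next
  show "ideal_length R A C \<le> ideal_length R A B + ideal_length R B C"
  proof (rule enat_le_by_nat)
    fix k assume "enat k \<le> ideal_length R A C"
    with C order_trans[OF CB BA] obtain N where N: "\<forall>l\<le>k. ideal (N l) R" "\<forall>l\<le>k. C \<subseteq> N l"
      "\<forall>l\<le>k. N l \<subseteq> A" "\<forall>l<k. N l \<subset> N (Suc l)"
      by (rule ideal_length_geE)
    note N = N[rule_format]
    define U where "U l = N l <+> B" for l
    define V where "V l = N l \<inter> B" for l
    let ?u = "{j. j < k \<and> U j \<noteq> U (Suc j)}" and ?v = "{j. j < k \<and> V j \<noteq> V (Suc j)}"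
    have U: "enat (card ?u) \<le> ideal_length R A B"
    proof (rule ideal_length_weak_chain[OF B BA])
      show "ideal (U j) R \<and> B \<subseteq> U j \<and> U j \<subseteq> A" if "j \<le> k" for j
        using N(1,3) that B BA A unfolding U_def by (simp add: add_ideals set_add_ub2 set_add_lub)
      show "U j \<subseteq> U (Suc j)" if "j < k" for j
        using N(4)[OF that] unfolding U_def set_add_def' by blast
    qed
    have V: "enat (card ?v) \<le> ideal_length R B C"
    proof (rule ideal_length_weak_chain[OF C CB])
      show "ideal (V j) R \<and> C \<subseteq> V j \<and> V j \<subseteq> B" if "j \<le> k" for j
        using N(1,2) that B CB unfolding V_def by (simp add: i_intersect)
      show "V j \<subseteq> V (Suc j)" if "j < k" for j
        using N(4)[OF that] unfolding V_def by blast
    qed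
    have "{..<k} \<subseteq> ?u \<union> ?v"
    proof (rule subsetI, rule ccontr)
      fix j assume j: "j \<in> {..<k}" "j \<notin> ?u \<union> ?v"
      then have eq: "U j = U (Suc j)" "V j = V (Suc j)" and sub: "N j \<subset> N (Suc j)" using N(4) by auto
      have id: "ideal (N j) R" "ideal (N (Suc j)) R" using N(1) j by auto
      have "N (Suc j) \<subseteq> N j"
      proof
        fix y assume y: "y \<in> N (Suc j)"
        then have "y \<in> N j <+> B" using eq(1) set_add_ub1[OF id(2) B] unfolding U_def by blast
        then obtain a b where ab: "a \<in> N j" "b \<in> B" "y = a \<oplus> b" by (rule set_add_memE)
        have "b \<in> N (Suc j)"
          using ideal_sum_mem_cancel[OF id(2), of a b] ab y sub B ideal_subset_carrier by blast
        then have "b \<in> N j" using eq(2) ab(2) unfolding V_def by blast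
        then show "y \<in> N j" using ab id by (simp add: ideal_add_mem)
      qed
      then show False using sub by blast
    qed
    then have "card {..<k} \<le> card (?u \<union> ?v)" by (intro card_mono) auto
    then have "k \<le> card ?u + card ?v" using card_Un_le[of ?u ?v] by simp
    then have "enat k \<le> enat (card ?u) + enat (card ?v)" by simp
    also have "\<dots> \<le> ideal_length R A B + ideal_length R B C" using U V by (rule add_mono)
    finally show "enat k \<le> ideal_length R A B + ideal_length R B C" .
  qed
qed

end

section \<open>Comparison of lengths through multiplication by a ring element\<close>

context cring
begin

lemma cring_idealI:
  assumes "J \<subseteq> carrier R" "\<zero> \<in> J" "\<And>a b. a \<in> J \<Longrightarrow> b \<in> J \<Longrightarrow> a \<oplus> b \<in> J"
    "\<And>r a. r \<in> carrier R \<Longrightarrow> a \<in> J \<Longrightarrow> r \<otimes> a \<in> J"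
  shows "ideal J R"
proof (rule idealI[OF ring_axioms])
  show "subgroup J (add_monoid R)"
  proof (rule add.subgroupI)
    show "J \<noteq> {}" using assms(2) by blast
    show "\<ominus> a \<in> J" if "a \<in> J" for a
    proof -
      have "\<ominus> \<one> \<otimes> a \<in> J" using assms(4)[of "\<ominus> \<one>" a] that by simp
      then show ?thesis using that assms(1) l_minus[of \<one> a] by auto
    qed
  qed (use assms in auto)
  show "x \<otimes> a \<in> J" "a \<otimes> x \<in> J" if "a \<in> J" "x \<in> carrier R" for a x
    using assms(4)[OF that(2,1)] m_comm[of a x] that assms(1) by auto
qed

lemma ideal_mult_mem: "ideal J R \<Longrightarrow> r \<in> carrier R \<Longrightarrow> a \<in> J \<Longrightarrow> r \<otimes> a \<in> J"
  by (rule ideal.I_l_closed)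

lemma ideal_mem_carrier: "ideal J R \<Longrightarrow> a \<in> J \<Longrightarrow> a \<in> carrier R"
  by (rule ideal.Icarr)

lemma ideal_cmult:
  assumes "ideal J R" "x \<in> carrier R"
  shows "ideal ((\<lambda>z. x \<otimes> z) ` J) R"
proof (rule cring_idealI)
  show "(\<lambda>z. x \<otimes> z) ` J \<subseteq> carrier R" using assms ideal_mem_carrier by auto
  have "x \<otimes> \<zero> = \<zero>" using assms by simp
  then show "\<zero> \<in> (\<lambda>z. x \<otimes> z) ` J" using ideal_zero_mem[OF assms(1)] by (metis image_eqI)
  fix a b assume "a \<in> (\<lambda>z. x \<otimes> z) ` J" "b \<in> (\<lambda>z. x \<otimes> z) ` J"
  then obtain u v where uv: "u \<in> J" "v \<in> J" "a = x \<otimes> u" "b = x \<otimes> v" by auto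
  then have "a \<oplus> b = x \<otimes> (u \<oplus> v)" using assms ideal_mem_carrier by (simp add: r_distr)
  then show "a \<oplus> b \<in> (\<lambda>z. x \<otimes> z) ` J" using ideal_add_mem[OF assms(1) uv(1,2)] by blast
next
  fix r a assume r: "r \<in> carrier R" and "a \<in> (\<lambda>z. x \<otimes> z) ` J"
  then obtain u where u: "u \<in> J" "a = x \<otimes> u" by auto
  then have "r \<otimes> a = x \<otimes> (r \<otimes> u)" using assms r ideal_mem_carrier by (simp add: m_lcomm)
  then show "r \<otimes> a \<in> (\<lambda>z. x \<otimes> z) ` J" using ideal_mult_mem[OF assms(1) r u(1)] by blast
qed

lemma ideal_colon:
  assumes "ideal J R" "ideal A R" "x \<in> carrier R"
  shows "ideal {a \<in> A. x \<otimes> a \<in> J} R"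
proof (rule cring_idealI)
  show "\<zero> \<in> {a \<in> A. x \<otimes> a \<in> J}" using assms ideal_zero_mem by simp
  show "a \<oplus> b \<in> {a \<in> A. x \<otimes> a \<in> J}" if "a \<in> {a \<in> A. x \<otimes> a \<in> J}" "b \<in> {a \<in> A. x \<otimes> a \<in> J}" for a b
    using that assms ideal_mem_carrier[OF assms(2)] ideal_add_mem by (simp add: r_distr)
  show "r \<otimes> a \<in> {a \<in> A. x \<otimes> a \<in> J}" if "r \<in> carrier R" "a \<in> {a \<in> A. x \<otimes> a \<in> J}" for r a
    using that assms ideal_mem_carrier[OF assms(2)] ideal_mult_mem by (simp add: m_lcomm)
qed (use assms ideal_mem_carrier in blast)

text \<open>Multiplication by \<open>y\<close> maps \<open>A/B\<close> onto \<open>C/D\<close>, so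
  pulling back ideals is strictly monotone. In the applications \<open>y\<close> is one, a generator
  or a socle element.\<close>

lemma ideal_length_le_of_surj:
  assumes id: "ideal A R" "ideal B R" "ideal C R" "ideal D R" and sub: "B \<subseteq> A" "D \<subseteq> C"
    and y: "y \<in> carrier R" and surj: "C \<subseteq> (\<lambda>z. y \<otimes> z) ` A <+> D" and B: "\<And>b. b \<in> B \<Longrightarrow> y \<otimes> b \<in> D"
  shows "ideal_length R C D \<le> ideal_length R A B"
proof (rule ideal_length_le_of_strict_mono[OF id(4) sub(2) id(2) sub(1), where f = "\<lambda>K. {a \<in> A. y \<otimes> a \<in> K}"])
  fix K assume "ideal K R" "D \<subseteq> K"
  then show "ideal {a \<in> A. y \<otimes> a \<in> K} R \<and> B \<subseteq> {a \<in> A. y \<otimes> a \<in> K} \<and> {a \<in> A. y \<otimes> a \<in> K} \<subseteq> A"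
    using ideal_colon[OF _ id(1) y] B sub by auto
next
  fix K K' assume K: "ideal K R" "D \<subseteq> K" "K \<subset> K'" "ideal K' R" "K' \<subseteq> C"
  then obtain k where k: "k \<in> K'" "k \<notin> K" by blast
  then have "k \<in> (\<lambda>z. y \<otimes> z) ` A <+> D" using K surj by blast
  then obtain u e where u: "u \<in> (\<lambda>z. y \<otimes> z) ` A" and e: "e \<in> D" "k = u \<oplus> e" by (rule set_add_memE)
  from u obtain a where a: "a \<in> A" "u = y \<otimes> a" by blast
  have uc: "u \<in> carrier R" "e \<in> carrier R" using a e y id ideal_mem_carrier by auto
  have "u \<in> K'"
    using ideal_sum_mem_cancel[OF K(4), of e u] e k K uc a_comm[of u e] by auto
  moreover have "u \<notin> K" using e k(2) K ideal_add_mem by blast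
  ultimately show "{a \<in> A. y \<otimes> a \<in> K} \<subset> {a \<in> A. y \<otimes> a \<in> K'}" using a K(3) by auto
qed

text \<open>Multiplication by \<open>y\<close> embeds \<open>A/B\<close> in \<open>C/D\<close>.
  Since \<open>B \<subseteq> N\<close>, the kernel condition makes \<open>N\<close> recoverable from
  \<open>y N + D\<close>, so strict steps stay strict.\<close>

lemma ideal_length_ge_of_inj:
  assumes id: "ideal A R" "ideal B R" "ideal C R" "ideal D R" and sub: "B \<subseteq> A" "D \<subseteq> C"
    and y: "y \<in> carrier R" and AC: "\<And>a. a \<in> A \<Longrightarrow> y \<otimes> a \<in> C"
    and ker: "\<And>a. a \<in> A \<Longrightarrow> y \<otimes> a \<in> D \<Longrightarrow> a \<in> B"
  shows "ideal_length R A B \<le> ideal_length R C D"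
proof (rule ideal_length_le_of_strict_mono[OF id(2) sub(1) id(4) sub(2), where f = "\<lambda>N. (\<lambda>z. y \<otimes> z) ` N <+> D"])
  fix N assume N: "ideal N R" "B \<subseteq> N" "N \<subseteq> A"
  have "(\<lambda>z. y \<otimes> z) ` N \<subseteq> C" using N AC by blast
  then show "ideal ((\<lambda>z. y \<otimes> z) ` N <+> D) R \<and> D \<subseteq> (\<lambda>z. y \<otimes> z) ` N <+> D \<and> (\<lambda>z. y \<otimes> z) ` N <+> D \<subseteq> C"
    using N id sub y by (simp add: add_ideals ideal_cmult set_add_ub2 set_add_lub)
next
  fix N N' assume N: "ideal N R" "B \<subseteq> N" "N \<subset> N'" "ideal N' R" "N' \<subseteq> A"
  then obtain a where a: "a \<in> N'" "a \<notin> N" by blast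
  have "y \<otimes> a \<in> (\<lambda>z. y \<otimes> z) ` N' <+> D"
    using set_add_ub1[OF ideal_cmult[OF N(4) y] id(4)] a by blast
  moreover have "y \<otimes> a \<notin> (\<lambda>z. y \<otimes> z) ` N <+> D"
  proof
    assume "y \<otimes> a \<in> (\<lambda>z. y \<otimes> z) ` N <+> D"
    then obtain u e where "u \<in> (\<lambda>z. y \<otimes> z) ` N" and e: "e \<in> D" "y \<otimes> a = u \<oplus> e" by (rule set_add_memE)
    then obtain n where n: "n \<in> N" "y \<otimes> a = y \<otimes> n \<oplus> e" by blast
    have c: "a \<in> carrier R" "n \<in> carrier R" "e \<in> carrier R"
      using a n e N id ideal_mem_carrier by blast+
    have "y \<otimes> (a \<ominus> n) = y \<otimes> a \<ominus> y \<otimes> n" using c y by (simp add: a_minus_def r_distr r_minus)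
    also have "\<dots> = e"
      using c y unfolding n(2) by (simp add: a_minus_def a_comm[of "y \<otimes> n" e] a_assoc r_neg)
    finally have "y \<otimes> (a \<ominus> n) \<in> D" using e by simp
    moreover have "a \<ominus> n \<in> A" using ideal_minus_mem[OF N(4)] a n N by blast
    ultimately have "a \<ominus> n \<in> N" using ker N(2) by blast
    then have "n \<oplus> (a \<ominus> n) \<in> N" using ideal_add_mem[OF N(1)] n by blast
    moreover have "n \<oplus> (a \<ominus> n) = a" using c by (simp add: a_minus_def a_comm[of a] r_neg2)
    ultimately show False using a by simp
  qed
  moreover have "(\<lambda>z. y \<otimes> z) ` N <+> D \<subseteq> (\<lambda>z. y \<otimes> z) ` N' <+> D"
    using N(3) unfolding set_add_def' by blast
  ultimately show "(\<lambda>z. y \<otimes> z) ` N <+> D \<subset> (\<lambda>z. y \<otimes> z) ` N' <+> D" by blast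
qed

lemma ideal_length_eq_of_iso:
  assumes id: "ideal A R" "ideal B R" "ideal C R" "ideal D R" and sub: "B \<subseteq> A" "D \<subseteq> C"
    and y: "y \<in> carrier R" and AC: "\<And>a. a \<in> A \<Longrightarrow> y \<otimes> a \<in> C"
    and surj: "C \<subseteq> (\<lambda>z. y \<otimes> z) ` A <+> D" and ker: "\<And>a. a \<in> A \<Longrightarrow> y \<otimes> a \<in> D \<longleftrightarrow> a \<in> B"
  shows "ideal_length R C D = ideal_length R A B"
proof (rule antisym)
  show "ideal_length R C D \<le> ideal_length R A B"
    using sub ker by (intro ideal_length_le_of_surj[OF id sub y surj]) blast
  show "ideal_length R A B \<le> ideal_length R C D"
    using ker by (intro ideal_length_ge_of_inj[OF id sub y AC]) simp_all
qed

lemma ideal_length_self: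
  assumes "ideal A R"
  shows "ideal_length R A A = 0"
proof -
  have "\<not> enat 1 \<le> ideal_length R A A"
  proof
    assume "enat 1 \<le> ideal_length R A A"
    with assms order_refl obtain N where "\<forall>l\<le>1::nat. ideal (N l) R" "\<forall>l\<le>1::nat. A \<subseteq> N l"
      "\<forall>l\<le>1::nat. N l \<subseteq> A" "\<forall>l<1::nat. N l \<subset> N (Suc l)"
      by (rule ideal_length_geE)
    then have "N 0 \<subset> N 1" "N 0 = A" "N 1 = A" by auto
    then show False by blast
  qed
  then show ?thesis by (cases "ideal_length R A A") (auto simp: zero_enat_def)
qed

section \<open>Submodules of \<open>A/B\<close> and ideals between \<open>B\<close> and
  \<open>A\<close>\<close>

lemma
  shows carrier_ideal_quot: "carrier (ideal_quot R A B) = (\<lambda>a. B +> a) ` A"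
    and add_ideal_quot: "add (ideal_quot R A B) X Y = X <+> Y"
    and zero_ideal_quot: "zero (ideal_quot R A B) = B"
    and smult_ideal_quot: "smult (ideal_quot R A B) r X = (\<Union>x\<in>X. B +> (r \<otimes> x))"
  by (auto simp: ideal_quot_def quot_module_def self_module_def A_RCOSETS_defs a_r_coset_def'
      RCOSETS_def r_coset_def set_add_defs)

context
  fixes A B
  assumes A: "ideal A R" and B: "ideal B R" and BA: "B \<subseteq> A"
begin

interpretation B: ideal B R by (rule B)

lemma coset_eq_iff:
  assumes "a \<in> carrier R" "b \<in> carrier R"
  shows "B +> a = B +> b \<longleftrightarrow> a \<ominus> b \<in> B"
  using quotient_eq_iff_same_a_r_cos[OF B assms] by simp

lemma coset_add: "a \<in> A \<Longrightarrow> b \<in> A \<Longrightarrow> (B +> a) <+> (B +> b) = B +> (a \<oplus> b)"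
  using B.a_rcos_sum ideal_mem_carrier[OF A] by blast

lemma coset_smult:
  assumes "r \<in> carrier R" "a \<in> A"
  shows "(\<Union>x\<in>B +> a. B +> (r \<otimes> x)) = B +> (r \<otimes> a)"
proof -
  have ac: "a \<in> carrier R" using assms ideal_mem_carrier[OF A] by blast
  have "B +> (r \<otimes> x) = B +> (r \<otimes> a)" if x: "x \<in> B +> a" for x
  proof -
    obtain b where b: "b \<in> B" "x = b \<oplus> a" using x by (auto simp: a_r_coset_def')
    have bc: "b \<in> carrier R" using b ideal_mem_carrier[OF B] by blast
    have "r \<otimes> x \<ominus> r \<otimes> a = r \<otimes> b"
      using b(2) bc ac assms(1) by (simp add: r_distr a_minus_def a_assoc r_neg)
    then show ?thesis
      using coset_eq_iff[of "r \<otimes> x" "r \<otimes> a"] ideal_mult_mem[OF B assms(1) b(1)] b(2) bc ac assms(1) by simp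
  qed
  moreover have "a \<in> B +> a" using B.a_rcos_self ac by blast
  ultimately show ?thesis by blast
qed

lemma coset_zero: "B +> \<zero> = B"
  using B.a_subset by simp

lemma group_ideal_quot: "group (add_monoid (ideal_quot R A B))"
proof (rule groupI)
  let ?G = "add_monoid (ideal_quot R A B)"
  have G: "carrier ?G = (\<lambda>a. B +> a) ` A" "mult ?G = (\<lambda>X Y. X <+> Y)" "one ?G = B"
    by (auto simp: carrier_ideal_quot add_ideal_quot zero_ideal_quot fun_eq_iff)
  show "x \<otimes>\<^bsub>?G\<^esub> y \<in> carrier ?G" if "x \<in> carrier ?G" "y \<in> carrier ?G" for x y
    using that ideal_add_mem[OF A] unfolding G by (auto simp: coset_add)
  show "\<one>\<^bsub>?G\<^esub> \<in> carrier ?G" using ideal_zero_mem[OF A] coset_zero unfolding G by (metis image_eqI)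
  show "x \<otimes>\<^bsub>?G\<^esub> y \<otimes>\<^bsub>?G\<^esub> z = x \<otimes>\<^bsub>?G\<^esub> (y \<otimes>\<^bsub>?G\<^esub> z)"
    if "x \<in> carrier ?G" "y \<in> carrier ?G" "z \<in> carrier ?G" for x y z
    using that ideal_add_mem[OF A] ideal_mem_carrier[OF A] unfolding G by (auto simp: coset_add a_assoc)
  show "\<one>\<^bsub>?G\<^esub> \<otimes>\<^bsub>?G\<^esub> x = x" if x: "x \<in> carrier ?G" for x
  proof -
    obtain a where a: "a \<in> A" "x = B +> a" using x unfolding G by blast
    then have "(B +> \<zero>) <+> (B +> a) = B +> (\<zero> \<oplus> a)" by (intro coset_add ideal_zero_mem A)
    then show ?thesis using a ideal_mem_carrier[OF A] unfolding G coset_zero by simp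
  qed
  show "\<exists>y\<in>carrier ?G. y \<otimes>\<^bsub>?G\<^esub> x = \<one>\<^bsub>?G\<^esub>" if x: "x \<in> carrier ?G" for x
  proof -
    obtain a where a: "a \<in> A" "x = B +> a" using x unfolding G by blast
    have m: "\<ominus> a \<in> A" using a A by (simp add: additive_subgroup.a_inv_closed ideal.axioms(1))
    have "(B +> \<ominus> a) <+> (B +> a) = B" using a m ideal_mem_carrier[OF A] by (simp add: coset_add l_neg coset_zero)
    then show ?thesis using m a(2) unfolding G by blast
  qed
qed

lemma ideal_of_submodule:
  assumes X: "submodule X R (ideal_quot R A B)"
  shows "ideal {a \<in> A. B +> a \<in> X} R" "B \<subseteq> {a \<in> A. B +> a \<in> X}" "(\<lambda>a. B +> a) ` {a \<in> A. B +> a \<in> X} = X"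
proof -
  interpret X: submodule X R "ideal_quot R A B" by (rule X)
  have zero: "B \<in> X" using X.one_closed by (simp add: zero_ideal_quot)
  have add: "(B +> a) <+> (B +> b) \<in> X" if "B +> a \<in> X" "B +> b \<in> X" for a b
    using X.m_closed[OF that] by (simp add: add_ideal_quot)
  have smult: "(\<Union>x\<in>B +> a. B +> (r \<otimes> x)) \<in> X" if "r \<in> carrier R" "B +> a \<in> X" for r a
    using X.smult_closed[OF that] by (simp add: smult_ideal_quot)
  show "ideal {a \<in> A. B +> a \<in> X} R"
  proof (rule cring_idealI)
    show "\<zero> \<in> {a \<in> A. B +> a \<in> X}" using zero coset_zero ideal_zero_mem[OF A] by simp
    show "a \<oplus> b \<in> {a \<in> A. B +> a \<in> X}" if "a \<in> {a \<in> A. B +> a \<in> X}" "b \<in> {a \<in> A. B +> a \<in> X}" for a b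
      using that add[of a b] ideal_add_mem[OF A] by (simp add: coset_add)
    show "r \<otimes> a \<in> {a \<in> A. B +> a \<in> X}" if "r \<in> carrier R" "a \<in> {a \<in> A. B +> a \<in> X}" for r a
      using that smult[of r a] ideal_mult_mem[OF A] by (simp add: coset_smult)
  qed (use ideal_mem_carrier[OF A] in blast)
  show "B \<subseteq> {a \<in> A. B +> a \<in> X}"
  proof
    fix b assume b: "b \<in> B"
    then have "b \<in> carrier R" "b \<ominus> \<zero> \<in> B" using ideal_mem_carrier[OF B] by (simp_all add: a_minus_def)
    then have "B +> b = B" using coset_eq_iff[of b \<zero>] coset_zero by simp
    then show "b \<in> {a \<in> A. B +> a \<in> X}" using zero b BA by auto
  qed
  have "X \<subseteq> (\<lambda>a. B +> a) ` A" using X.subset by (simp add: carrier_ideal_quot)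
  then show "(\<lambda>a. B +> a) ` {a \<in> A. B +> a \<in> X} = X" by blast
qed

lemma submodule_of_ideal:
  assumes N: "ideal N R" "B \<subseteq> N" "N \<subseteq> A"
  shows "submodule ((\<lambda>a. B +> a) ` N) R (ideal_quot R A B)" "{a \<in> A. B +> a \<in> (\<lambda>a. B +> a) ` N} = N"
proof -
  show "submodule ((\<lambda>a. B +> a) ` N) R (ideal_quot R A B)"
  proof (intro submodule.intro submodule_axioms.intro)
    show "subgroup ((\<lambda>a. B +> a) ` N) (add_monoid (ideal_quot R A B))"
    proof (rule subgroup.intro)
      show "(\<lambda>a. B +> a) ` N \<subseteq> carrier (add_monoid (ideal_quot R A B))"
        using N by (auto simp: carrier_ideal_quot)
      show "x \<otimes>\<^bsub>add_monoid (ideal_quot R A B)\<^esub> y \<in> (\<lambda>a. B +> a) ` N"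
        if xy: "x \<in> (\<lambda>a. B +> a) ` N" "y \<in> (\<lambda>a. B +> a) ` N" for x y
      proof -
        obtain a b where ab: "a \<in> N" "b \<in> N" "x = B +> a" "y = B +> b" using xy by blast
        then have "x <+> y = B +> (a \<oplus> b)" using coset_add N by blast
        then show ?thesis using ideal_add_mem[OF N(1) ab(1,2)] by (simp add: add_ideal_quot)
      qed
      show "\<one>\<^bsub>add_monoid (ideal_quot R A B)\<^esub> \<in> (\<lambda>a. B +> a) ` N"
        using ideal_zero_mem[OF N(1)] coset_zero by (simp add: zero_ideal_quot) (metis image_eqI)
      show "inv\<^bsub>add_monoid (ideal_quot R A B)\<^esub> x \<in> (\<lambda>a. B +> a) ` N" if x: "x \<in> (\<lambda>a. B +> a) ` N" for x
      proof -
        obtain a where a: "a \<in> N" "x = B +> a" using x by blast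
        have m: "\<ominus> a \<in> N" using a N by (simp add: additive_subgroup.a_inv_closed ideal.axioms(1))
        have "(B +> \<ominus> a) <+> (B +> a) = B +> (\<ominus> a \<oplus> a)" using m a N by (intro coset_add) auto
        also have "\<dots> = B" using a ideal_mem_carrier[OF N(1)] by (simp add: l_neg coset_zero)
        finally have "inv\<^bsub>add_monoid (ideal_quot R A B)\<^esub> x = B +> \<ominus> a"
          using m a N by (intro group.inv_equality[OF group_ideal_quot])
            (auto simp: add_ideal_quot zero_ideal_quot carrier_ideal_quot)
        then show ?thesis using m by blast
      qed
    qed
    show "r \<odot>\<^bsub>ideal_quot R A B\<^esub> x \<in> (\<lambda>a. B +> a) ` N" if r: "r \<in> carrier R" and x: "x \<in> (\<lambda>a. B +> a) ` N" for r x
    proof -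
      obtain a where a: "a \<in> N" "x = B +> a" using x by blast
      then have "r \<odot>\<^bsub>ideal_quot R A B\<^esub> x = B +> (r \<otimes> a)"
        using coset_smult[OF r, of a] N by (auto simp: smult_ideal_quot)
      then show ?thesis using ideal_mult_mem[OF N(1) r a(1)] by blast
    qed
  qed
  show "{a \<in> A. B +> a \<in> (\<lambda>a. B +> a) ` N} = N"
  proof
    show "N \<subseteq> {a \<in> A. B +> a \<in> (\<lambda>a. B +> a) ` N}" using N by blast
    show "{a \<in> A. B +> a \<in> (\<lambda>a. B +> a) ` N} \<subseteq> N"
    proof
      fix a assume "a \<in> {a \<in> A. B +> a \<in> (\<lambda>a. B +> a) ` N}"
      then obtain n where n: "a \<in> A" "n \<in> N" "B +> a = B +> n" by blast
      have "a \<in> carrier R" using n ideal_mem_carrier[OF A] by blast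
      then have "a \<in> B +> n" using B.a_rcos_self n(3) by metis
      then obtain b where "b \<in> B" "a = b \<oplus> n" by (auto simp: a_r_coset_def')
      then show "a \<in> N" using ideal_add_mem[OF N(1)] n(2) N(2) by blast
    qed
  qed
qed

text \<open>Correspondence theorem: preimage and image under the projection from \<open>A\<close> to
  \<open>A/B\<close> are mutually inverse and monotone, hence carry strict chains to strict
  chains.\<close>

lemma module_length_ideal_quot: "module_length R (ideal_quot R A B) = ideal_length R A B"
proof -
  have "(\<exists>N. (\<forall>j\<le>n. submodule (N j) R (ideal_quot R A B)) \<and> (\<forall>j<n. N j \<subset> N (Suc j))) \<longleftrightarrow>
    (\<exists>N. (\<forall>j\<le>n. ideal (N j) R \<and> B \<subseteq> N j \<and> N j \<subseteq> A) \<and> (\<forall>j<n. N j \<subset> N (Suc j)))" (is "?l \<longleftrightarrow> ?r") for n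
  proof
    assume ?l
    then obtain N where "(\<forall>j\<le>n. submodule (N j) R (ideal_quot R A B)) \<and> (\<forall>j<n. N j \<subset> N (Suc j))"
      by (rule exE)
    then have N: "\<forall>j\<le>n. submodule (N j) R (ideal_quot R A B)" "\<forall>j<n. N j \<subset> N (Suc j)" by simp_all
    define M where "M j = {a \<in> A. B +> a \<in> N j}" for j
    have "M j \<subset> M (Suc j)" if "j < n" for j
    proof -
      have sub: "N j \<subset> N (Suc j)" using N(2) that by simp
      moreover have "(\<lambda>a. B +> a) ` M j = N j" "(\<lambda>a. B +> a) ` M (Suc j) = N (Suc j)"
        unfolding M_def using N(1) that ideal_of_submodule(3) by simp_all
      ultimately have "M j \<noteq> M (Suc j)" by force
      moreover have "M j \<subseteq> M (Suc j)" unfolding M_def using sub by auto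
      ultimately show ?thesis by blast
    qed
    moreover have "ideal (M j) R \<and> B \<subseteq> M j \<and> M j \<subseteq> A" if "j \<le> n" for j
      using ideal_of_submodule(1,2)[OF N(1)[rule_format, OF that]] unfolding M_def by blast
    ultimately show ?r by (intro exI[of _ M]) simp
  next
    assume ?r
    then obtain N where "(\<forall>j\<le>n. ideal (N j) R \<and> B \<subseteq> N j \<and> N j \<subseteq> A) \<and> (\<forall>j<n. N j \<subset> N (Suc j))"
      by (rule exE)
    then have N: "\<forall>j\<le>n. ideal (N j) R \<and> B \<subseteq> N j \<and> N j \<subseteq> A" "\<forall>j<n. N j \<subset> N (Suc j)" by simp_all
    define M where "M j = (\<lambda>a. B +> a) ` N j" for j
    have "M j \<subset> M (Suc j)" if "j < n" for j
    proof -
      have sub: "N j \<subset> N (Suc j)" using N(2) that by simp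
      moreover have "{a \<in> A. B +> a \<in> M j} = N j" "{a \<in> A. B +> a \<in> M (Suc j)} = N (Suc j)"
        unfolding M_def using N(1) that submodule_of_ideal(2) by simp_all
      ultimately have "M j \<noteq> M (Suc j)" by force
      moreover have "M j \<subseteq> M (Suc j)" unfolding M_def using sub by auto
      ultimately show ?thesis by blast
    qed
    moreover have "submodule (M j) R (ideal_quot R A B)" if "j \<le> n" for j
      unfolding M_def using N(1) that submodule_of_ideal(1) by simp
    ultimately show ?l by (intro exI[of _ M]) simp
  qed
  then show ?thesis unfolding module_length_def ideal_length_def by simp
qed

end

end

section \<open>Noetherian local rings\<close>

text \<open>In a Noetherian ring the union of a nonempty chain of ideals is a member of the chain,
  so Zorn's lemma applies. Noetherian induction is used in this form: a maximal counterexample is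
  chosen.\<close>

lemma (in noetherian_ring) maximal_ideal_in_family:
  assumes "S \<noteq> {}" "\<And>I. I \<in> S \<Longrightarrow> ideal I R"
  obtains M where "M \<in> S" "\<forall>K\<in>S. M \<subseteq> K \<longrightarrow> K = M"
proof -
  have "\<exists>M\<in>S. \<forall>X\<in>S. M \<subseteq> X \<longrightarrow> X = M"
  proof (rule subset_Zorn_nonempty[OF assms(1)])
    fix C assume C: "C \<noteq> {}" "subset.chain S C"
    then have "subset.chain {I. ideal I R} C" using assms(2) unfolding subset_chain_def by blast
    then have "\<Union>C \<in> C" using ideal_chain_is_trivial C(1) by blast
    then show "\<Union>C \<in> S" using C(2) unfolding subset_chain_def by blast
  qed
  then show thesis using that by blast
qed

lemma (in cring) ideal_prod_least:
  assumes "ideal C R" "\<And>a b. a \<in> A \<Longrightarrow> b \<in> B \<Longrightarrow> a \<otimes> b \<in> C"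
  shows "A \<cdot> B \<subseteq> C"
proof
  fix s assume "s \<in> A \<cdot> B"
  then show "s \<in> C"
    by (induction rule: ideal_prod.induct) (use assms ideal_add_mem in auto)
qed

context noetherian_local_ring
begin

lemma maximal_is_ideal: "ideal \<mm> R"
  using maximal by (rule maximalideal.axioms)

lemma one_not_in_maximal: "\<one> \<notin> \<mm>"
proof
  assume "\<one> \<in> \<mm>"
  then have "\<mm> = carrier R" using ideal.one_imp_carrier[OF maximal_is_ideal] by blast
  then show False using maximalideal.I_notcarr[OF maximal] by simp
qed

lemma proper_ideal_subset_maximal:
  assumes "ideal J R" "J \<noteq> carrier R"
  shows "J \<subseteq> \<mm>"
proof -
  define S where "S = {K. ideal K R \<and> J \<subseteq> K \<and> K \<noteq> carrier R}"
  obtain M where M: "M \<in> S" "\<forall>K\<in>S. M \<subseteq> K \<longrightarrow> K = M"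
  proof (rule maximal_ideal_in_family)
    show "S \<noteq> {}" "\<And>I. I \<in> S \<Longrightarrow> ideal I R" unfolding S_def using assms by auto
  qed
  have "maximalideal M R"
  proof (rule maximalidealI)
    show "ideal M R" "carrier R \<noteq> M" using M(1) unfolding S_def by auto
    show "K = M \<or> K = carrier R" if "ideal K R" "M \<subseteq> K" "K \<subseteq> carrier R" for K
      using M(2)[rule_format, of K] that M(1) unfolding S_def by auto
  qed
  then have "M = \<mm>" by (rule maximal_unique)
  then show ?thesis using M(1) unfolding S_def by blast
qed

text \<open>This is division by the unit \<open>1 - \<mu>\<close>: the ideal of all \<open>a\<close>
  with \<open>b a \<in> J\<close> contains \<open>1 - \<mu>\<close>, is therefore not inside
  \<open>\<mm>\<close>, and so is the whole ring.\<close>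

lemma one_minus_maximal_cancel:
  assumes "\<mu> \<in> \<mm>" "b \<in> carrier R" "ideal J R" "b \<ominus> b \<otimes> \<mu> \<in> J"
  shows "b \<in> J"
proof -
  define K where "K = {a \<in> carrier R. b \<otimes> a \<in> J}"
  have K: "ideal K R" unfolding K_def using ideal_colon assms oneideal by blast
  have mc: "\<mu> \<in> carrier R" using assms maximal_is_ideal ideal_mem_carrier by blast
  have "b \<otimes> (\<one> \<ominus> \<mu>) = b \<ominus> b \<otimes> \<mu>" using assms mc by (simp add: a_minus_def r_distr r_minus)
  then have in_K: "\<one> \<ominus> \<mu> \<in> K" unfolding K_def using assms mc by simp
  have "K = carrier R"
  proof (rule ccontr)
    assume "K \<noteq> carrier R"
    then have "\<one> \<ominus> \<mu> \<in> \<mm>" using proper_ideal_subset_maximal[OF K] in_K by blast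
    then have "\<mu> \<oplus> (\<one> \<ominus> \<mu>) \<in> \<mm>" using ideal_add_mem[OF maximal_is_ideal] assms(1) by blast
    moreover have "\<mu> \<oplus> (\<one> \<ominus> \<mu>) = \<one>" using mc by (simp add: a_minus_def a_comm[of \<one>] r_neg2)
    ultimately show False using one_not_in_maximal by simp
  qed
  then have "\<one> \<in> K" by simp
  then show ?thesis unfolding K_def using assms by simp
qed

text \<open>No generators of \<open>A\<close> are chosen. With \<open>M\<close> maximal among the
  ideals that contain \<open>B\<close> and lie properly inside \<open>A\<close>, any
  \<open>a\<close> in \<open>A\<close> outside \<open>M\<close> gives \<open>A = M + a R\<close>.
  The hypothesis then puts \<open>a\<close> in \<open>M + a \<mm>\<close>, and the preceding
  cancellation puts it in \<open>M\<close>.\<close>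

lemma nakayama:
  assumes A: "ideal A R" and B: "ideal B R" and BA: "B \<subseteq> A" and sub: "A \<subseteq> B <+> \<mm> \<cdot> A"
  shows "A = B"
proof (rule ccontr)
  assume "A \<noteq> B"
  define S where "S = {K. ideal K R \<and> B \<subseteq> K \<and> K \<subseteq> A \<and> K \<noteq> A}"
  obtain M where MS: "M \<in> S" and Mmax: "\<forall>K\<in>S. M \<subseteq> K \<longrightarrow> K = M"
  proof (rule maximal_ideal_in_family)
    show "S \<noteq> {}" "\<And>I. I \<in> S \<Longrightarrow> ideal I R" unfolding S_def using B BA \<open>A \<noteq> B\<close> by auto
  qed
  then have M: "ideal M R" "B \<subseteq> M" "M \<subseteq> A" "M \<noteq> A" unfolding S_def by auto
  obtain a where a: "a \<in> A" "a \<notin> M" using M by blast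
  have ac: "a \<in> carrier R" using a A ideal_mem_carrier by blast
  define P where "P = M <+> (\<lambda>z. a \<otimes> z) ` carrier R"
  have aR: "ideal ((\<lambda>z. a \<otimes> z) ` carrier R) R" using ideal_cmult[OF oneideal ac] .
  have P: "ideal P R" unfolding P_def using add_ideals M(1) aR by blast
  have MP: "M \<subseteq> P" unfolding P_def by (rule set_add_ub1[OF M(1) aR])
  have "a \<otimes> \<one> \<in> P" unfolding P_def using set_add_ub2[OF M(1) aR] by blast
  then have "a \<in> P" using ac by simp
  have aRA: "(\<lambda>z. a \<otimes> z) ` carrier R \<subseteq> A" using ideal.I_r_closed[OF A a(1)] by blast
  have "P \<subseteq> A" unfolding P_def using set_add_lub[OF A M(3) aRA] .
  then have AP: "A = P"
    using Mmax[rule_format, of P] P MP M(2) \<open>a \<in> P\<close> a(2) unfolding S_def by blast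
  define T where "T = M <+> (\<lambda>z. a \<otimes> z) ` \<mm>"
  have am: "ideal ((\<lambda>z. a \<otimes> z) ` \<mm>) R" using ideal_cmult[OF maximal_is_ideal ac] .
  have T: "ideal T R" unfolding T_def using add_ideals M(1) am by blast
  have "\<mm> \<cdot> A \<subseteq> T"
  proof (rule ideal_prod_least[OF T])
    fix \<mu> x assume \<mu>: "\<mu> \<in> \<mm>" and x: "x \<in> A"
    obtain m y where m: "m \<in> M" "y \<in> (\<lambda>z. a \<otimes> z) ` carrier R" "x = m \<oplus> y"
      using x unfolding AP P_def by (rule set_add_memE)
    then obtain r where r: "r \<in> carrier R" "y = a \<otimes> r" by blast
    have c: "\<mu> \<in> carrier R" "m \<in> carrier R"
      using \<mu> m M(1) maximal_is_ideal ideal_mem_carrier by blast+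
    have "\<mu> \<otimes> x = \<mu> \<otimes> m \<oplus> a \<otimes> (\<mu> \<otimes> r)" using c r ac m(3) by (simp add: r_distr m_lcomm)
    moreover have "\<mu> \<otimes> m \<in> M" using ideal_mult_mem[OF M(1)] c m by blast
    moreover have "\<mu> \<otimes> r \<in> \<mm>" using ideal.I_r_closed[OF maximal_is_ideal \<mu>] r by blast
    ultimately show "\<mu> \<otimes> x \<in> T" unfolding T_def using set_add_memI by auto
  qed
  then have "A \<subseteq> T"
    using sub set_add_lub[OF T, of B "\<mm> \<cdot> A"] M(2) set_add_ub1[OF M(1) am] unfolding T_def by blast
  then have "a \<in> M <+> (\<lambda>z. a \<otimes> z) ` \<mm>" using a unfolding T_def by blast
  then obtain m y where m: "m \<in> M" "y \<in> (\<lambda>z. a \<otimes> z) ` \<mm>" "a = m \<oplus> y" by (rule set_add_memE)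
  then obtain \<mu> where \<mu>: "\<mu> \<in> \<mm>" "y = a \<otimes> \<mu>" by blast
  have c: "\<mu> \<in> carrier R" "m \<in> carrier R"
    using \<mu> m M(1) maximal_is_ideal ideal_mem_carrier by blast+
  have "a \<ominus> a \<otimes> \<mu> = (m \<oplus> a \<otimes> \<mu>) \<ominus> a \<otimes> \<mu>" using m(3) \<mu>(2) by simp
  also have "\<dots> = m" using c ac by (simp add: a_minus_def a_assoc r_neg)
  finally have "a \<ominus> a \<otimes> \<mu> \<in> M" using m(1) by simp
  then have "a \<in> M" using one_minus_maximal_cancel[OF \<mu>(1) ac M(1)] by blast
  then show False using a by blast
qed

lemma ideal_length_residue_field: "ideal_length R (carrier R) \<mm> \<le> 1"
proof -
  have "\<not> enat 2 \<le> ideal_length R (carrier R) \<mm>"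
  proof
    assume "enat 2 \<le> ideal_length R (carrier R) \<mm>"
    with maximal_is_ideal ideal_subset_carrier[OF maximal_is_ideal]
    obtain N where N: "\<forall>l\<le>2::nat. ideal (N l) R" "\<forall>l\<le>2::nat. \<mm> \<subseteq> N l"
      "\<forall>l\<le>2::nat. N l \<subseteq> carrier R" "\<forall>l<2::nat. N l \<subset> N (Suc l)"
      by (rule ideal_length_geE)
    have "N 0 \<subset> N 1" "N 1 \<subset> N 2" using N(4) by (auto simp: numeral_2_eq_2)
    moreover have "N 2 \<subseteq> carrier R" "\<mm> \<subseteq> N 0" "ideal (N 1) R" using N by simp_all
    moreover have "N 1 = \<mm> \<or> N 1 = carrier R"
      using maximalideal.I_maximal[OF maximal, of "N 1"] N(1-3) by simp
    ultimately show False by blast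
  qed
  then show ?thesis
    by (cases "ideal_length R (carrier R) \<mm>") (auto simp: one_enat_def)
qed

text \<open>Among the colon ideals \<open>(J : a)\<close> with \<open>a \<notin> J\<close> take a
  maximal one. If \<open>a \<mu>\<close> were outside \<open>J\<close>, the last power with
  \<open>a \<mu>\<^sup>k \<notin> J\<close> would give a colon ideal that contains the maximal one
  and also \<open>\<mu>\<close>.\<close>

lemma exists_socle_element:
  assumes J: "ideal J R" "J \<noteq> carrier R" and nil: "\<And>\<mu>. \<mu> \<in> \<mm> \<Longrightarrow> \<exists>n::nat. \<mu> [^] n \<in> J"
  shows "\<exists>a\<in>carrier R. a \<notin> J \<and> (\<forall>\<mu>\<in>\<mm>. a \<otimes> \<mu> \<in> J)"
proof -
  define S where "S = (\<lambda>a. {b \<in> carrier R. a \<otimes> b \<in> J}) ` (carrier R - J)"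
  obtain M where M: "M \<in> S" "\<forall>K\<in>S. M \<subseteq> K \<longrightarrow> K = M"
  proof (rule maximal_ideal_in_family)
    show "S \<noteq> {}" unfolding S_def using J ideal_subset_carrier by blast
    show "\<And>I. I \<in> S \<Longrightarrow> ideal I R" unfolding S_def using ideal_colon[OF J(1) oneideal] by blast
  qed
  then obtain a where a: "a \<in> carrier R" "a \<notin> J" "M = {b \<in> carrier R. a \<otimes> b \<in> J}"
    unfolding S_def by blast
  have "a \<otimes> \<mu> \<in> J" if \<mu>: "\<mu> \<in> \<mm>" for \<mu>
  proof (rule ccontr)
    assume not_in: "a \<otimes> \<mu> \<notin> J"
    have mc: "\<mu> \<in> carrier R" using \<mu> maximal_is_ideal ideal_mem_carrier by blast
    define n where "n = (LEAST n::nat. a \<otimes> \<mu> [^] n \<in> J)"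
    obtain n0 :: nat where "\<mu> [^] n0 \<in> J" using nil[OF \<mu>] by blast
    then have "a \<otimes> \<mu> [^] n0 \<in> J" using ideal_mult_mem J(1) a(1) by blast
    then have n: "a \<otimes> \<mu> [^] n \<in> J" unfolding n_def by (rule LeastI)
    then obtain k where k: "n = Suc k" using a mc by (cases n) auto
    have k_notin: "a \<otimes> \<mu> [^] k \<notin> J" using not_less_Least[of k] k unfolding n_def[symmetric]
      by (metis lessI n_def not_less_Least)
    define K where "K = {b \<in> carrier R. (a \<otimes> \<mu> [^] k) \<otimes> b \<in> J}"
    have "K \<in> S" unfolding K_def S_def using k_notin a mc by blast
    moreover have "M \<subseteq> K"
    proof
      fix b assume "b \<in> M"
      then have b: "b \<in> carrier R" "a \<otimes> b \<in> J" using a by auto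
      have "(a \<otimes> \<mu> [^] k) \<otimes> b = \<mu> [^] k \<otimes> (a \<otimes> b)" using a b mc by (simp add: m_ac)
      then show "b \<in> K" unfolding K_def using ideal_mult_mem[OF J(1)] b mc by simp
    qed
    ultimately have "K = M" using M(2) by blast
    moreover have "\<mu> \<in> K" unfolding K_def using n k a mc by (simp add: m_assoc)
    ultimately show False using a not_in by blast
  qed
  then show ?thesis using a by blast
qed

text \<open>Take \<open>M\<close> maximal among the ideals above \<open>J\<close> of infinite
  colength. A socle element \<open>a\<close> of \<open>R/M\<close> gives the larger ideal
  \<open>a R + M\<close>, which has finite colength, and \<open>(a R + M)/M\<close> is an image of
  the residue field; additivity makes the colength of \<open>M\<close> finite.\<close>

theorem ideal_length_finite:
  assumes J: "ideal J R" and nil: "\<And>\<mu>. \<mu> \<in> \<mm> \<Longrightarrow> \<exists>n::nat. \<mu> [^] n \<in> J"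
  shows "ideal_length R (carrier R) J \<noteq> \<infinity>"
proof
  assume inf: "ideal_length R (carrier R) J = \<infinity>"
  define S where "S = {K. ideal K R \<and> J \<subseteq> K \<and> ideal_length R (carrier R) K = \<infinity>}"
  obtain M where MS: "M \<in> S" and Mmax: "\<forall>K\<in>S. M \<subseteq> K \<longrightarrow> K = M"
  proof (rule maximal_ideal_in_family)
    show "S \<noteq> {}" "\<And>I. I \<in> S \<Longrightarrow> ideal I R" unfolding S_def using J inf by auto
  qed
  then have M: "ideal M R" "J \<subseteq> M" "ideal_length R (carrier R) M = \<infinity>" unfolding S_def by auto
  have "M \<noteq> carrier R" using M(3) ideal_length_self[OF oneideal] by auto
  then obtain a where a: "a \<in> carrier R" "a \<notin> M" "\<And>\<mu>. \<mu> \<in> \<mm> \<Longrightarrow> a \<otimes> \<mu> \<in> M"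
    using exists_socle_element[OF M(1)] nil M(2) by blast
  define K where "K = (\<lambda>z. a \<otimes> z) ` carrier R <+> M"
  have aR: "ideal ((\<lambda>z. a \<otimes> z) ` carrier R) R" using ideal_cmult[OF oneideal a(1)] .
  have K: "ideal K R" unfolding K_def using add_ideals M(1) aR by blast
  have MK: "M \<subseteq> K" unfolding K_def by (rule set_add_ub2[OF aR M(1)])
  have "a \<otimes> \<one> \<in> K" unfolding K_def using set_add_ub1[OF aR M(1)] by blast
  then have "K \<noteq> M" using a by auto
  then have "K \<notin> S" using Mmax MK by blast
  then have finK: "ideal_length R (carrier R) K \<noteq> \<infinity>" unfolding S_def using K MK M(2) by auto
  have "ideal_length R K M \<le> ideal_length R (carrier R) \<mm>"
    using a MK ideal_subset_carrier[OF maximal_is_ideal] unfolding K_def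
    by (intro ideal_length_le_of_surj oneideal maximal_is_ideal K[unfolded K_def] M(1)) auto
  also have "\<dots> \<le> 1" by (rule ideal_length_residue_field)
  finally have "ideal_length R K M \<noteq> \<infinity>"
    by (cases "ideal_length R K M") (auto simp: one_enat_def)
  then have "ideal_length R (carrier R) M \<noteq> \<infinity>"
    unfolding ideal_length_add[OF oneideal K M(1) MK ideal_subset_carrier[OF K]] using finK by auto
  then show False using M(3) by simp
qed

end

section \<open>Powers of ideals generated by a sequence\<close>

declare nat_pow_Suc [simp del]

context cring
begin

abbreviation ipow :: "'a set \<Rightarrow> nat \<Rightarrow> 'a set" where
  "ipow I n \<equiv> I [^]\<^bsub>ideals_set R\<^esub> n"

lemma ipow_0: "ipow I 0 = carrier R"
  by (simp add: ideals_set_def)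

lemma ipow_Suc: "ipow I (Suc n) = ipow I n \<cdot> I"
  by (simp add: ideals_set_def Group.nat_pow_Suc)

lemma ipow_ideal: "ideal I R \<Longrightarrow> ideal (ipow I n) R"
  by (induction n) (simp_all only: ipow_0 ipow_Suc oneideal ideal_prod_is_ideal)

lemma ideal_prod_mono:
  assumes "A \<subseteq> A'" "B \<subseteq> B'"
  shows "A \<cdot> B \<subseteq> A' \<cdot> B'"
proof
  fix s assume "s \<in> A \<cdot> B"
  then show "s \<in> A' \<cdot> B'"
    by (induction rule: ideal_prod.induct) (use assms in \<open>auto intro: ideal_prod.intros\<close>)
qed

lemma ideal_prod_subset1: "ideal A R \<Longrightarrow> ideal B R \<Longrightarrow> A \<cdot> B \<subseteq> A"
  and ideal_prod_subset2: "ideal A R \<Longrightarrow> ideal B R \<Longrightarrow> A \<cdot> B \<subseteq> B"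
  using ideal_prod_inter by blast+

lemma ipow_mono: "I \<subseteq> J \<Longrightarrow> ipow I n \<subseteq> ipow J n"
  by (induction n) (simp_all only: ipow_0 ipow_Suc order_refl ideal_prod_mono)

lemma ideal_prod_ipow_0: "ideal A R \<Longrightarrow> A \<cdot> ipow I 0 = A"
  by (simp only: ipow_0 ideal_prod_one)

lemma ideal_prod_ipow_Suc:
  "ideal A R \<Longrightarrow> ideal I R \<Longrightarrow> A \<cdot> ipow I (Suc n) = (A \<cdot> ipow I n) \<cdot> I"
  by (simp only: ipow_Suc ideal_prod_assoc ipow_ideal)

lemma carrier_prod: "ideal A R \<Longrightarrow> carrier R \<cdot> A = A"
  using ideal_prod_commute ideal_prod_one oneideal by metis

lemma ipow_add:
  assumes "ideal I R"
  shows "ipow I (m + n) = ipow I m \<cdot> ipow I n"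
proof (induction n)
  case 0
  show ?case using ideal_prod_ipow_0[OF ipow_ideal[OF assms]] by simp
next
  case (Suc n)
  then show ?case
    by (simp only: add_Suc_right ipow_Suc ideal_prod_assoc ipow_ideal assms)
qed

lemma ipow_1: "ideal I R \<Longrightarrow> ipow I (Suc 0) = I"
  by (simp only: ipow_Suc ipow_0 carrier_prod)

lemma ipow_antimono:
  assumes "ideal I R" "m \<le> n"
  shows "ipow I n \<subseteq> ipow I m"
proof -
  obtain k where "n = m + k" using assms le_Suc_ex by blast
  then show ?thesis using ideal_prod_subset1 ipow_ideal assms by (simp only: ipow_add)
qed

lemma zero_ideal_ipow_Suc: "ipow {\<zero>} (Suc n) = {\<zero>}"
  using ideal_prod_zero[OF ipow_ideal[OF zeroideal]] by (simp only: ipow_Suc)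

lemma set_add_cmultE:
  assumes "b \<in> J <+> (\<lambda>z. x \<otimes> z) ` M"
  obtains u r where "u \<in> J" "r \<in> M" "b = u \<oplus> x \<otimes> r"
  using assms unfolding set_add_def' by blast

text \<open>A product of \<open>n + 1\<close> elements \<open>u + x r\<close> of \<open>I\<close>,
  once expanded, has terms with all factors in \<open>J\<close> and terms with a factor
  \<open>x\<close>. Iterated over the generators this replaces the expansion of a form in
  monomials.\<close>

lemma prod_ipow_Suc_split:
  assumes id: "ideal A R" "ideal J R" and x: "x \<in> carrier R"
    and I: "I = J <+> (\<lambda>z. x \<otimes> z) ` carrier R"
  shows "A \<cdot> ipow I (Suc n) \<subseteq> A \<cdot> ipow J (Suc n) <+> (\<lambda>z. x \<otimes> z) ` (A \<cdot> ipow I n)"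
proof -
  define T where "T n = A \<cdot> ipow J (Suc n) <+> (\<lambda>z. x \<otimes> z) ` (A \<cdot> ipow I n)" for n
  have idI: "ideal I R" unfolding I by (intro add_ideals id ideal_cmult oneideal x)
  have AI: "ideal (A \<cdot> ipow I n) R" and AJ: "ideal (A \<cdot> ipow J n) R" for n
    using id idI ipow_ideal ideal_prod_is_ideal by blast+
  have idT: "ideal (T n) R" for n
    unfolding T_def by (intro add_ideals AI AJ ideal_cmult x)
  have T1: "A \<cdot> ipow J (Suc n) \<subseteq> T n" and T2: "(\<lambda>z. x \<otimes> z) ` (A \<cdot> ipow I n) \<subseteq> T n" for n
    unfolding T_def
    by (rule set_add_ub1[OF AJ ideal_cmult[OF AI x]], rule set_add_ub2[OF AJ ideal_cmult[OF AI x]])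
  have "A \<cdot> ipow I (Suc n) \<subseteq> T n"
  proof (induction n)
    case 0
    have "A \<cdot> I \<subseteq> T 0"
    proof (rule ideal_prod_least[OF idT])
      fix a b assume a: "a \<in> A" and b: "b \<in> I"
      obtain u r where u: "u \<in> J" and r: "r \<in> carrier R" and bu: "b = u \<oplus> x \<otimes> r"
        using b unfolding I by (rule set_add_cmultE)
      have c: "a \<in> carrier R" "u \<in> carrier R" using a u id ideal_mem_carrier by blast+
      have "a \<otimes> b = a \<otimes> u \<oplus> x \<otimes> (r \<otimes> a)"
        using r c x unfolding bu by algebra
      moreover have "a \<otimes> u \<in> T 0"
        using T1[of 0] ideal_prod.prod[OF a u, of R] by (simp only: ipow_1 id) blast
      moreover have "x \<otimes> (r \<otimes> a) \<in> T 0"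
        using T2[of 0] ideal_mult_mem[OF id(1) r(1) a] by (simp only: ideal_prod_ipow_0 id) blast
      ultimately show "a \<otimes> b \<in> T 0" using ideal_add_mem[OF idT] by simp
    qed
    then show ?case by (simp only: ipow_1 idI)
  next
    case (Suc n)
    have "(A \<cdot> ipow I (Suc n)) \<cdot> I \<subseteq> T (Suc n)"
    proof (rule ideal_prod_least[OF idT])
      fix a b assume a: "a \<in> A \<cdot> ipow I (Suc n)" and b: "b \<in> I"
      obtain u r where u: "u \<in> J" and r: "r \<in> carrier R" and bu: "b = u \<oplus> x \<otimes> r"
        using b unfolding I by (rule set_add_cmultE)
      have "a \<in> T n" using Suc a by blast
      then obtain p w where p: "p \<in> A \<cdot> ipow J (Suc n)" and w: "w \<in> A \<cdot> ipow I n" and ap: "a = p \<oplus> x \<otimes> w"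
        unfolding T_def by (rule set_add_cmultE)
      have c: "a \<in> carrier R" "u \<in> carrier R" "p \<in> carrier R" "w \<in> carrier R"
        using a u id p w AI AJ ideal_mem_carrier by blast+
      have "a \<otimes> b = a \<otimes> u \<oplus> x \<otimes> (r \<otimes> a)"
        using r c x unfolding bu by algebra
      moreover have "a \<otimes> u = p \<otimes> u \<oplus> x \<otimes> (w \<otimes> u)"
        using c x unfolding ap by algebra
      moreover have "p \<otimes> u \<in> T (Suc n)"
        using T1[of "Suc n"] ideal_prod.prod[OF p u, of R]
        unfolding ideal_prod_ipow_Suc[OF id, of "Suc n"] by blast
      moreover have "u \<in> I" unfolding I using set_add_ub1[OF id(2) ideal_cmult[OF oneideal x]] u by blast
      then have "x \<otimes> (w \<otimes> u) \<in> T (Suc n)"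
        using T2[of "Suc n"] ideal_prod.prod[OF w, of u I R]
        unfolding ideal_prod_ipow_Suc[OF id(1) idI, of n] by blast
      moreover have "x \<otimes> (r \<otimes> a) \<in> T (Suc n)"
        using T2[of "Suc n"] ideal_mult_mem[OF AI r(1) a] by blast
      ultimately show "a \<otimes> b \<in> T (Suc n)" using ideal_add_mem[OF idT] by simp
    qed
    then show ?case unfolding ideal_prod_ipow_Suc[OF id(1) idI, of "Suc n"] .
  qed
  then show ?thesis unfolding T_def .
qed

lemma add_cancel_scaled:
  assumes "p \<oplus> x \<otimes> a = v \<oplus> x \<otimes> b"
    and c: "p \<in> carrier R" "x \<in> carrier R" "a \<in> carrier R" "v \<in> carrier R" "b \<in> carrier R"
  shows "x \<otimes> (a \<ominus> b) = v \<ominus> p"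
proof -
  have "x \<otimes> (a \<ominus> b) = (p \<oplus> x \<otimes> a) \<ominus> x \<otimes> b \<ominus> p" using c by algebra
  also have "\<dots> = (v \<oplus> x \<otimes> b) \<ominus> x \<otimes> b \<ominus> p" using assms(1) by simp
  also have "\<dots> = v \<ominus> p" using c by algebra
  finally show ?thesis .
qed

lemma ideal_diff_mem_cancel:
  assumes "ideal J R" "a \<ominus> b \<in> J" "b \<in> J" "a \<in> carrier R"
  shows "a \<in> J"
proof -
  have "b \<in> carrier R" using assms ideal_mem_carrier by blast
  then have "(a \<ominus> b) \<oplus> b = a" using assms(4) by algebra
  then show ?thesis using ideal_add_mem[OF assms(1,2,3)] by simp
qed

end

text \<open>Regularity is added separately in \<open>regular_tower\<close>, since the growth
  comparison also needs a tower of elements not known to form a regular sequence.\<close>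

locale ideal_tower = cring R for R (structure) +
  fixes K :: "nat \<Rightarrow> 'a set" and x :: "nat \<Rightarrow> 'a" and d :: nat
  assumes K_0: "K 0 = {\<zero>}"
    and x_carrier: "m < d \<Longrightarrow> x m \<in> carrier R"
    and K_Suc: "m < d \<Longrightarrow> K (Suc m) = K m <+> (\<lambda>z. x m \<otimes> z) ` carrier R"
begin

lemma K_ideal: "m \<le> d \<Longrightarrow> ideal (K m) R"
  by (induction m) (auto simp: K_0 K_Suc zeroideal intro!: add_ideals ideal_cmult oneideal x_carrier)

lemma K_le_Suc: "m < d \<Longrightarrow> K m \<subseteq> K (Suc m)"
  using set_add_ub1[OF K_ideal ideal_cmult[OF oneideal x_carrier]] by (simp add: K_Suc)

lemma x_mem: "m < d \<Longrightarrow> x m \<in> K (Suc m)"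
proof -
  assume m: "m < d"
  have "x m \<otimes> \<one> \<in> K (Suc m)"
    using set_add_ub2[OF K_ideal ideal_cmult[OF oneideal x_carrier], of m m] m by (auto simp: K_Suc)
  then show ?thesis using x_carrier[OF m] by simp
qed

lemma K_mono:
  assumes "n \<le> d" "m \<le> n"
  shows "K m \<subseteq> K n"
  using assms(2,1)
proof (induction rule: dec_induct)
  case (step k)
  then show ?case using K_le_Suc[of k] by auto
qed simp

lemma prod_K_ideal: "m \<le> d \<Longrightarrow> ideal A R \<Longrightarrow> ideal (A \<cdot> ipow (K m) n) R"
  by (intro ideal_prod_is_ideal ipow_ideal K_ideal)

lemma split_K:
  assumes "m < d" "ideal A R" "z \<in> A \<cdot> ipow (K (Suc m)) (Suc n)"
  obtains u w where "u \<in> A \<cdot> ipow (K m) (Suc n)" "w \<in> A \<cdot> ipow (K (Suc m)) n" "z = u \<oplus> x m \<otimes> w"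
proof -
  have "z \<in> A \<cdot> ipow (K m) (Suc n) <+> (\<lambda>z. x m \<otimes> z) ` (A \<cdot> ipow (K (Suc m)) n)"
    using prod_ipow_Suc_split[OF assms(2) K_ideal x_carrier K_Suc, of m] assms by auto
  then show thesis by (rule set_add_cmultE) (rule that)
qed

lemma x_mult_prod:
  assumes "m < d" "ideal A R" "w \<in> A \<cdot> ipow (K (Suc m)) n"
  shows "x m \<otimes> w \<in> A \<cdot> ipow (K (Suc m)) (Suc n)"
proof -
  have "w \<otimes> x m \<in> A \<cdot> ipow (K (Suc m)) (Suc n)"
    unfolding ideal_prod_ipow_Suc[OF assms(2) K_ideal[OF Suc_leI[OF assms(1)]]]
    using ideal_prod.prod[OF assms(3) x_mem[OF assms(1)]] .
  moreover have "w \<in> carrier R" using prod_K_ideal[of "Suc m" A n] assms ideal_mem_carrier by simp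
  ultimately show ?thesis using m_comm[of w "x m"] x_carrier assms by simp
qed

lemma prod_K_le_Suc: "m < d \<Longrightarrow> A \<cdot> ipow (K m) n \<subseteq> A \<cdot> ipow (K (Suc m)) n"
  by (intro ideal_prod_mono order_refl ipow_mono K_le_Suc)

lemma prod_K_subset_ipow: "m \<le> d \<Longrightarrow> ideal A R \<Longrightarrow> A \<cdot> ipow (K m) n \<subseteq> ipow (K m) n"
  by (intro ideal_prod_subset2 ipow_ideal K_ideal)

lemma ipow_Suc_subset_prod:
  assumes "m \<le> d" "ideal C R" "K m \<subseteq> C"
  shows "ipow (K m) (Suc n) \<subseteq> C \<cdot> ipow (K m) n"
  unfolding ipow_Suc ideal_prod_commute[OF ipow_ideal[OF K_ideal[OF assms(1)]] K_ideal[OF assms(1)]]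
  by (intro ideal_prod_mono order_refl assms)

lemma ipow_Suc_subset_prod':
  assumes "m < d" "ideal C R" "K m \<subseteq> C"
  shows "ipow (K m) (Suc n) \<subseteq> C \<cdot> ipow (K (Suc m)) n"
  using ipow_Suc_subset_prod[of m C n] prod_K_le_Suc[of m C n] assms by simp

text \<open>Powers of \<open>K m\<close> are spanned by monomials, and each monomial contributes at
  most one copy of \<open>A/B\<close>. The binomial counts the monomials of degree \<open>n\<close>
  in \<open>m\<close> variables; for \<open>m = 0\<close> the truncated \<open>n + 0 - 1\<close>
  gives the right count, one for \<open>n = 0\<close> and zero otherwise.\<close>

lemma ideal_length_prod_le:
  assumes A: "ideal A R" and B: "ideal B R" "B \<subseteq> A"
  shows "m \<le> d \<Longrightarrow> ideal_length R (A \<cdot> ipow (K m) n) (B \<cdot> ipow (K m) n)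
    \<le> of_nat ((n + m - 1) choose n) * ideal_length R A B"
proof (induction m arbitrary: n)
  case 0
  then show ?case
  proof (cases n)
    case (Suc k)
    then have "A \<cdot> ipow (K 0) n = {\<zero>}" "B \<cdot> ipow (K 0) n = {\<zero>}"
      using A B by (simp_all only: K_0 zero_ideal_ipow_Suc ideal_prod_zero)
    then show ?thesis by (simp add: ideal_length_self zeroideal)
  qed (simp only: ideal_prod_ipow_0 A B, simp)
next
  case (Suc m)
  then have m: "m < d" "m \<le> d" "Suc m \<le> d" by simp_all
  note IHm = Suc.IH
  show ?case
  proof (induction n)
    case 0
    show ?case by (simp only: ideal_prod_ipow_0 A B, simp)
  next
    case (Suc n)
    let ?X = "A \<cdot> ipow (K (Suc m)) (Suc n)" and ?Z = "B \<cdot> ipow (K (Suc m)) (Suc n)"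
    define W where "W = (\<lambda>z. x m \<otimes> z) ` (A \<cdot> ipow (K (Suc m)) n)"
    \<comment> \<open>\<open>Y\<close> separates the monomials that contain \<open>x m\<close>:
      \<open>?X/Y\<close> comes from degree \<open>n + 1\<close> in one generator fewer, and
      \<open>Y/?Z\<close> from degree \<open>n\<close> by multiplication with
      \<open>x m\<close>.\<close>
    define Y where "Y = W <+> ?Z"
    have X: "ideal ?X R" and Z: "ideal ?Z R" and ZX: "?Z \<subseteq> ?X" and W: "ideal W R"
      unfolding W_def
      by (rule prod_K_ideal[OF m(3) A], rule prod_K_ideal[OF m(3) B(1)], rule ideal_prod_mono[OF B(2) order_refl],
          rule ideal_cmult[OF prod_K_ideal[OF m(3) A] x_carrier[OF m(1)]])
    have Y: "ideal Y R" unfolding Y_def by (intro add_ideals W Z)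
    have ZY: "?Z \<subseteq> Y" and WY: "W \<subseteq> Y" unfolding Y_def
      by (rule set_add_ub2[OF W Z], rule set_add_ub1[OF W Z])
    have "W \<subseteq> ?X" unfolding W_def using x_mult_prod[OF m(1) A] by blast
    then have YX: "Y \<subseteq> ?X" unfolding Y_def using ZX by (rule set_add_lub[OF X])
    have "ideal_length R ?X Y \<le> ideal_length R (A \<cdot> ipow (K m) (Suc n)) (B \<cdot> ipow (K m) (Suc n))"
    proof (rule ideal_length_le_of_surj[where y = \<one>])
      show "?X \<subseteq> (\<lambda>z. \<one> \<otimes> z) ` (A \<cdot> ipow (K m) (Suc n)) <+> Y"
      proof
        fix z assume "z \<in> ?X"
        then obtain u w where uw: "u \<in> A \<cdot> ipow (K m) (Suc n)" "w \<in> A \<cdot> ipow (K (Suc m)) n" "z = u \<oplus> x m \<otimes> w"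
          using split_K[OF m(1) A] by blast
        then have "u \<in> carrier R" using prod_K_ideal[OF m(2) A] ideal_mem_carrier by blast
        then have "u = \<one> \<otimes> u" by simp
        moreover have "x m \<otimes> w \<in> Y" using WY uw(2) unfolding W_def by blast
        ultimately show "z \<in> (\<lambda>z. \<one> \<otimes> z) ` (A \<cdot> ipow (K m) (Suc n)) <+> Y"
          using uw(1,3) set_add_memI[of "\<one> \<otimes> u" "(\<lambda>z. \<one> \<otimes> z) ` (A \<cdot> ipow (K m) (Suc n))" "x m \<otimes> w" Y] by simp
      qed
      show "\<one> \<otimes> b \<in> Y" if "b \<in> B \<cdot> ipow (K m) (Suc n)" for b
      proof -
        have "b \<in> Y" using that prod_K_le_Suc[OF m(1), of B "Suc n"] ZY by blast
        moreover have "b \<in> carrier R" using that ideal_mem_carrier[OF prod_K_ideal[OF m(2) B(1)]] by blast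
        ultimately show ?thesis by simp
      qed
    qed (intro prod_K_ideal[OF m(2)] ideal_prod_mono A B X Y YX one_closed order_refl)+
    also have "\<dots> \<le> of_nat ((Suc n + m - 1) choose Suc n) * ideal_length R A B"
      using m(2) by (rule IHm)
    finally have 1: "ideal_length R ?X Y \<le> of_nat ((Suc n + m - 1) choose Suc n) * ideal_length R A B" .
    have "ideal_length R Y ?Z \<le> ideal_length R (A \<cdot> ipow (K (Suc m)) n) (B \<cdot> ipow (K (Suc m)) n)"
    proof (rule ideal_length_le_of_surj[where y = "x m"])
      show "Y \<subseteq> (\<lambda>z. x m \<otimes> z) ` (A \<cdot> ipow (K (Suc m)) n) <+> ?Z"
        unfolding Y_def W_def by (rule order_refl)
      show "x m \<otimes> b \<in> ?Z" if "b \<in> B \<cdot> ipow (K (Suc m)) n" for b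
        using x_mult_prod[OF m(1) B(1) that] .
    qed (intro prod_K_ideal[OF m(3)] ideal_prod_mono A B Y Z ZY x_carrier[OF m(1)] order_refl)+
    also note Suc.IH
    finally have 2: "ideal_length R Y ?Z \<le> of_nat ((n + Suc m - 1) choose n) * ideal_length R A B" .
    have "ideal_length R ?X ?Z = ideal_length R ?X Y + ideal_length R Y ?Z"
      by (rule ideal_length_add[OF X Y Z ZY YX])
    also have "\<dots> \<le> of_nat ((Suc n + m - 1) choose Suc n) * ideal_length R A B
        + of_nat ((n + Suc m - 1) choose n) * ideal_length R A B"
      using 1 2 by (rule add_mono)
    \<comment> \<open>Pascal's rule: both binomials in the sum have upper index
      \<open>n + m\<close>.\<close>
    also have "\<dots> = of_nat ((Suc n + Suc m - 1) choose Suc n) * ideal_length R A B"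
      by (simp add: distrib_right add.commute)
    finally show ?case .
  qed
qed

end

section \<open>Regular sequences\<close>

locale regular_tower = ideal_tower +
  assumes regular: "m < d \<Longrightarrow> z \<in> carrier R \<Longrightarrow> x m \<otimes> z \<in> K m \<Longrightarrow> z \<in> K m"
begin

text \<open>Regularity of \<open>x m\<close> modulo powers of \<open>K m\<close> and the statement
  \<open>regular_coeff\<close> feed each other: the former at level \<open>m\<close> needs the
  latter at level \<open>m\<close>, and the latter at level \<open>m + 1\<close> needs the former at
  level \<open>m\<close>. Hence the hypothesis \<open>coeff\<close>. It is applied with
  \<open>C = K m\<close> and \<open>y = x m\<close>, which raises the known power by one.\<close>

lemma regular_ipow_aux:
  assumes m: "m < d"
    and coeff: "\<And>C y n z. ideal C R \<Longrightarrow> K m \<subseteq> C \<Longrightarrow> y \<in> carrier R \<Longrightarrow>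
      (\<forall>a\<in>carrier R. y \<otimes> a \<in> C \<longrightarrow> a \<in> C) \<Longrightarrow> z \<in> ipow (K m) n \<Longrightarrow> y \<otimes> z \<in> C \<cdot> ipow (K m) n \<Longrightarrow>
      z \<in> C \<cdot> ipow (K m) n"
  shows "z \<in> carrier R \<Longrightarrow> x m \<otimes> z \<in> ipow (K m) n \<Longrightarrow> z \<in> ipow (K m) n"
proof (induction n)
  case 0
  then show ?case by (simp only: ipow_0)
next
  case (Suc n)
  have id: "ideal (K m) R" using K_ideal m by simp
  have eq: "ipow (K m) (Suc n) = K m \<cdot> ipow (K m) n"
    by (simp only: ipow_Suc ideal_prod_commute[OF ipow_ideal[OF id] id])
  have "x m \<otimes> z \<in> ipow (K m) n" using Suc.prems(2) ipow_antimono[OF id, of n "Suc n"] by auto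
  then have z: "z \<in> ipow (K m) n" using Suc.IH[OF Suc.prems(1)] by simp
  have xz: "x m \<otimes> z \<in> K m \<cdot> ipow (K m) n" using Suc.prems(2) unfolding eq .
  have reg: "\<forall>a\<in>carrier R. x m \<otimes> a \<in> K m \<longrightarrow> a \<in> K m" using regular[OF m] by simp
  show ?case unfolding eq by (rule coeff[OF id order_refl x_carrier[OF m] reg z xz])
qed

text \<open>Quasi-regularity without polynomials: an element regular on \<open>R/C\<close> is regular on
  \<open>K\<^sub>m\<^sup>n/C K\<^sub>m\<^sup>n\<close>, the forms of degree \<open>n\<close> with coefficients in \<open>R/C\<close>.\<close>

lemma regular_coeff:
  "m \<le> d \<Longrightarrow> ideal C R \<Longrightarrow> K m \<subseteq> C \<Longrightarrow> y \<in> carrier R \<Longrightarrow>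
    \<forall>a\<in>carrier R. y \<otimes> a \<in> C \<longrightarrow> a \<in> C \<Longrightarrow> z \<in> ipow (K m) n \<Longrightarrow> y \<otimes> z \<in> C \<cdot> ipow (K m) n \<Longrightarrow>
    z \<in> C \<cdot> ipow (K m) n"
proof (induction m arbitrary: C y n z)
  case 0
  show ?case
  proof (cases n)
    case 0
    have "y \<otimes> z \<in> C" using "0.prems"(7) unfolding 0 ideal_prod_ipow_0[OF "0.prems"(2)] .
    moreover have "z \<in> carrier R" using "0.prems"(6) unfolding 0 ipow_0 .
    ultimately show ?thesis using "0.prems"(5) unfolding 0 ideal_prod_ipow_0[OF "0.prems"(2)] by simp
  next
    case (Suc k)
    then have "z = \<zero>" using "0.prems"(6) by (simp only: K_0 zero_ideal_ipow_Suc singleton_iff)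
    then show ?thesis using ideal_zero_mem[OF prod_K_ideal[OF "0.prems"(1,2)]] by simp
  qed
next
  case (Suc m)
  have m: "m < d" "m \<le> d" "Suc m \<le> d" using Suc.prems by simp_all
  have id: "ideal (K m) R" "ideal (K (Suc m)) R" using K_ideal m by simp_all
  note C = Suc.prems(2)
  have KC: "K m \<subseteq> C" using Suc.prems(3) K_le_Suc[OF m(1)] by blast
  have xC: "x m \<in> C" using Suc.prems(3) x_mem[OF m(1)] by blast
  note y = Suc.prems(4,5)
  note IH = Suc.IH[OF m(2)]
  have P: "z \<in> ipow (K m) n" if "z \<in> carrier R" "x m \<otimes> z \<in> ipow (K m) n" for z n
    by (rule regular_ipow_aux[OF m(1) _ that]) (rule IH)
  have xc: "x m \<in> carrier R" using x_carrier m by simp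
  from Suc.prems(6,7) show ?case
  proof (induction n arbitrary: z)
    case 0
    then show ?case using y(2) unfolding ipow_0 ideal_prod_one[OF C] by simp
  next
    case (Suc n)
    have z: "z \<in> carrier R \<cdot> ipow (K (Suc m)) (Suc n)"
      using Suc.prems(1) by (simp only: carrier_prod ipow_ideal id)
    obtain z' w where z': "z' \<in> ipow (K m) (Suc n)" and w: "w \<in> ipow (K (Suc m)) n" and zw: "z = z' \<oplus> x m \<otimes> w"
      using split_K[OF m(1) oneideal z] by (simp only: carrier_prod ipow_ideal id) blast
    obtain v u where v: "v \<in> C \<cdot> ipow (K m) (Suc n)" and u: "u \<in> C \<cdot> ipow (K (Suc m)) n"
      and vu: "y \<otimes> z = v \<oplus> x m \<otimes> u"
      using split_K[OF m(1) C Suc.prems(2)] by blast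
    have c: "z' \<in> carrier R" "w \<in> carrier R" "v \<in> carrier R" "u \<in> carrier R"
      using ideal_mem_carrier[OF ipow_ideal[OF id(1)] z'] ideal_mem_carrier[OF ipow_ideal[OF id(2)] w]
        ideal_mem_carrier[OF prod_K_ideal[OF m(2) C] v] ideal_mem_carrier[OF prod_K_ideal[OF m(3) C] u] .
    have "y \<otimes> z' \<oplus> x m \<otimes> (y \<otimes> w) = y \<otimes> z" using c y(1) xc unfolding zw by algebra
    then have eq: "x m \<otimes> (y \<otimes> w \<ominus> u) = v \<ominus> y \<otimes> z'"
      unfolding vu by (rule add_cancel_scaled) (use c xc y in simp_all)
    \<comment> \<open>Two expressions of \<open>y z\<close> by powers of \<open>x m\<close> are
      compared, and \<open>h\<close> measures their disagreement. Regularity puts \<open>h\<close>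
      in \<open>ipow (K m) (Suc n)\<close>, and since \<open>K m \<subseteq> C\<close> it then has
      coefficients in \<open>C\<close>.\<close>
    define h where "h = y \<otimes> w \<ominus> u"
    have hc: "h \<in> carrier R" unfolding h_def using c y by simp
    have v': "v \<in> ipow (K m) (Suc n)" using prod_K_subset_ipow[OF m(2) C] v by blast
    have "y \<otimes> z' \<in> ipow (K m) (Suc n)" using ideal_mult_mem[OF ipow_ideal[OF id(1)] y(1) z'] .
    then have "x m \<otimes> h \<in> ipow (K m) (Suc n)"
      unfolding h_def eq using ideal_minus_mem[OF ipow_ideal[OF id(1)] v'] by blast
    then have h: "h \<in> ipow (K m) (Suc n)" by (rule P[OF hc])
    then have h': "h \<in> C \<cdot> ipow (K (Suc m)) n" using ipow_Suc_subset_prod'[OF m(1) C KC] by blast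
    have "y \<otimes> w \<in> C \<cdot> ipow (K (Suc m)) n"
      using ideal_diff_mem_cancel[OF prod_K_ideal[OF m(3) C] _ u] h' c y unfolding h_def by simp
    then have "w \<in> C \<cdot> ipow (K (Suc m)) n" by (rule Suc.IH[OF w])
    then have xw: "x m \<otimes> w \<in> C \<cdot> ipow (K (Suc m)) (Suc n)" by (rule x_mult_prod[OF m(1) C])
    \<comment> \<open>As \<open>x m\<close> itself lies in \<open>C\<close>, the correction
      \<open>x m h\<close> is absorbed in the part without \<open>x m\<close>, to which the
      induction on \<open>m\<close> applies.\<close>
    have "x m \<otimes> h \<in> C \<cdot> ipow (K m) (Suc n)" using ideal_prod.prod[OF xC h] .
    then have "v \<ominus> x m \<otimes> h \<in> C \<cdot> ipow (K m) (Suc n)" using ideal_minus_mem[OF prod_K_ideal[OF m(2) C] v] by blast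
    moreover have "v \<ominus> x m \<otimes> h = y \<otimes> z'" unfolding h_def eq using c y by algebra
    ultimately have "z' \<in> C \<cdot> ipow (K m) (Suc n)" using IH[OF C KC y z'] by simp
    then have "z' \<in> C \<cdot> ipow (K (Suc m)) (Suc n)" using prod_K_le_Suc[OF m(1)] by blast
    then show ?case unfolding zw using xw ideal_add_mem[OF prod_K_ideal[OF m(3) C]] by blast
  qed
qed

lemma regular_ipow:
  assumes "m < d" "z \<in> carrier R" "x m \<otimes> z \<in> ipow (K m) n"
  shows "z \<in> ipow (K m) n"
  by (rule regular_ipow_aux[OF assms(1) _ assms(2,3)]) (rule regular_coeff[OF less_imp_le[OF assms(1)]])

text \<open>The expressions of \<open>z\<close> with coefficients in \<open>A\<close> and in
  \<open>C\<close> differ by a multiple \<open>x m h\<close> with \<open>h\<close> in a power of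
  \<open>K m\<close>, as in \<open>regular_coeff\<close>. By \<open>K m \<subseteq> C\<close> the
  element \<open>h\<close> has coefficients in \<open>C\<close>, so the parts of the first
  expression have coefficients in \<open>C\<close> as well.\<close>

lemma prod_inter_subset:
  "m \<le> d \<Longrightarrow> ideal A R \<Longrightarrow> ideal C R \<Longrightarrow> K m \<subseteq> C \<Longrightarrow> z \<in> A \<cdot> ipow (K m) n \<Longrightarrow>
    z \<in> C \<cdot> ipow (K m) n \<Longrightarrow> z \<in> (A \<inter> C) \<cdot> ipow (K m) n"
proof (induction m arbitrary: n z)
  case 0
  note AC = i_intersect[OF 0(2,3)]
  show ?case
  proof (cases n)
    case z: 0
    show ?thesis using "0.prems" unfolding z by (simp only: ideal_prod_ipow_0 AC) blast
  next
    case (Suc k)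
    then have "z = \<zero>" using "0.prems"(5) ideal_prod_zero[OF 0(2)] by (simp only: K_0 zero_ideal_ipow_Suc singleton_iff)
    then show ?thesis using ideal_zero_mem[OF prod_K_ideal[OF "0.prems"(1) AC]] by simp
  qed
next
  case (Suc m)
  have m: "m < d" "m \<le> d" "Suc m \<le> d" using Suc.prems by simp_all
  note A = Suc.prems(2) and C = Suc.prems(3)
  note AC = i_intersect[OF A C]
  have KC: "K m \<subseteq> C" using Suc.prems(4) K_le_Suc[OF m(1)] by blast
  have xC: "x m \<in> C" using Suc.prems(4) x_mem[OF m(1)] by blast
  note IH = Suc.IH[OF m(2) A C KC]
  have xc: "x m \<in> carrier R" using x_carrier m by simp
  from Suc.prems(5,6) show ?case
  proof (induction n arbitrary: z)
    case 0
    then show ?case by (simp only: ideal_prod_ipow_0 A C AC) blast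
  next
    case (Suc n)
    obtain z' w where z': "z' \<in> A \<cdot> ipow (K m) (Suc n)" and w: "w \<in> A \<cdot> ipow (K (Suc m)) n"
      and zw: "z = z' \<oplus> x m \<otimes> w"
      using split_K[OF m(1) A Suc.prems(1)] by blast
    obtain v u where v: "v \<in> C \<cdot> ipow (K m) (Suc n)" and u: "u \<in> C \<cdot> ipow (K (Suc m)) n"
      and vu: "z = v \<oplus> x m \<otimes> u"
      using split_K[OF m(1) C Suc.prems(2)] by blast
    have c: "z' \<in> carrier R" "w \<in> carrier R" "v \<in> carrier R" "u \<in> carrier R"
      using ideal_mem_carrier[OF prod_K_ideal[OF m(2) A] z'] ideal_mem_carrier[OF prod_K_ideal[OF m(3) A] w]
        ideal_mem_carrier[OF prod_K_ideal[OF m(2) C] v] ideal_mem_carrier[OF prod_K_ideal[OF m(3) C] u] .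
    have "z' \<oplus> x m \<otimes> w = v \<oplus> x m \<otimes> u" using zw vu by simp
    then have eq: "x m \<otimes> (w \<ominus> u) = v \<ominus> z'" by (rule add_cancel_scaled) (use c xc in simp_all)
    define h where "h = w \<ominus> u"
    have hc: "h \<in> carrier R" unfolding h_def using c by simp
    have "v \<in> ipow (K m) (Suc n)" "z' \<in> ipow (K m) (Suc n)"
      using prod_K_subset_ipow[OF m(2) C] v prod_K_subset_ipow[OF m(2) A] z' by blast+
    then have "x m \<otimes> h \<in> ipow (K m) (Suc n)"
      unfolding h_def eq using ideal_minus_mem[OF ipow_ideal[OF K_ideal[OF m(2)]]] by blast
    then have h: "h \<in> ipow (K m) (Suc n)" by (rule regular_ipow[OF m(1) hc])
    then have "h \<in> C \<cdot> ipow (K (Suc m)) n" using ipow_Suc_subset_prod'[OF m(1) C KC] by blast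
    then have "w \<in> C \<cdot> ipow (K (Suc m)) n"
      using ideal_diff_mem_cancel[OF prod_K_ideal[OF m(3) C] _ u] c unfolding h_def by simp
    then have "w \<in> (A \<inter> C) \<cdot> ipow (K (Suc m)) n" by (rule Suc.IH[OF w])
    then have xw: "x m \<otimes> w \<in> (A \<inter> C) \<cdot> ipow (K (Suc m)) (Suc n)" by (rule x_mult_prod[OF m(1) AC])
    have "x m \<otimes> h \<in> C \<cdot> ipow (K m) (Suc n)" using ideal_prod.prod[OF xC h] .
    then have "v \<ominus> x m \<otimes> h \<in> C \<cdot> ipow (K m) (Suc n)" using ideal_minus_mem[OF prod_K_ideal[OF m(2) C] v] by blast
    moreover have "v \<ominus> x m \<otimes> h = z'" unfolding h_def eq using c by algebra
    ultimately have "z' \<in> (A \<inter> C) \<cdot> ipow (K m) (Suc n)" using IH[OF z'] by simp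
    then have "z' \<in> (A \<inter> C) \<cdot> ipow (K (Suc m)) (Suc n)" using prod_K_le_Suc[OF m(1)] by blast
    then show ?case unfolding zw using xw ideal_add_mem[OF prod_K_ideal[OF m(3) AC]] by blast
  qed
qed

text \<open>The filtration is that of \<open>ideal_length_prod_le\<close>, but both surjections are
  now also injective. Relations among monomials in a regular sequence have coefficients in the ideal
  of the sequence, and \<open>K m \<subseteq> C\<close> makes them invisible modulo
  \<open>A \<inter> C\<close>.\<close>

theorem ideal_length_prod:
  assumes A: "ideal A R" and C: "ideal C R"
  shows "m \<le> d \<Longrightarrow> K m \<subseteq> C \<Longrightarrow> ideal_length R (A \<cdot> ipow (K m) n) ((A \<inter> C) \<cdot> ipow (K m) n)
    = of_nat ((n + m - 1) choose n) * ideal_length R A (A \<inter> C)"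
proof (induction m arbitrary: n)
  case 0
  show ?case
  proof (cases n)
    case (Suc k)
    then have "A \<cdot> ipow (K 0) n = {\<zero>}" "(A \<inter> C) \<cdot> ipow (K 0) n = {\<zero>}"
      using A i_intersect[OF A C] by (simp_all only: K_0 zero_ideal_ipow_Suc ideal_prod_zero)
    then show ?thesis using Suc by (simp add: ideal_length_self zeroideal)
  qed (simp only: ideal_prod_ipow_0 A i_intersect[OF A C], simp)
next
  case (Suc m)
  then have m: "m < d" "m \<le> d" "Suc m \<le> d" by simp_all
  define B where "B = A \<inter> C"
  have B: "ideal B R" "B \<subseteq> A" unfolding B_def using i_intersect[OF A C] by simp_all
  have KC: "K m \<subseteq> C" "K (Suc m) \<subseteq> C" using Suc.prems(2) K_le_Suc[OF m(1)] by blast+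
  have xC: "x m \<in> C" using KC x_mem[OF m(1)] by blast
  have xc: "x m \<in> carrier R" using x_carrier m by simp
  note IHm = Suc.IH[OF m(2) KC(1), folded B_def]
  show ?case
    unfolding B_def[symmetric]
  proof (induction n)
    case 0
    show ?case by (simp only: ideal_prod_ipow_0 A B) simp
  next
    case (Suc n)
    let ?X = "A \<cdot> ipow (K (Suc m)) (Suc n)" and ?Z = "B \<cdot> ipow (K (Suc m)) (Suc n)"
    define W where "W = (\<lambda>z. x m \<otimes> z) ` (A \<cdot> ipow (K (Suc m)) n)"
    define Y where "Y = W <+> ?Z"
    have X: "ideal ?X R" and Z: "ideal ?Z R" and ZX: "?Z \<subseteq> ?X" and W: "ideal W R"
      unfolding W_def
      by (rule prod_K_ideal[OF m(3) A], rule prod_K_ideal[OF m(3) B(1)], rule ideal_prod_mono[OF B(2) order_refl],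
          rule ideal_cmult[OF prod_K_ideal[OF m(3) A] xc])
    have Y: "ideal Y R" unfolding Y_def by (intro add_ideals W Z)
    have ZY: "?Z \<subseteq> Y" and WY: "W \<subseteq> Y" unfolding Y_def
      by (rule set_add_ub2[OF W Z], rule set_add_ub1[OF W Z])
    have "W \<subseteq> ?X" unfolding W_def using x_mult_prod[OF m(1) A] by blast
    then have YX: "Y \<subseteq> ?X" unfolding Y_def using ZX by (rule set_add_lub[OF X])
    have 1: "ideal_length R ?X Y = ideal_length R (A \<cdot> ipow (K m) (Suc n)) (B \<cdot> ipow (K m) (Suc n))"
    proof (rule ideal_length_eq_of_iso[where y = \<one>])
      show "?X \<subseteq> (\<lambda>z. \<one> \<otimes> z) ` (A \<cdot> ipow (K m) (Suc n)) <+> Y"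
      proof
        fix z assume "z \<in> ?X"
        then obtain u w where uw: "u \<in> A \<cdot> ipow (K m) (Suc n)" "w \<in> A \<cdot> ipow (K (Suc m)) n" "z = u \<oplus> x m \<otimes> w"
          using split_K[OF m(1) A] by blast
        then have "u \<in> carrier R" using prod_K_ideal[OF m(2) A] ideal_mem_carrier by blast
        then have "u = \<one> \<otimes> u" by simp
        moreover have "x m \<otimes> w \<in> Y" using WY uw(2) unfolding W_def by blast
        ultimately show "z \<in> (\<lambda>z. \<one> \<otimes> z) ` (A \<cdot> ipow (K m) (Suc n)) <+> Y"
          using uw(1,3) set_add_memI[of "\<one> \<otimes> u" "(\<lambda>z. \<one> \<otimes> z) ` (A \<cdot> ipow (K m) (Suc n))" "x m \<otimes> w" Y] by simp
      qed
      fix a assume a: "a \<in> A \<cdot> ipow (K m) (Suc n)"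
      have ac: "a \<in> carrier R" using a prod_K_ideal[OF m(2) A] ideal_mem_carrier by blast
      show "\<one> \<otimes> a \<in> ?X" using a prod_K_le_Suc[OF m(1), of A "Suc n"] ac by auto
      show "\<one> \<otimes> a \<in> Y \<longleftrightarrow> a \<in> B \<cdot> ipow (K m) (Suc n)"
      proof
        assume "a \<in> B \<cdot> ipow (K m) (Suc n)"
        then have "a \<in> Y" using prod_K_le_Suc[OF m(1), of B "Suc n"] ZY by blast
        then show "\<one> \<otimes> a \<in> Y" using ac by simp
      next
        assume "\<one> \<otimes> a \<in> Y"
        then have "a \<in> W <+> ?Z" using ac unfolding Y_def by simp
        then obtain q z where q: "q \<in> W" and z: "z \<in> ?Z" and aq: "a = q \<oplus> z" by (rule set_add_memE)
        obtain w where w: "w \<in> A \<cdot> ipow (K (Suc m)) n" and qw: "q = x m \<otimes> w" using q unfolding W_def by blast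
        obtain v u where v: "v \<in> B \<cdot> ipow (K m) (Suc n)" and u: "u \<in> B \<cdot> ipow (K (Suc m)) n"
          and zv: "z = v \<oplus> x m \<otimes> u"
          using split_K[OF m(1) B(1) z] by blast
        \<comment> \<open>The element \<open>a\<close> is built from powers of \<open>K m\<close>,
          yet \<open>a = v + x m h\<close>. So \<open>x m h\<close> lies in a power of
          \<open>K m\<close>, regularity puts \<open>h\<close> there too, and
          \<open>x m \<in> C\<close> gives \<open>x m h\<close> coefficients in
          \<open>C\<close>.\<close>
        define h where "h = w \<oplus> u"
        have c: "w \<in> carrier R" "v \<in> carrier R" "u \<in> carrier R"
          using ideal_mem_carrier[OF prod_K_ideal[OF m(3) A] w]
            ideal_mem_carrier[OF prod_K_ideal[OF m(2) B(1)] v] ideal_mem_carrier[OF prod_K_ideal[OF m(3) B(1)] u] .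
        have hc: "h \<in> carrier R" unfolding h_def using c by simp
        have avh: "a = v \<oplus> x m \<otimes> h" unfolding aq qw zv h_def using c xc by algebra
        then have "x m \<otimes> h = a \<ominus> v" using c hc xc by algebra
        moreover have "a \<in> ipow (K m) (Suc n)" "v \<in> ipow (K m) (Suc n)"
          using prod_K_subset_ipow[OF m(2) A] a prod_K_subset_ipow[OF m(2) B(1)] v by blast+
        ultimately have "x m \<otimes> h \<in> ipow (K m) (Suc n)"
          using ideal_minus_mem[OF ipow_ideal[OF K_ideal[OF m(2)]]] by simp
        then have "h \<in> ipow (K m) (Suc n)" by (rule regular_ipow[OF m(1) hc])
        then have "x m \<otimes> h \<in> C \<cdot> ipow (K m) (Suc n)" by (rule ideal_prod.prod[OF xC])
        moreover have "v \<in> C \<cdot> ipow (K m) (Suc n)"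
          using v ideal_prod_mono[of B C "ipow (K m) (Suc n)" "ipow (K m) (Suc n)"] unfolding B_def by blast
        ultimately have "a \<in> C \<cdot> ipow (K m) (Suc n)"
          unfolding avh using ideal_add_mem[OF prod_K_ideal[OF m(2) C]] by blast
        then show "a \<in> B \<cdot> ipow (K m) (Suc n)"
          unfolding B_def using prod_inter_subset[OF m(2) A C KC(1) a] by blast
      qed
    qed (intro prod_K_ideal[OF m(2)] ideal_prod_mono A B X Y YX one_closed order_refl)+
    have 2: "ideal_length R Y ?Z = ideal_length R (A \<cdot> ipow (K (Suc m)) n) (B \<cdot> ipow (K (Suc m)) n)"
    proof (rule ideal_length_eq_of_iso[where y = "x m"])
      show "Y \<subseteq> (\<lambda>z. x m \<otimes> z) ` (A \<cdot> ipow (K (Suc m)) n) <+> ?Z"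
        unfolding Y_def W_def by (rule order_refl)
      fix a assume a: "a \<in> A \<cdot> ipow (K (Suc m)) n"
      then show "x m \<otimes> a \<in> Y" using WY unfolding W_def by blast
      have ac: "a \<in> carrier R" using ideal_mem_carrier[OF prod_K_ideal[OF m(3) A] a] .
      show "x m \<otimes> a \<in> ?Z \<longleftrightarrow> a \<in> B \<cdot> ipow (K (Suc m)) n"
      proof
        assume "x m \<otimes> a \<in> ?Z"
        then obtain v u where v: "v \<in> B \<cdot> ipow (K m) (Suc n)" and u: "u \<in> B \<cdot> ipow (K (Suc m)) n"
          and av: "x m \<otimes> a = v \<oplus> x m \<otimes> u"
          using split_K[OF m(1) B(1)] by blast
        have c: "v \<in> carrier R" "u \<in> carrier R"
          using ideal_mem_carrier[OF prod_K_ideal[OF m(2) B(1)] v] ideal_mem_carrier[OF prod_K_ideal[OF m(3) B(1)] u] .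
        have "x m \<otimes> (a \<ominus> u) = x m \<otimes> a \<ominus> x m \<otimes> u" using c ac xc by algebra
        also have "\<dots> = v" unfolding av using c xc by algebra
        finally have "x m \<otimes> (a \<ominus> u) \<in> ipow (K m) (Suc n)"
          using prod_K_subset_ipow[OF m(2) B(1)] v by blast
        then have "a \<ominus> u \<in> ipow (K m) (Suc n)" using regular_ipow[OF m(1)] ac c by simp
        then have "a \<ominus> u \<in> C \<cdot> ipow (K (Suc m)) n" using ipow_Suc_subset_prod'[OF m(1) C KC(1)] by blast
        moreover have "u \<in> C \<cdot> ipow (K (Suc m)) n"
          using u ideal_prod_mono[of B C "ipow (K (Suc m)) n" "ipow (K (Suc m)) n"] unfolding B_def by blast
        ultimately have "a \<in> C \<cdot> ipow (K (Suc m)) n"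
          using ideal_diff_mem_cancel[OF prod_K_ideal[OF m(3) C]] ac by blast
        then show "a \<in> B \<cdot> ipow (K (Suc m)) n"
          unfolding B_def using prod_inter_subset[OF m(3) A C KC(2) a] by blast
      next
        assume "a \<in> B \<cdot> ipow (K (Suc m)) n"
        then show "x m \<otimes> a \<in> ?Z" by (rule x_mult_prod[OF m(1) B(1)])
      qed
    qed (intro prod_K_ideal[OF m(3)] ideal_prod_mono A B Y Z ZY xc order_refl)+
    have "ideal_length R ?X ?Z = ideal_length R ?X Y + ideal_length R Y ?Z"
      by (rule ideal_length_add[OF X Y Z ZY YX])
    also have "\<dots> = of_nat ((Suc n + m - 1) choose Suc n) * ideal_length R A B
        + of_nat ((n + Suc m - 1) choose n) * ideal_length R A B"
      unfolding 1 2 IHm Suc.IH ..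
    also have "\<dots> = of_nat ((Suc n + Suc m - 1) choose Suc n) * ideal_length R A B"
      by (simp add: distrib_right add.commute)
    finally show ?case .
  qed
qed

end

section \<open>Stability of graded families\<close>

lemma (in noetherian_ring) ascending_ideals_stabilize:
  fixes L :: "nat \<Rightarrow> 'a set"
  assumes id: "\<And>i. ideal (L i) R" and mono: "\<And>i. L i \<subseteq> L (Suc i)"
  shows "\<exists>i0. \<forall>i\<ge>i0. L i = L i0"
proof -
  obtain M where M: "M \<in> range L" "\<forall>K\<in>range L. M \<subseteq> K \<longrightarrow> K = M"
    by (rule maximal_ideal_in_family[of "range L"]) (use id in auto)
  then obtain i0 where i0: "M = L i0" by blast
  have "L i = L i0" if "i \<ge> i0" for i
    using M(2) i0 lift_Suc_mono_le[of L, OF mono that] by blast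
  then show ?thesis by blast
qed

context ideal_tower
begin

text \<open>The part of \<open>K\<^sub>m\<^sub>+\<^sub>1\<^sup>n\<close> spanned by the terms of degree less than \<open>i\<close> in \<open>x\<^sub>m\<close>.
  For \<open>i > n\<close> the truncated exponent \<open>n - i\<close> is harmless, since \<open>x\<^sub>m\<^sup>i\<close> is a multiple of \<open>x\<^sub>m\<^sup>n\<close>.\<close>

primrec low_part :: "nat \<Rightarrow> nat \<Rightarrow> nat \<Rightarrow> 'a set" where
  "low_part m 0 n = {\<zero>}"
| "low_part m (Suc i) n = low_part m i n <+> (\<lambda>z. x m [^] i \<otimes> z) ` ipow (K m) (n - i)"

context
  fixes m assumes m: "m < d"
begin

lemma low_facts:
  "x m \<in> carrier R" "x m [^] (i::nat) \<in> carrier R" "ideal (K m) R" "ideal (K (Suc m)) R"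
  "ideal (ipow (K m) n) R" "ideal (ipow (K (Suc m)) n) R"
  using x_carrier[OF m] K_ideal[of m] K_ideal[of "Suc m"] m ipow_ideal[of "K m"] ipow_ideal[of "K (Suc m)"]
  by simp_all

lemma low_part_ideal: "ideal (low_part m i n) R"
  by (induction i) (simp_all add: zeroideal add_ideals ideal_cmult low_facts)

lemma low_part_top: "z \<in> ipow (K m) (n - i) \<Longrightarrow> x m [^] i \<otimes> z \<in> low_part m (Suc i) n"
  using set_add_ub2[OF low_part_ideal[of i n] ideal_cmult[OF low_facts(5)[of "n - i"] low_facts(2)[of i]]] by auto

lemma low_part_le_Suc: "low_part m i n \<subseteq> low_part m (Suc i) n"
  using set_add_ub1[OF low_part_ideal[of i n] ideal_cmult[OF low_facts(5)[of "n - i"] low_facts(2)[of i]]] by simp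

lemma low_part_mono: "i \<le> j \<Longrightarrow> low_part m i n \<subseteq> low_part m j n"
  using lift_Suc_mono_le[of "\<lambda>i. low_part m i n", OF low_part_le_Suc] .

text \<open>Multiplication by \<open>x m\<close> raises the degree and the bound on the exponent of
  \<open>x m\<close> together; multiplication by \<open>K m\<close>, treated next, raises the degree
  alone. The stability argument uses exactly these two actions.\<close>

lemma low_part_x_mult: "a \<in> low_part m i n \<Longrightarrow> x m \<otimes> a \<in> low_part m (Suc i) (Suc n)"
proof (induction i arbitrary: a)
  case 0
  then have "x m \<otimes> a = \<zero>" using low_facts(1) by simp
  then show ?case using ideal_zero_mem[OF low_part_ideal] by (simp del: low_part.simps)
next
  case (Suc i)
  from Suc.prems have "a \<in> low_part m i n <+> (\<lambda>z. x m [^] i \<otimes> z) ` ipow (K m) (n - i)" by simp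
  then obtain b c where b: "b \<in> low_part m i n" and c: "c \<in> ipow (K m) (n - i)" and a: "a = b \<oplus> x m [^] i \<otimes> c"
    by (rule set_add_cmultE)
  have cc: "b \<in> carrier R" "c \<in> carrier R"
    using ideal_mem_carrier[OF low_part_ideal b] ideal_mem_carrier[OF low_facts(5) c] .
  have "x m \<otimes> (x m [^] i \<otimes> c) = x m [^] Suc i \<otimes> c"
    using cc low_facts(1,2) by (simp add: m_ac nat_pow_Suc)
  then have "x m \<otimes> a = x m \<otimes> b \<oplus> x m [^] Suc i \<otimes> c"
    unfolding a using cc low_facts(1,2) by (simp add: r_distr)
  moreover have "x m \<otimes> b \<in> low_part m (Suc (Suc i)) (Suc n)" using Suc.IH[OF b] low_part_le_Suc by blast
  moreover have "x m [^] Suc i \<otimes> c \<in> low_part m (Suc (Suc i)) (Suc n)"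
    using c by (intro low_part_top) simp
  ultimately show ?case using ideal_add_mem[OF low_part_ideal] by (simp del: low_part.simps)
qed

lemma low_part_K_mult: "y \<in> K m \<Longrightarrow> a \<in> low_part m i n \<Longrightarrow> y \<otimes> a \<in> low_part m i (Suc n)"
proof (induction i arbitrary: a)
  case 0
  then have "y \<otimes> a = \<zero>" using ideal_mem_carrier[OF low_facts(3)] by simp
  then show ?case by simp
next
  case (Suc i)
  from Suc.prems(2) have "a \<in> low_part m i n <+> (\<lambda>z. x m [^] i \<otimes> z) ` ipow (K m) (n - i)" by simp
  then obtain b c where b: "b \<in> low_part m i n" and c: "c \<in> ipow (K m) (n - i)" and a: "a = b \<oplus> x m [^] i \<otimes> c"
    by (rule set_add_cmultE)
  have cc: "b \<in> carrier R" "c \<in> carrier R" "y \<in> carrier R"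
    using ideal_mem_carrier[OF low_part_ideal b] ideal_mem_carrier[OF low_facts(5) c]
      ideal_mem_carrier[OF low_facts(3) Suc.prems(1)] .
  have "y \<otimes> a = y \<otimes> b \<oplus> x m [^] i \<otimes> (c \<otimes> y)"
    unfolding a using cc low_facts(2)[of i] by algebra
  moreover have "y \<otimes> b \<in> low_part m (Suc i) (Suc n)" using Suc.IH[OF Suc.prems(1) b] low_part_le_Suc by blast
  moreover have "x m [^] i \<otimes> (c \<otimes> y) \<in> low_part m (Suc i) (Suc n)"
  proof -
    have "c \<otimes> y \<in> ipow (K m) (Suc (n - i))"
      unfolding ipow_Suc using c Suc.prems(1) by (rule ideal_prod.prod)
    \<comment> \<open>The inequality is strict only for \<open>i > n\<close>, where the left side is
      0 and the right side 1.\<close>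
    moreover have "Suc n - i \<le> Suc (n - i)" by arith
    ultimately have "c \<otimes> y \<in> ipow (K m) (Suc n - i)"
      using ipow_antimono[OF low_facts(3), of "Suc n - i" "Suc (n - i)"] by blast
    then show ?thesis by (rule low_part_top)
  qed
  ultimately show ?case using ideal_add_mem[OF low_part_ideal] by (simp del: low_part.simps)
qed

lemma ipow_subset_low_part: "ipow (K (Suc m)) n \<subseteq> low_part m (Suc n) n"
proof (induction n)
  case 0
  show ?case
  proof
    fix z assume "z \<in> ipow (K (Suc m)) 0"
    then have z: "z \<in> carrier R" by (simp only: ipow_0)
    then have "x m [^] (0::nat) \<otimes> z \<in> low_part m (Suc 0) 0" by (intro low_part_top) (simp only: ipow_0 diff_0_eq_0)
    then show "z \<in> low_part m (Suc 0) 0" using z by simp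
  qed
next
  case (Suc n)
  show ?case
  proof
    fix z assume "z \<in> ipow (K (Suc m)) (Suc n)"
    then have "z \<in> carrier R \<cdot> ipow (K (Suc m)) (Suc n)" by (simp only: carrier_prod low_facts)
    then obtain u w where u: "u \<in> carrier R \<cdot> ipow (K m) (Suc n)" and w: "w \<in> carrier R \<cdot> ipow (K (Suc m)) n"
      and z: "z = u \<oplus> x m \<otimes> w" by (rule split_K[OF m oneideal])
    have "w \<in> ipow (K (Suc m)) n" using w by (simp only: carrier_prod low_facts)
    then have "x m \<otimes> w \<in> low_part m (Suc (Suc n)) (Suc n)" using Suc low_part_x_mult by blast
    moreover have u': "u \<in> ipow (K m) (Suc n)" using u by (simp only: carrier_prod low_facts)
    then have "x m [^] (0::nat) \<otimes> u \<in> low_part m (Suc 0) (Suc n)" by (intro low_part_top) (simp only: diff_zero)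
    then have "u \<in> low_part m (Suc 0) (Suc n)" using ideal_mem_carrier[OF low_facts(5) u'] by simp
    then have "u \<in> low_part m (Suc (Suc n)) (Suc n)"
      using low_part_mono[of "Suc 0" "Suc (Suc n)" "Suc n"] by auto
    ultimately show "z \<in> low_part m (Suc (Suc n)) (Suc n)"
      unfolding z using ideal_add_mem[OF low_part_ideal] by blast
  qed
qed

end

text \<open>The graded module \<open>\<Oplus>\<^sub>n N\<^sub>n\<close> over the Rees algebra is finitely generated: as in Hilbert's basis
  theorem, the ideals of coefficients of \<open>x\<^sub>m\<^sup>i\<close> in \<open>N\<close> form graded modules over one variable fewer,
  ascending with \<open>i\<close>.\<close>

theorem graded_family_stable:
  assumes noeth: "noetherian_ring R"
  shows "m \<le> d \<Longrightarrow> (\<And>n. ideal (N n) R) \<Longrightarrow> (\<And>n. N n \<subseteq> ipow (K m) n) \<Longrightarrow>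
    (\<And>n. K m \<cdot> N n \<subseteq> N (Suc n)) \<Longrightarrow> \<exists>n0. \<forall>n\<ge>n0. N (Suc n) \<subseteq> K m \<cdot> N n"
proof (induction m arbitrary: N)
  case 0
  have "N (Suc n) \<subseteq> K 0 \<cdot> N n" for n
  proof -
    have "N (Suc n) \<subseteq> {\<zero>}" using "0.prems"(3)[of "Suc n"] by (simp only: K_0 zero_ideal_ipow_Suc)
    moreover have "\<zero> \<in> K 0 \<cdot> N n"
      using ideal_zero_mem[OF ideal_prod_is_ideal[OF K_ideal[OF "0.prems"(1)] "0.prems"(2)]] .
    ultimately show ?thesis by blast
  qed
  then show ?case by blast
next
  case (Suc m)
  interpret noetherian_ring R by (rule noeth)
  have m: "m < d" "m \<le> d" using Suc.prems by simp_all
  note low = low_facts[OF m(1)]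
  note idN = Suc.prems(2) and Nsub = Suc.prems(3) and KN = Suc.prems(4)
  have xN: "x m \<otimes> g \<in> N (Suc n)" and xKN: "x m \<otimes> g \<in> K (Suc m) \<cdot> N n" if "g \<in> N n" for g n
    using ideal_prod.prod[OF x_mem[OF m(1)] that] KN by blast+
  have yKN: "y \<otimes> g \<in> K (Suc m) \<cdot> N n" if "y \<in> K m" "g \<in> N n" for y g n
    using ideal_prod.prod[of y "K (Suc m)" g "N n" R] that K_le_Suc[OF m(1)] by blast
  define V where "V = low_part m"
  note V = low_part_ideal[OF m(1), folded V_def]
  \<comment> \<open>\<open>L i n\<close> collects the leading coefficients at
    \<open>x m [^] i\<close> of elements of \<open>N (n + i)\<close>; they have degree
    \<open>n\<close> in the first \<open>m\<close> generators, and \<open>V\<close> discards the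
    terms of lower degree in \<open>x m\<close>.\<close>
  define L where "L i n = {z \<in> ipow (K m) n. x m [^] i \<otimes> z \<in> N (n + i) <+> V i (n + i)}" for i n :: nat
  have idNV: "ideal (N k <+> V i n) R" for k i n by (rule add_ideals[OF idN V])
  have idL: "ideal (L i n) R" for i n
    unfolding L_def by (rule ideal_colon[OF idNV low(5,2)])
  have Lsub: "L i n \<subseteq> ipow (K m) n" for i n unfolding L_def by blast
  have LE: "\<exists>g\<in>N (n + i). \<exists>v\<in>V i (n + i). x m [^] i \<otimes> z = g \<oplus> v" if "z \<in> L i n" for z i n
    using that unfolding L_def set_add_def' by blast
  have Lmono: "L i n \<subseteq> L (Suc i) n" for i n
  proof
    fix z assume z: "z \<in> L i n"
    then obtain g v where g: "g \<in> N (n + i)" and v: "v \<in> V i (n + i)" and eq: "x m [^] i \<otimes> z = g \<oplus> v"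
      using LE by blast
    have zc: "z \<in> carrier R" using ideal_mem_carrier[OF idL z] .
    have gv: "g \<in> carrier R" "v \<in> carrier R" using ideal_mem_carrier[OF idN g] ideal_mem_carrier[OF V v] .
    have "x m [^] Suc i \<otimes> z = x m \<otimes> (x m [^] i \<otimes> z)"
      using zc low(1,2) by (simp add: m_ac nat_pow_Suc)
    also have "\<dots> = x m \<otimes> g \<oplus> x m \<otimes> v" unfolding eq using gv low(1) by (simp add: r_distr)
    also have "\<dots> \<in> N (n + Suc i) <+> V (Suc i) (n + Suc i)"
      using xN[OF g] low_part_x_mult[OF m(1) v[unfolded V_def], folded V_def] by (intro set_add_memI) simp_all
    finally show "z \<in> L (Suc i) n" using z unfolding L_def by blast
  qed
  have KL: "K m \<cdot> L i n \<subseteq> L i (Suc n)" for i n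
  proof (rule ideal_prod_least[OF idL])
    fix y z assume y: "y \<in> K m" and z: "z \<in> L i n"
    obtain g v where g: "g \<in> N (n + i)" and v: "v \<in> V i (n + i)" and eq: "x m [^] i \<otimes> z = g \<oplus> v"
      using LE[OF z] by blast
    have zc: "z \<in> carrier R" using ideal_mem_carrier[OF idL z] .
    have yc: "y \<in> carrier R" using ideal_mem_carrier[OF low(3) y] .
    have gv: "g \<in> carrier R" "v \<in> carrier R" using ideal_mem_carrier[OF idN g] ideal_mem_carrier[OF V v] .
    have "x m [^] i \<otimes> (y \<otimes> z) = y \<otimes> (x m [^] i \<otimes> z)" using zc yc low(2)[of i] by algebra
    also have "\<dots> = y \<otimes> g \<oplus> y \<otimes> v" unfolding eq using gv yc by (simp add: r_distr)
    also have "\<dots> \<in> N (Suc n + i) <+> V i (Suc n + i)"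
      using yKN[OF y g] KN low_part_K_mult[OF m(1) y v[unfolded V_def], folded V_def]
      by (intro set_add_memI) auto
    finally have "x m [^] i \<otimes> (y \<otimes> z) \<in> N (Suc n + i) <+> V i (Suc n + i)" .
    moreover have "z \<otimes> y \<in> ipow (K m) (Suc n)"
      unfolding ipow_Suc using ideal_prod.prod[OF _ y] Lsub z by blast
    ultimately show "y \<otimes> z \<in> L i (Suc n)" unfolding L_def using m_comm[OF yc zc] by simp
  qed
  have Lmono': "L i n \<subseteq> L j n" if "i \<le> j" for i j n
    using lift_Suc_mono_le[of "\<lambda>i. L i n", OF Lmono that] .
  have "\<exists>i0. \<forall>i\<ge>i0. L i n = L i0 n" for n
    by (rule ascending_ideals_stabilize) (rule idL, rule Lmono)
  then obtain i0 where i0: "L i n = L (i0 n) n" if "i \<ge> i0 n" for i n by metis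
  define Linf where "Linf n = L (i0 n) n" for n
  have L_le_Linf: "L i n \<subseteq> Linf n" for i n
    using Lmono'[of i "max i (i0 n)" n] i0[of n "max i (i0 n)"] unfolding Linf_def by simp
  have KLinf: "K m \<cdot> Linf n \<subseteq> Linf (Suc n)" for n
    using KL[of "i0 n" n] L_le_Linf[of "i0 n" "Suc n"] unfolding Linf_def by blast
  have "\<exists>n0. \<forall>n\<ge>n0. Linf (Suc n) \<subseteq> K m \<cdot> Linf n"
    by (rule Suc.IH[OF m(2)]) (simp_all only: Linf_def[of for n] idL Lsub KLinf[unfolded Linf_def])
  then obtain ninf where ninf: "\<And>n. n \<ge> ninf \<Longrightarrow> Linf (Suc n) \<subseteq> K m \<cdot> Linf n" by blast
  \<comment> \<open>The index \<open>i0 n\<close> depends on \<open>n\<close>, but only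
    \<open>n \<le> ninf\<close> has to be inspected: beyond \<open>ninf\<close> the limit family is
    obtained from its predecessor by \<open>K m\<close>, and \<open>K m\<close> maps each
    \<open>L i n\<close> into \<open>L i (Suc n)\<close>.\<close>
  define I0 where "I0 = Max (i0 ` {..ninf})"
  have I0: "Linf n \<subseteq> L i n" if i: "I0 \<le> i" for i n
  proof (cases "n \<le> ninf")
    case True
    then have "i0 n \<le> I0" unfolding I0_def by (intro Max_ge) auto
    then show ?thesis using i0[of n i] i unfolding Linf_def by simp
  next
    case False
    then have "ninf \<le> n" by simp
    then show ?thesis
    proof (induction rule: dec_induct)
      case base
      have "i0 ninf \<le> I0" unfolding I0_def by (intro Max_ge) auto
      then show ?case using i0[of ninf i] i unfolding Linf_def by simp
    next
      case (step k)
      have "Linf (Suc k) \<subseteq> K m \<cdot> Linf k" using ninf step.hyps by simp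
      also have "\<dots> \<subseteq> K m \<cdot> L i k" using step.IH by (intro ideal_prod_mono order_refl)
      also have "\<dots> \<subseteq> L i (Suc k)" by (rule KL)
      finally show ?case .
    qed
  qed
  then have L_eq: "L i n = Linf n" if "I0 \<le> i" for i n using L_le_Linf that by blast
  have "\<exists>n0. \<forall>n\<ge>n0. L i (Suc n) \<subseteq> K m \<cdot> L i n" for i
    by (rule Suc.IH[OF m(2)]) (rule idL, rule Lsub, rule KL)
  then obtain nb where nb: "L i (Suc n) \<subseteq> K m \<cdot> L i n" if "n \<ge> nb i" for i n by metis
  \<comment> \<open>One bound for all \<open>i\<close>: from \<open>I0\<close> on the families
    \<open>L i\<close> coincide, so the finitely many bounds with \<open>i \<le> I0\<close>
    suffice.\<close>
  define n1 where "n1 = Max (nb ` {..I0})"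
  have n1: "L i (Suc n) \<subseteq> K m \<cdot> L i n" if n: "n1 \<le> n" for i n
  proof -
    have "nb (min i I0) \<le> n1" unfolding n1_def by (intro Max_ge) auto
    then have "L (min i I0) (Suc n) \<subseteq> K m \<cdot> L (min i I0) n" using nb n by simp
    then show ?thesis using L_eq by (cases "i \<le> I0") (auto simp: min_def)
  qed
  \<comment> \<open>This size of \<open>M\<close> leaves two cases for a leading term at
    \<open>x m [^] i\<close>: either its coefficient has degree above \<open>n1\<close> and comes
    from \<open>K m\<close>, or \<open>i\<close> exceeds \<open>I0\<close> and one factor
    \<open>x m\<close> can be taken out.\<close>
  have "N (Suc M) \<subseteq> K (Suc m) \<cdot> N M" if M: "n1 + I0 + 1 \<le> M" for M
  proof -
    define T where "T i = K (Suc m) \<cdot> N M <+> V i (Suc M)" for i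
    have idKN: "ideal (K (Suc m) \<cdot> N M) R" by (rule ideal_prod_is_ideal[OF low(4) idN])
    have idT: "ideal (T i) R" for i unfolding T_def by (rule add_ideals[OF idKN V])
    have in_T: "x m [^] i \<otimes> z \<in> T i" if i: "i \<le> Suc M" and z: "z \<in> L i (Suc M - i)" for i z
    proof (cases "n1 \<le> M - i \<and> i \<le> M")
      case True
      then have "Suc M - i = Suc (M - i)" by (simp add: Suc_diff_le)
      then have "z \<in> K m \<cdot> L i (M - i)" using n1[of "M - i" i] True z by auto
      moreover have "K m \<cdot> L i (M - i) \<subseteq> {a \<in> carrier R. x m [^] i \<otimes> a \<in> T i}"
      proof (rule ideal_prod_least[OF ideal_colon[OF idT oneideal low(2)]])
        fix y a assume y: "y \<in> K m" and a: "a \<in> L i (M - i)"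
        then obtain g v where g: "g \<in> N M" and v: "v \<in> V i M" and eq: "x m [^] i \<otimes> a = g \<oplus> v"
          using LE[OF a] True by auto
        have ac: "a \<in> carrier R" using ideal_mem_carrier[OF idL a] .
        have yc: "y \<in> carrier R" using ideal_mem_carrier[OF low(3) y] .
        have gv: "g \<in> carrier R" "v \<in> carrier R" using ideal_mem_carrier[OF idN g] ideal_mem_carrier[OF V v] .
        have "x m [^] i \<otimes> (y \<otimes> a) = y \<otimes> (x m [^] i \<otimes> a)" using ac yc low(2)[of i] by algebra
        also have "\<dots> = y \<otimes> g \<oplus> y \<otimes> v" unfolding eq using gv yc by (simp add: r_distr)
        also have "\<dots> \<in> T i"
          unfolding T_def using yKN[OF y g] low_part_K_mult[OF m(1) y v[unfolded V_def], folded V_def]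
          by (rule set_add_memI)
        finally show "y \<otimes> a \<in> {a \<in> carrier R. x m [^] i \<otimes> a \<in> T i}" using yc ac by simp
      qed
      ultimately show ?thesis by blast
    next
      case False
      then have "Suc I0 \<le> i" using M i by linarith
      then obtain i' where i': "i = Suc i'" "I0 \<le> i'" by (cases i) auto
      then have z': "z \<in> L i' (M - i')" using z L_eq[of i] L_eq[of i'] by simp
      have "i' \<le> M" using i i' by simp
      then obtain g v where g: "g \<in> N M" and v: "v \<in> V i' M" and eq: "x m [^] i' \<otimes> z = g \<oplus> v"
        using LE[OF z'] by auto
      have zc: "z \<in> carrier R" using ideal_mem_carrier[OF idL z] .
      have gv: "g \<in> carrier R" "v \<in> carrier R" using ideal_mem_carrier[OF idN g] ideal_mem_carrier[OF V v] .
      have "x m [^] i \<otimes> z = x m \<otimes> (x m [^] i' \<otimes> z)"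
        unfolding i' using zc low(1,2) by (simp add: m_ac nat_pow_Suc)
      also have "\<dots> = x m \<otimes> g \<oplus> x m \<otimes> v" unfolding eq using gv low(1) by (simp add: r_distr)
      also have "\<dots> \<in> T i"
        unfolding T_def i' using xKN[OF g] low_part_x_mult[OF m(1) v[unfolded V_def], folded V_def]
        by (rule set_add_memI)
      finally show ?thesis .
    qed
    \<comment> \<open>The division step of Hilbert's basis theorem: subtracting an element of
      \<open>K (Suc m) \<cdot> N M\<close> with the same leading term lowers the degree in
      \<open>x m\<close>.\<close>
    have claim: "f \<in> K (Suc m) \<cdot> N M" if "f \<in> N (Suc M)" "f \<in> V i (Suc M)" for i f
      using that
    proof (induction i arbitrary: f)
      case 0
      then have "f = \<zero>" unfolding V_def by simp
      then show ?case using ideal_zero_mem[OF idKN] by simp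
    next
      case (Suc i)
      show ?case
      proof (cases "i \<le> Suc M")
        case True
        have "f \<in> V i (Suc M) <+> (\<lambda>z. x m [^] i \<otimes> z) ` ipow (K m) (Suc M - i)"
          using Suc.prems(2) unfolding V_def by simp
        then obtain u z where u: "u \<in> V i (Suc M)" and z: "z \<in> ipow (K m) (Suc M - i)"
          and f: "f = u \<oplus> x m [^] i \<otimes> z" by (rule set_add_cmultE)
        have c: "u \<in> carrier R" "z \<in> carrier R" "f \<in> carrier R"
          using ideal_mem_carrier[OF V u] ideal_mem_carrier[OF low(5) z] ideal_mem_carrier[OF idN Suc.prems(1)] .
        have mu: "\<ominus> u \<in> V i (Suc M)" using u V[of i "Suc M"] by (simp add: additive_subgroup.a_inv_closed ideal.axioms(1))
        have "x m [^] i \<otimes> z = f \<oplus> \<ominus> u"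
          unfolding f using c low(2)[of i] by algebra
        then have "x m [^] i \<otimes> z \<in> N (Suc M) <+> V i (Suc M)"
          using set_add_memI[OF Suc.prems(1) mu] by simp
        then have "z \<in> L i (Suc M - i)" unfolding L_def using z True by simp
        then have "x m [^] i \<otimes> z \<in> K (Suc m) \<cdot> N M <+> V i (Suc M)" using in_T[OF True] unfolding T_def by blast
        then obtain g v where g: "g \<in> K (Suc m) \<cdot> N M" and v: "v \<in> V i (Suc M)" and eq: "x m [^] i \<otimes> z = g \<oplus> v"
          by (rule set_add_memE)
        have gv: "g \<in> carrier R" "v \<in> carrier R" using ideal_mem_carrier[OF idKN g] ideal_mem_carrier[OF V v] .
        have "f \<ominus> g = u \<oplus> v" unfolding f eq using gv c by algebra
        then have "f \<ominus> g \<in> V i (Suc M)" using ideal_add_mem[OF V u v] by simp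
        moreover have "f \<ominus> g \<in> N (Suc M)" using ideal_minus_mem[OF idN Suc.prems(1)] g KN by blast
        ultimately have "f \<ominus> g \<in> K (Suc m) \<cdot> N M" by (intro Suc.IH)
        then show ?thesis using ideal_diff_mem_cancel[OF idKN _ g c(3)] by blast
      next
        case False
        have "f \<in> V (Suc (Suc M)) (Suc M)"
          using Suc.prems(1) Nsub ipow_subset_low_part[OF m(1), of "Suc M"] unfolding V_def by blast
        then have "f \<in> V i (Suc M)" using low_part_mono[OF m(1), of "Suc (Suc M)" i "Suc M"] False
          unfolding V_def by auto
        then show ?thesis using Suc.IH Suc.prems(1) by blast
      qed
    qed
    show ?thesis
    proof
      fix f assume f: "f \<in> N (Suc M)"
      then have "f \<in> V (Suc (Suc M)) (Suc M)"
        using Nsub ipow_subset_low_part[OF m(1), of "Suc M"] unfolding V_def by blast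
      then show "f \<in> K (Suc m) \<cdot> N M" using claim[OF f] by blast
    qed
  qed
  then show ?case by blast
qed

end

section \<open>Binomial identities\<close>

text \<open>Inclusion-exclusion for the \<open>m\<close>-subsets of an \<open>M\<close>-set that
  avoid \<open>k\<close> given elements. It rewrites the shifted binomials of the Hilbert function
  in the basis of \<open>hilbert_coeff\<close> and is the source of the factors
  \<open>k choose i\<close>.\<close>

lemma binomial_shift_expansion:
  assumes "k + m \<le> M"
  shows "int ((M - k) choose m) = (\<Sum>i\<le>m. (-1) ^ i * int (k choose i) * int ((M - i) choose (m - i)))"
  using assms
proof (induction k arbitrary: M m)
  case 0
  have "(\<Sum>i\<le>m. (-1) ^ i * int (0 choose i) * int ((M - i) choose (m - i))) =
     (\<Sum>i\<in>{0}. (-1) ^ i * int (0 choose i) * int ((M - i) choose (m - i)))"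
    by (rule sum.mono_neutral_right) auto
  then show ?case by simp
next
  case (Suc k)
  show ?case
  proof (cases m)
    case (Suc m')
    then obtain M' where M: "M = Suc M'" "k + m' < M'" using Suc.prems by (cases M) auto
    have "(\<Sum>i\<le>Suc m'. (-1) ^ i * int (Suc k choose i) * int ((M - i) choose (Suc m' - i))) =
      int (M choose Suc m') + (\<Sum>i\<le>m'. (-1) ^ Suc i * int (Suc k choose Suc i) * int ((M' - i) choose (m' - i)))"
      unfolding sum.atMost_Suc_shift using M by simp
    also have "\<dots> = (int (M choose Suc m') + (\<Sum>i\<le>m'. (-1) ^ Suc i * int (k choose Suc i) * int ((M' - i) choose (m' - i))))
        - (\<Sum>i\<le>m'. (-1) ^ i * int (k choose i) * int ((M' - i) choose (m' - i)))"
      by (simp add: algebra_simps sum.distrib sum_subtractf sum_negf)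
    also have "int (M choose Suc m') + (\<Sum>i\<le>m'. (-1) ^ Suc i * int (k choose Suc i) * int ((M' - i) choose (m' - i)))
        = (\<Sum>i\<le>Suc m'. (-1) ^ i * int (k choose i) * int ((M - i) choose (Suc m' - i)))"
      unfolding sum.atMost_Suc_shift using M by simp
    also have "\<dots> = int ((M - k) choose Suc m')" using Suc.IH[of "Suc m'" M] M by simp
    also have "(\<Sum>i\<le>m'. (-1) ^ i * int (k choose i) * int ((M' - i) choose (m' - i))) = int ((M' - k) choose m')"
      using Suc.IH[of m' M'] M by simp
    also have "M - k = Suc (M' - k)" using M by simp
    finally show ?thesis using Suc M by simp
  qed simp
qed

text \<open>Taking differences in \<open>n\<close> turns a relation for \<open>Suc d\<close> into
  one for \<open>d\<close> and loses only the constant term, which is the last coefficient and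
  vanishes once the others do.\<close>

lemma binomial_basis_unique:
  fixes c :: "nat \<Rightarrow> int"
  assumes "\<forall>\<^sub>F n in sequentially. (\<Sum>i\<le>d. c i * int ((n + d - 1 - i) choose (d - i))) = 0" "i \<le> d"
  shows "c i = 0"
  using assms
proof (induction d arbitrary: i)
  case 0
  then show ?case by (auto simp: eventually_sequentially)
next
  case (Suc d)
  let ?g = "\<lambda>n. \<Sum>i\<le>Suc d. c i * int ((n + d - i) choose (Suc d - i))"
  have ev: "\<forall>\<^sub>F n in sequentially. ?g n = 0" using Suc.prems(1) by simp
  then have ev': "\<forall>\<^sub>F n in sequentially. ?g (Suc n) = 0"
    using eventually_sequentially_Suc[of "\<lambda>n. ?g n = 0"] by blast
  have diff: "?g (Suc n) - ?g n = (\<Sum>i\<le>d. c i * int ((Suc n + d - 1 - i) choose (d - i)))" for n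
  proof -
    have "?g (Suc n) - ?g n =
      (\<Sum>i\<le>d. c i * int ((Suc n + d - i) choose (Suc d - i)) - c i * int ((n + d - i) choose (Suc d - i)))"
      by (simp add: sum_subtractf)
    also have "\<dots> = (\<Sum>i\<le>d. c i * int ((Suc n + d - 1 - i) choose (d - i)))"
      by (intro sum.cong) (auto simp: Suc_diff_le algebra_simps)
    finally show ?thesis .
  qed
  have "\<forall>\<^sub>F n in sequentially. (\<Sum>i\<le>d. c i * int ((Suc n + d - 1 - i) choose (d - i))) = 0"
    using ev ev' by eventually_elim (simp only: diff[symmetric])
  then have "\<forall>\<^sub>F n in sequentially. (\<Sum>i\<le>d. c i * int ((n + d - 1 - i) choose (d - i))) = 0"
    using eventually_sequentially_Suc[of "\<lambda>n. (\<Sum>i\<le>d. c i * int ((n + d - 1 - i) choose (d - i))) = 0"] by blast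
  then have zero: "c i = 0" if "i \<le> d" for i using Suc.IH that by blast
  show ?case
  proof (cases "i = Suc d")
    case True
    from ev have "\<forall>\<^sub>F n in sequentially. c (Suc d) = 0" by eventually_elim (simp add: zero)
    then show ?thesis using True by simp
  qed (use zero Suc.prems in simp)
qed

lemma sum_multichoose: "(\<Sum>j\<le>n. (j + d - 1) choose j) = (n + d) choose n"
  by (induction n) auto

text \<open>For \<open>d \<ge> 2\<close> the left side grows in \<open>s\<close> with degree
  \<open>d - 1\<close> and the right side with degree \<open>d - 2\<close>; for \<open>d = 1\<close>
  the right side already vanishes at \<open>s = 1\<close>.\<close>

lemma multichoose_growth:
  assumes "0 < d" "0 < c" and le: "\<And>s. ((n + s + d - 1) choose (n + s)) * c \<le> ((s + (d - 1) - 1) choose s) * b"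
  shows False
proof (cases "d - 1")
  case 0
  then show False using le[of 1] assms(1,2) by (simp add: zero_less_binomial_iff)
next
  case (Suc e)
  then have d: "d = Suc (Suc e)" using assms(1) by simp
  \<comment> \<open>The binomials \<open>(s + e + 1) choose (e + 1)\<close> and
    \<open>(s + e) choose e\<close> have quotient \<open>(s + e + 1)/(e + 1)\<close>, which exceeds
    \<open>b\<close> at this \<open>s\<close>.\<close>
  define s where "s = b * Suc e"
  have "Suc e * ((s + Suc e) choose Suc e) = (s + Suc e) * ((s + e) choose e)"
    using Suc_times_binomial_eq[of "s + e" e] by (simp add: mult.commute)
  moreover have "(s + Suc e) choose Suc e \<le> (n + s + Suc e) choose Suc e"
    by (rule binomial_right_mono) auto
  moreover have "\<dots> = (n + s + d - 1) choose (n + s)"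
    using binomial_symmetric[of "Suc e" "n + s + Suc e"] d by simp
  moreover have "\<dots> \<le> ((n + s + d - 1) choose (n + s)) * c" using assms(2) by simp
  moreover have "\<dots> \<le> ((s + (d - 1) - 1) choose s) * b" by (rule le)
  moreover have "(s + (d - 1) - 1) choose s = (s + e) choose e"
    using binomial_symmetric[of s "s + e"] d by simp
  ultimately have "(s + Suc e) * ((s + e) choose e) \<le> Suc e * (((s + e) choose e) * b)"
    by (metis (no_types, lifting) le_trans mult_le_mono2)
  then have "((s + e) choose e) * (s + Suc e) \<le> ((s + e) choose e) * s" by (simp add: s_def algebra_simps)
  then have "s + Suc e \<le> s" by (simp only: mult_le_cancel1) simp
  then show False by simp
qed

section \<open>Reductions\<close>

lemma (in ring) ideal_length_pos:
  assumes "ideal A R" "ideal B R" "B \<subset> A"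
  shows "enat 1 \<le> ideal_length R A B"
  using assms by (intro ideal_length_geI[where N = "\<lambda>j. if j = 0 then B else A"]) auto

locale local_regular_tower = noetherian_local_ring + regular_tower +
  assumes K_proper: "K d \<noteq> carrier R"
    and nilpotent: "\<mu> \<in> \<mm> \<Longrightarrow> \<exists>n::nat. \<mu> [^] n \<in> K d"
begin

lemma finite_colength: "ideal_length R (carrier R) (K d) \<noteq> \<infinity>"
  using ideal_length_finite[OF K_ideal] nilpotent by blast

lemma ideal_length_ipow_step:
  "ideal_length R (ipow (K d) n) (ipow (K d) (Suc n))
    = of_nat ((n + d - 1) choose n) * ideal_length R (carrier R) (K d)"
proof -
  have id: "ideal (K d) R" using K_ideal by simp
  have "carrier R \<inter> K d = K d" using ideal_subset_carrier[OF id] by blast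
  moreover have "K d \<cdot> ipow (K d) n = ipow (K d) (Suc n)"
    using ideal_prod_commute[OF ipow_ideal[OF id] id] by (simp only: ipow_Suc)
  ultimately show ?thesis
    using ideal_length_prod[OF oneideal id order_refl order_refl, of n]
    by (simp only: carrier_prod ipow_ideal id)
qed

text \<open>A smaller \<open>J\<close> would lie in an ideal \<open>W\<close> maximal among those
  properly inside \<open>I\<close>, and \<open>I = W + x m R\<close> for some \<open>m\<close>. The
  other generators, corrected by multiples of \<open>x m\<close>, give an ideal
  \<open>B \<subseteq> W\<close> with \<open>d - 1\<close> generators, and Nakayama turns the
  equation for \<open>J\<close> into \<open>I\<^sup>n\<^sup>+\<^sup>1 = B I\<^sup>n\<close>. Then
  \<open>I\<^sup>n\<^sup>+\<^sup>s = I\<^sup>n B\<^sup>s\<close> bounds lengths by a count for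
  \<open>d - 1\<close> generators, against the exact count for \<open>d\<close>.\<close>

theorem no_proper_reduction:
  assumes J: "ideal J R" "J \<subseteq> K d" and red: "J \<cdot> ipow (K d) n = ipow (K d) (Suc n)"
  shows "J = K d"
proof (rule ccontr)
  assume "J \<noteq> K d"
  define I where "I = K d"
  have I: "ideal I R" unfolding I_def using K_ideal by simp
  define S where "S = {W. ideal W R \<and> J \<subseteq> W \<and> W \<subseteq> I \<and> W \<noteq> I}"
  obtain W where WS: "W \<in> S" and Wmax: "\<forall>P\<in>S. W \<subseteq> P \<longrightarrow> P = W"
  proof (rule maximal_ideal_in_family)
    show "S \<noteq> {}" "\<And>P. P \<in> S \<Longrightarrow> ideal P R" unfolding S_def I_def using J \<open>J \<noteq> K d\<close> by auto
  qed
  then have W: "ideal W R" "J \<subseteq> W" "W \<subseteq> I" "W \<noteq> I" unfolding S_def by auto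
  have "\<exists>m<d. x m \<notin> W"
  proof (rule ccontr)
    assume all: "\<not> (\<exists>m<d. x m \<notin> W)"
    have "K j \<subseteq> W" if "j \<le> d" for j
      using that
    proof (induction j)
      case 0
      then show ?case using ideal_zero_mem[OF W(1)] by (simp add: K_0)
    next
      case (Suc j)
      then have "(\<lambda>z. x j \<otimes> z) ` carrier R \<subseteq> W" using all ideal.I_r_closed[OF W(1)] by auto
      then show ?case using Suc by (auto simp: K_Suc dest: set_add_lub[OF W(1), THEN subsetD, rotated 2])
    qed
    then show False using W(3,4) unfolding I_def by blast
  qed
  then obtain m where m: "m < d" "x m \<notin> W" by blast
  have xc: "x m \<in> carrier R" using x_carrier m by simp
  have xI: "x j \<in> I" if "j < d" for j
    using x_mem[OF that] K_mono[of d "Suc j"] that unfolding I_def by auto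
  have xR: "ideal ((\<lambda>z. x m \<otimes> z) ` carrier R) R" using ideal_cmult[OF oneideal xc] .
  define P where "P = W <+> (\<lambda>z. x m \<otimes> z) ` carrier R"
  have P: "ideal P R" "W \<subseteq> P" unfolding P_def by (rule add_ideals[OF W(1) xR], rule set_add_ub1[OF W(1) xR])
  have "x m \<otimes> \<one> \<in> P" unfolding P_def using set_add_ub2[OF W(1) xR] by blast
  then have "x m \<in> P" using xc by simp
  have "(\<lambda>z. x m \<otimes> z) ` carrier R \<subseteq> I" using ideal.I_r_closed[OF I xI[OF m(1)]] by blast
  then have "P \<subseteq> I" unfolding P_def by (rule set_add_lub[OF I W(3)])
  then have PI: "P = I" using Wmax P W(2) \<open>x m \<in> P\<close> m(2) unfolding S_def by auto
  have "\<exists>w\<in>W. \<exists>c\<in>carrier R. x k = w \<oplus> x m \<otimes> c" if "k < d" for k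
  proof -
    have "x k \<in> W <+> (\<lambda>z. x m \<otimes> z) ` carrier R" using xI[OF that] PI P_def by simp
    then obtain w c where "w \<in> W" "c \<in> carrier R" "x k = w \<oplus> x m \<otimes> c" by (rule set_add_cmultE)
    then show ?thesis by blast
  qed
  then obtain w c where w: "w k \<in> W" and c: "c k \<in> carrier R" and xw: "x k = w k \<oplus> x m \<otimes> c k"
    if "k < d" for k by metis
  \<comment> \<open>Enumerates the indices below \<open>d\<close> other than
    \<open>m\<close>.\<close>
  define e where "e j = (if j < m then j else Suc j)" for j
  have e: "e j < d" if "j < d - 1" for j using that m unfolding e_def by auto
  define L where "L = rec_nat {\<zero>} (\<lambda>j L. L <+> (\<lambda>z. w (e j) \<otimes> z) ` carrier R)"
  have wc: "w k \<in> carrier R" if "k < d" for k using ideal_mem_carrier[OF W(1) w[OF that]] .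
  interpret T: ideal_tower R L "\<lambda>j. w (e j)" "d - 1"
    by unfold_locales (simp_all add: L_def wc e)
  have LW: "L j \<subseteq> W" if "j \<le> d - 1" for j
    using that
  proof (induction j)
    case 0
    then show ?case using ideal_zero_mem[OF W(1)] by (simp add: T.K_0)
  next
    case (Suc j)
    then have "(\<lambda>z. w (e j) \<otimes> z) ` carrier R \<subseteq> W" using w[OF e] ideal.I_r_closed[OF W(1)] by auto
    then have "L j <+> (\<lambda>z. w (e j) \<otimes> z) ` carrier R \<subseteq> W" using Suc by (intro set_add_lub[OF W(1)]) simp_all
    then show ?case using T.K_Suc[of j] Suc.prems by simp
  qed
  define B where "B = L (d - 1)"
  have B: "ideal B R" "B \<subseteq> W" unfolding B_def using T.K_ideal LW by simp_all
  define Q where "Q = B <+> (\<lambda>z. x m \<otimes> z) ` carrier R"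
  have Q: "ideal Q R" "B \<subseteq> Q" "(\<lambda>z. x m \<otimes> z) ` carrier R \<subseteq> Q"
    unfolding Q_def by (rule add_ideals[OF B(1) xR], rule set_add_ub1[OF B(1) xR], rule set_add_ub2[OF B(1) xR])
  have xQ: "x k \<in> Q" if k: "k < d" for k
  proof (cases "k = m")
    case True
    have "x m \<otimes> \<one> \<in> Q" using Q(3) by blast
    then show ?thesis using xc True by simp
  next
    case False
    define j where "j = (if k < m then k else k - 1)"
    have j: "j < d - 1" "e j = k" using False k m unfolding j_def e_def by auto
    have "w k \<in> L (Suc j)" using T.x_mem[OF j(1)] j(2) by simp
    then have "w k \<in> Q" using T.K_mono[of "d - 1" "Suc j"] j(1) Q(2) unfolding B_def by auto
    moreover have "x m \<otimes> c k \<in> Q" using Q(3) c[OF k] by blast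
    ultimately have "w k \<oplus> x m \<otimes> c k \<in> Q" by (rule ideal_add_mem[OF Q(1)])
    then show ?thesis using xw[OF k] by simp
  qed
  have "K j \<subseteq> Q" if "j \<le> d" for j
    using that
  proof (induction j)
    case 0
    then show ?case using ideal_zero_mem[OF Q(1)] by (simp add: K_0)
  next
    case (Suc j)
    then have "(\<lambda>z. x j \<otimes> z) ` carrier R \<subseteq> Q" using xQ[of j] ideal.I_r_closed[OF Q(1)] by auto
    then have "K j <+> (\<lambda>z. x j \<otimes> z) ` carrier R \<subseteq> Q" using Suc by (intro set_add_lub[OF Q(1)]) simp_all
    then show ?case using K_Suc[of j] Suc.prems by simp
  qed
  then have IQ: "I \<subseteq> Q" unfolding I_def by simp
  have mI: "ideal (\<mm> \<cdot> I) R" using ideal_prod_is_ideal[OF maximal_is_ideal I] .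
  \<comment> \<open>If \<open>b + x m r\<close> lies in \<open>W\<close>, so does
    \<open>x m r\<close>; as \<open>x m\<close> is not in \<open>W\<close>, the factor
    \<open>r\<close> is no unit, whence \<open>x m r \<in> \<mm> I\<close>.\<close>
  have W_sub: "W \<subseteq> B <+> \<mm> \<cdot> I"
  proof
    fix a assume a: "a \<in> W"
    then have "a \<in> B <+> (\<lambda>z. x m \<otimes> z) ` carrier R" using W(3) IQ unfolding Q_def by blast
    then obtain b r where b: "b \<in> B" and r: "r \<in> carrier R" and ab: "a = b \<oplus> x m \<otimes> r" by (rule set_add_cmultE)
    have xr: "x m \<otimes> r \<in> W"
      using ideal_sum_mem_cancel[OF W(1), of b "x m \<otimes> r"] a b B(2) ab xc r by auto
    define C where "C = {r \<in> carrier R. x m \<otimes> r \<in> W}"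
    have C: "ideal C R" unfolding C_def by (rule ideal_colon[OF W(1) oneideal xc])
    have "\<one> \<notin> C" unfolding C_def using m(2) xc by simp
    then have "C \<subseteq> \<mm>" using proper_ideal_subset_maximal[OF C] by auto
    then have "r \<otimes> x m \<in> \<mm> \<cdot> I"
      using r xr xI[OF m(1)] unfolding C_def by (intro ideal_prod.prod) auto
    then show "a \<in> B <+> \<mm> \<cdot> I"
      using set_add_memI[OF b] m_comm[OF r xc] ab by auto
  qed
  have In: "ideal (ipow I k) R" for k using ipow_ideal[OF I] .
  have BIn: "ideal (B \<cdot> ipow I n) R" using ideal_prod_is_ideal[OF B(1) In] .
  have IIn: "I \<cdot> ipow I k = ipow I (Suc k)" for k
    using ideal_prod_commute[OF I In] by (simp only: ipow_Suc)
  have "ipow I (Suc n) \<subseteq> (B <+> \<mm> \<cdot> I) \<cdot> ipow I n"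
    unfolding I_def red[symmetric] unfolding I_def[symmetric]
    using W(2) W_sub by (intro ideal_prod_mono order_refl) blast
  also have "\<dots> = B \<cdot> ipow I n <+> \<mm> \<cdot> ipow I (Suc n)"
    using ideal_prod_distr(2)[OF In B(1) mI, of n] ideal_prod_assoc[OF maximal_is_ideal I In, of n] IIn by simp
  finally have "ipow I (Suc n) = B \<cdot> ipow I n"
    using ideal_prod_mono[of B I "ipow I n" "ipow I n"] B(2) W(3) IIn
    by (intro nakayama[OF In BIn]) auto
  then have B_red: "I \<cdot> ipow I n = B \<cdot> ipow I n" using IIn by simp
  have I_pow: "ipow I (n + s) = ipow I n \<cdot> ipow B s" for s
  proof (induction s)
    case 0
    show ?case using ideal_prod_ipow_0[OF In] by simp
  next
    case (Suc s)
    have Bs: "ideal (ipow B s) R" using ipow_ideal[OF B(1)] .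
    have "ipow I (n + Suc s) = I \<cdot> ipow I (n + s)" using IIn by simp
    also have "\<dots> = (I \<cdot> ipow I n) \<cdot> ipow B s" unfolding Suc using ideal_prod_assoc[OF I In Bs] by simp
    also have "\<dots> = (ipow I n \<cdot> B) \<cdot> ipow B s" unfolding B_red using ideal_prod_commute[OF B(1) In] by simp
    also have "\<dots> = ipow I n \<cdot> (B \<cdot> ipow B s)" using ideal_prod_assoc[OF In B(1) Bs] .
    also have "B \<cdot> ipow B s = ipow B (Suc s)" using ideal_prod_commute[OF B(1) Bs] by (simp only: ipow_Suc)
    finally show ?case .
  qed
  have I_pow': "ipow I (Suc (n + s)) = ipow I (Suc n) \<cdot> ipow B s" for s
    unfolding IIn[symmetric] I_pow using ideal_prod_assoc[OF I In ipow_ideal[OF B(1)]] by simp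
  obtain l where l: "ideal_length R (carrier R) I = enat l"
    using finite_colength unfolding I_def by auto
  have "I \<subset> carrier R" using ideal_subset_carrier[OF I] K_proper unfolding I_def by blast
  then have "0 < l" using ideal_length_pos[OF oneideal I] l by simp
  have len: "ideal_length R (ipow I k) (ipow I (Suc k)) = enat (((k + d - 1) choose k) * l)" for k
    using ideal_length_ipow_step[of k] l unfolding I_def by (simp add: of_nat_eq_enat)
  have "((n + s + d - 1) choose (n + s)) * l \<le> ((s + (d - 1) - 1) choose s) * (((n + d - 1) choose n) * l)" for s
  proof -
    have "enat (((n + s + d - 1) choose (n + s)) * l) = ideal_length R (ipow I n \<cdot> ipow B s) (ipow I (Suc n) \<cdot> ipow B s)"
      using len[of "n + s"] unfolding I_pow I_pow' by simp
    also have "\<dots> \<le> of_nat ((s + (d - 1) - 1) choose s) * ideal_length R (ipow I n) (ipow I (Suc n))"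
      unfolding B_def by (rule T.ideal_length_prod_le[OF In In ipow_antimono[OF I] order_refl]) simp
    also have "\<dots> = enat (((s + (d - 1) - 1) choose s) * (((n + d - 1) choose n) * l))"
      unfolding len by (simp add: of_nat_eq_enat)
    finally show ?thesis by simp
  qed
  then show False using multichoose_growth[of d l n] \<open>0 < l\<close> m(1) by blast
qed

end

section \<open>The Hilbert function\<close>

lemma enat_the_enat: "a \<noteq> \<infinity> \<Longrightarrow> enat (the_enat a) = a"
  by (cases a) simp_all

text \<open>On the integers a satisfiable predicate may have no least element; a bound from below
  reduces the matter to the natural numbers.\<close>

lemma int_Least_nonneg:
  fixes P :: "int \<Rightarrow> bool"
  assumes "P a" "\<And>n. P n \<Longrightarrow> 0 \<le> n"
  shows "P (LEAST n. P n)"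
proof -
  define k where "k = (LEAST k. P (int k))"
  have "P (int (nat a))" using assms by simp
  then have k: "P (int k)" unfolding k_def by (rule LeastI)
  have "int k \<le> n" if "P n" for n
    using Least_le[of "\<lambda>k. P (int k)" "nat n"] that assms(2)[OF that] unfolding k_def by simp
  then have "(LEAST n. P n) = int k" using k by (intro Least_equality)
  then show ?thesis using k by simp
qed

lemma (in cring) genideal_insert:
  assumes "S \<subseteq> carrier R" "y \<in> carrier R"
  shows "Idl (insert y S) = Idl S <+> (\<lambda>z. y \<otimes> z) ` carrier R"
proof
  have S: "ideal (Idl S) R" using genideal_ideal assms(1) .
  have Y: "ideal ((\<lambda>z. y \<otimes> z) ` carrier R) R" using ideal_cmult[OF oneideal assms(2)] .
  have "y \<otimes> \<one> \<in> (\<lambda>z. y \<otimes> z) ` carrier R" by blast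
  then have "y \<in> (\<lambda>z. y \<otimes> z) ` carrier R" using assms(2) by simp
  then have "insert y S \<subseteq> Idl S <+> (\<lambda>z. y \<otimes> z) ` carrier R"
    using set_add_ub1[OF S Y] set_add_ub2[OF S Y] genideal_self[OF assms(1)] by blast
  then show "Idl (insert y S) \<subseteq> Idl S <+> (\<lambda>z. y \<otimes> z) ` carrier R"
    by (rule genideal_minimal[OF add_ideals[OF S Y]])
  have yS: "insert y S \<subseteq> carrier R" using assms by blast
  have G: "ideal (Idl (insert y S)) R" using genideal_ideal yS .
  have y: "y \<in> Idl (insert y S)" and sub: "S \<subseteq> Idl (insert y S)" using genideal_self[OF yS] by blast+
  have "(\<lambda>z. y \<otimes> z) ` carrier R \<subseteq> Idl (insert y S)" using ideal.I_r_closed[OF G y] by blast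
  then show "Idl S <+> (\<lambda>z. y \<otimes> z) ` carrier R \<subseteq> Idl (insert y S)"
    by (rule set_add_lub[OF G genideal_minimal[OF G sub]])
qed

lemma (in cring) genideal_empty: "Idl {} = {\<zero>}"
  using genideal_minimal[OF zeroideal, of "{}"] ideal_zero_mem[OF genideal_ideal, of "{}"] by blast

lemma local_regular_towerI:
  fixes R (structure)
  assumes "noetherian_local_ring R \<mm>" "regular_sequence R xs" "radical R (Idl (set xs)) = \<mm>"
  shows "local_regular_tower R \<mm> (\<lambda>m. Idl (set (take m xs))) (\<lambda>m. xs ! m) (length xs)"
proof -
  interpret noetherian_local_ring R \<mm> by fact
  have c: "set xs \<subseteq> carrier R"
    and reg: "\<forall>j<length xs. \<forall>a\<in>carrier R. xs ! j \<otimes> a \<in> Idl (set (take j xs)) \<longrightarrow> a \<in> Idl (set (take j xs))"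
    and proper: "Idl (set xs) \<noteq> carrier R"
    using assms(2) unfolding regular_sequence_def by auto
  show ?thesis
  proof unfold_locales
    show "Idl (set (take 0 xs)) = {\<zero>}" by (simp add: genideal_empty)
    show "xs ! m \<in> carrier R" if "m < length xs" for m using c that by auto
    then show "Idl (set (take (Suc m) xs)) = Idl (set (take m xs)) <+> (\<lambda>z. xs ! m \<otimes> z) ` carrier R"
      if "m < length xs" for m
      using that c genideal_insert[of "set (take m xs)" "xs ! m"] set_take_subset[of m xs]
      by (simp add: take_Suc_conv_app_nth)
    show "z \<in> Idl (set (take m xs))"
      if "m < length xs" "z \<in> carrier R" "xs ! m \<otimes> z \<in> Idl (set (take m xs))" for m z
      using reg that by blast
    show "Idl (set (take (length xs) xs)) \<noteq> carrier R" using proper by simp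
    show "\<exists>n::nat. \<mu> [^] n \<in> Idl (set (take (length xs) xs))" if "\<mu> \<in> \<mm>" for \<mu>
      using that unfolding assms(3)[symmetric] radical_def by simp
  qed
qed

section \<open>Stability of the filtration and its reduction number\<close>

locale filtered_tower = local_regular_tower +
  fixes F :: "int \<Rightarrow> 'a set" and I
  assumes I_eq: "I = K d"
    and admissible: "I_admissible R \<mm> I F"
begin

lemma I_ideal: "ideal I R"
  unfolding I_eq using K_ideal by simp

lemma ideal_power_int: "ideal_power R I (int n) = ipow I n"
  by (simp add: ideal_power_def)

lemma ideal_power_1: "ideal_power R I 1 = I"
  using ideal_power_int[of "Suc 0"] ipow_1[OF I_ideal] by simp

lemma filtration: "I_filtration R \<mm> I F"
  using admissible unfolding I_admissible_def by simp

lemma F_ideal: "ideal (F n) R"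
  and F_nonpos: "n \<le> 0 \<Longrightarrow> F n = carrier R"
  and F_mult: "F m \<cdot> F n \<subseteq> F (m + n)"
  and F_power: "ideal_power R I n \<subseteq> F n"
  using filtration unfolding I_filtration_def by auto

lemma I_subset_F1: "I \<subseteq> F 1"
  using F_power[of 1] ideal_power_1 by simp

lemma I_mult_F: "I \<cdot> F n \<subseteq> F (n + 1)"
  using ideal_prod_mono[OF I_subset_F1 order_refl, of "F n"] F_mult[of 1 n] by (simp add: add.commute)

text \<open>Admissibility places \<open>F (n + k)\<close> inside \<open>I\<^sup>n\<close>, so after
  a shift by \<open>k\<close> the filtration is a graded submodule of the Rees algebra of
  \<open>I\<close>, and finite generation applies.\<close>

lemma stable: "\<exists>n0. \<forall>n\<ge>n0. I \<cdot> F n = F (n + 1)"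
proof -
  obtain k :: nat where k: "\<And>n. F n \<subseteq> ideal_power R I (n - int k)"
    using admissible unfolding I_admissible_def by blast
  have "\<exists>n0. \<forall>n\<ge>n0. F (int (Suc n) + int k) \<subseteq> K d \<cdot> F (int n + int k)"
  proof (rule graded_family_stable[OF noetherian_ring_axioms order_refl, where N = "\<lambda>n. F (int n + int k)"])
    show "ideal (F (int n + int k)) R" for n by (rule F_ideal)
    show "F (int n + int k) \<subseteq> ipow (K d) n" for n
      using k[of "int n + int k"] ideal_power_int[of n] unfolding I_eq by simp
    show "K d \<cdot> F (int n + int k) \<subseteq> F (int (Suc n) + int k)" for n
      using I_mult_F[of "int n + int k"] unfolding I_eq by (simp add: ac_simps)
  qed
  then obtain n0 where n0: "\<And>n. n \<ge> n0 \<Longrightarrow> F (int (Suc n) + int k) \<subseteq> I \<cdot> F (int n + int k)"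
    unfolding I_eq by blast
  have "I \<cdot> F n = F (n + 1)" if "int n0 + int k \<le> n" for n
  proof
    define l where "l = nat (n - int k)"
    have l: "int (Suc l) + int k = n + 1" "int l + int k = n" "n0 \<le> l"
      using that unfolding l_def by linarith+
    show "F (n + 1) \<subseteq> I \<cdot> F n" using n0[OF l(3)] unfolding l(1,2) .
  qed (rule I_mult_F)
  then show ?thesis by blast
qed

text \<open>By \<open>no_proper_reduction\<close> the ideal \<open>I\<close> is its own only
  reduction, so the minimum that defines the reduction number is taken over a single value.\<close>

lemma minimal_reduction_iff: "is_minimal_reduction R I J \<longleftrightarrow> J = I"
proof -
  have red: "J = I" if J: "is_reduction R (ideal_power R I) J" for J
  proof -
    obtain N where N: "\<forall>n\<ge>N. J \<cdot> ideal_power R I n = ideal_power R I (n + 1)"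
      using J unfolding is_reduction_def eventually_at_top_linorder by blast
    have "J \<cdot> ideal_power R I (int (nat N)) = ideal_power R I (int (nat N) + 1)" using N by simp
    also have "int (nat N) + 1 = int (Suc (nat N))" by simp
    finally have "J \<cdot> ipow I (nat N) = ipow I (Suc (nat N))" by (simp only: ideal_power_int)
    moreover have "ideal J R" "J \<subseteq> I" using J unfolding is_reduction_def ideal_power_1 by simp_all
    ultimately show ?thesis using no_proper_reduction unfolding I_eq by blast
  qed
  have "I \<cdot> ideal_power R I n = ideal_power R I (n + 1)" if "0 \<le> n" for n
  proof -
    define k where "k = nat n"
    have k: "n = int k" using that unfolding k_def by simp
    then have "n + 1 = int (Suc k)" by simp
    then show ?thesis
      unfolding k using ideal_prod_commute[OF I_ideal ipow_ideal[OF I_ideal]]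
      by (simp only: ideal_power_int ipow_Suc)
  qed
  then have "is_reduction R (ideal_power R I) I"
    unfolding is_reduction_def ideal_power_1 eventually_at_top_linorder using I_ideal by blast
  then have "is_reduction R (ideal_power R I) J \<longleftrightarrow> J = I" for J using red by auto
  then show ?thesis unfolding is_minimal_reduction_def by auto
qed

definition r where "r = reduction_number R I F"

lemma reduction_number_stable: "r \<le> n \<Longrightarrow> I \<cdot> F n = F (n + 1)"
proof -
  let ?P = "\<lambda>n. \<forall>m\<ge>n. I \<cdot> F m = F (m + 1)"
  have "r = reduction_number_wrt R F I"
    unfolding r_def reduction_number_def minimal_reduction_iff by (auto intro: Least_equality)
  moreover have "?P (LEAST n. ?P n)"
  proof -
    obtain n0 where "?P n0" using stable by blast
    then show ?thesis
    proof (rule int_Least_nonneg)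
      fix n assume P: "?P n"
      show "0 \<le> n"
      proof (rule ccontr)
        assume "\<not> 0 \<le> n"
        \<comment> \<open>A bound \<open>n < 0\<close> would cover the index \<open>-1\<close>,
          where the equation reads \<open>I R = R\<close>.\<close>
        then have "I \<cdot> F (-1) = F (-1 + 1)" using P by simp
        then have "I = carrier R" using ideal_prod_one[OF I_ideal] by (simp add: F_nonpos)
        then show False using K_proper unfolding I_eq by simp
      qed
    qed
  qed
  ultimately show "r \<le> n \<Longrightarrow> I \<cdot> F n = F (n + 1)" unfolding reduction_number_wrt_def by simp
qed

end

section \<open>The Hilbert function under the conditions HI\<close>

locale HI_filtered_tower = filtered_tower +
  assumes HI_small: "p \<le> r - 2 \<Longrightarrow> HI R I F p"
begin

lemma HI_all: "F (p + int k + 1) \<inter> ipow I k = F (p + 1) \<cdot> ipow I k"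
proof (cases "p \<le> r - 2")
  case True
  have "p \<le> p + int k" by simp
  then have "F (p + int k + 1) \<inter> ideal_power R I (p + int k - p) = F (p + 1) \<cdot> ideal_power R I (p + int k - p)"
    using HI_small[OF True] unfolding HI_def by blast
  then show ?thesis using ideal_power_int[of k] by simp
next
  case False
  have "F (p + int k + 1) = F (p + 1) \<cdot> ipow I k"
  proof (induction k)
    case 0
    show ?case using ideal_prod_ipow_0[OF F_ideal] by simp
  next
    case (Suc k)
    have "F (p + int (Suc k) + 1) = I \<cdot> F (p + int k + 1)"
      using reduction_number_stable[of "p + int k + 1"] False by (simp add: ac_simps)
    also have "\<dots> = F (p + 1) \<cdot> ipow I (Suc k)"
      unfolding Suc ideal_prod_ipow_Suc[OF F_ideal I_ideal]
      by (rule ideal_prod_commute[OF I_ideal ideal_prod_is_ideal[OF F_ideal ipow_ideal[OF I_ideal]]])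
    finally show ?case .
  qed
  moreover have "F (p + 1) \<cdot> ipow I k \<subseteq> ipow I k"
    by (rule ideal_prod_subset2[OF F_ideal ipow_ideal[OF I_ideal]])
  ultimately show ?thesis by blast
qed

definition v :: "nat \<Rightarrow> enat" where
  "v k = ideal_length R (F (int k + 1)) (I \<cdot> F (int k))"

lemma HI_step:
  assumes "j \<le> n"
  shows "ideal_length R (F (int n + 1) \<inter> ipow I j) (F (int n + 1) \<inter> ipow I (Suc j))
    = of_nat ((j + d - 1) choose j) * v (n - j)"
proof -
  define A where "A = F (int (n - j) + 1)"
  have A: "ideal A R" unfolding A_def by (rule F_ideal)
  have 1: "F (int n + 1) \<inter> ipow I j = A \<cdot> ipow I j"
    using HI_all[of "int (n - j)" j] assms unfolding A_def by simp
  \<comment> \<open>Taken at \<open>p = n - j - 1\<close> with exponent one. For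
    \<open>j = n\<close> this is \<open>p = -1\<close>, where \<open>F (p + 1)\<close> is the whole
    ring; so \<open>HI_all\<close> has to allow negative \<open>p\<close>.\<close>
  have AI: "A \<inter> I = F (int (n - j)) \<cdot> I"
    using HI_all[of "int (n - j) - 1" "Suc 0"] unfolding A_def by (simp add: ipow_1 I_ideal)
  have "F (int n + 1) \<inter> ipow I (Suc j) = F (int (n - j)) \<cdot> ipow I (Suc j)"
    using HI_all[of "int (n - j) - 1" "Suc j"] assms by (simp add: algebra_simps)
  also have "\<dots> = F (int (n - j)) \<cdot> (I \<cdot> ipow I j)"
    unfolding ipow_Suc using ideal_prod_commute[OF ipow_ideal[OF I_ideal] I_ideal] by simp
  also have "\<dots> = (A \<inter> I) \<cdot> ipow I j"
    unfolding AI using ideal_prod_assoc[OF F_ideal I_ideal ipow_ideal[OF I_ideal]] by simp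
  finally have 2: "F (int n + 1) \<inter> ipow I (Suc j) = (A \<inter> I) \<cdot> ipow I j" .
  have "ideal_length R (A \<cdot> ipow I j) ((A \<inter> I) \<cdot> ipow I j) = of_nat ((j + d - 1) choose j) * ideal_length R A (A \<inter> I)"
    using ideal_length_prod[OF A I_ideal order_refl, of j] unfolding I_eq by simp
  moreover have "ideal_length R A (A \<inter> I) = v (n - j)"
    unfolding AI v_def ideal_prod_commute[OF F_ideal I_ideal] by (simp add: A_def)
  ultimately show ?thesis unfolding 1 2 by simp
qed

lemma ideal_length_power: "ideal_length R (carrier R) (ipow I n) = (\<Sum>j<n. of_nat ((j + d - 1) choose j)) * ideal_length R (carrier R) I"
proof (induction n)
  case 0
  show ?case unfolding ipow_0 using ideal_length_self[OF oneideal] by simp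
next
  case (Suc n)
  note id = ipow_ideal[OF I_ideal]
  have "ideal_length R (carrier R) (ipow I (Suc n)) = ideal_length R (carrier R) (ipow I n) + ideal_length R (ipow I n) (ipow I (Suc n))"
    by (rule ideal_length_add[OF oneideal id id ipow_antimono[OF I_ideal] ideal_subset_carrier[OF id]]) simp
  then show ?case unfolding Suc using ideal_length_ipow_step[of n] unfolding I_eq by (simp add: distrib_right)
qed

lemma ideal_length_F_power:
  assumes "t \<le> Suc n"
  shows "ideal_length R (F (int n + 1)) (F (int n + 1) \<inter> ipow I t) = (\<Sum>j<t. of_nat ((j + d - 1) choose j) * v (n - j))"
  using assms
proof (induction t)
  case 0
  have "F (int n + 1) \<inter> carrier R = F (int n + 1)" using ideal_subset_carrier[OF F_ideal] by blast
  then show ?case unfolding ipow_0 using ideal_length_self[OF F_ideal] by simp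
next
  case (Suc t)
  have id: "ideal (F (int n + 1) \<inter> ipow I k) R" for k
    by (rule i_intersect[OF F_ideal ipow_ideal[OF I_ideal]])
  have "F (int n + 1) \<inter> ipow I (Suc t) \<subseteq> F (int n + 1) \<inter> ipow I t"
    using ipow_antimono[OF I_ideal, of t "Suc t"] by auto
  then have "ideal_length R (F (int n + 1)) (F (int n + 1) \<inter> ipow I (Suc t))
      = ideal_length R (F (int n + 1)) (F (int n + 1) \<inter> ipow I t)
        + ideal_length R (F (int n + 1) \<inter> ipow I t) (F (int n + 1) \<inter> ipow I (Suc t))"
    by (intro ideal_length_add[OF F_ideal id id]) auto
  then show ?case using Suc HI_step[of t n] by simp
qed

text \<open>The length of \<open>R\<close> modulo \<open>ipow I (Suc n)\<close> is computed once
  along the powers of \<open>I\<close> and once through \<open>F (n + 1)\<close>. The identity stays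
  additive because lengths may still be infinite; the finiteness of the right side later gives that
  of every term on the left.\<close>

lemma hilbert_function_enat:
  "ideal_length R (carrier R) (F (int n + 1)) + (\<Sum>j\<le>n. of_nat ((j + d - 1) choose j) * v (n - j))
    = of_nat ((n + d) choose n) * ideal_length R (carrier R) I"
proof -
  have sub: "ipow I (Suc n) \<subseteq> F (int n + 1)"
    using F_power[of "int (Suc n)"] unfolding ideal_power_int by (simp add: add.commute)
  then have "F (int n + 1) \<inter> ipow I (Suc n) = ipow I (Suc n)" by blast
  then have "ideal_length R (F (int n + 1)) (ipow I (Suc n)) = (\<Sum>j\<le>n. of_nat ((j + d - 1) choose j) * v (n - j))"
    using ideal_length_F_power[of "Suc n" n] by (simp add: lessThan_Suc_atMost)
  moreover have "ideal_length R (carrier R) (ipow I (Suc n))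
      = ideal_length R (carrier R) (F (int n + 1)) + ideal_length R (F (int n + 1)) (ipow I (Suc n))"
    by (rule ideal_length_add[OF oneideal F_ideal ipow_ideal[OF I_ideal] sub ideal_subset_carrier[OF F_ideal]])
  moreover have "(\<Sum>j\<le>n. of_nat ((j + d - 1) choose j)) = (of_nat ((n + d) choose n) :: enat)"
    by (simp only: of_nat_sum[symmetric] sum_multichoose)
  ultimately show ?thesis using ideal_length_power[of "Suc n"] by (simp add: lessThan_Suc_atMost)
qed

section \<open>Finite lengths as natural numbers and the Hilbert polynomial\<close>

definition len :: nat where "len = the_enat (ideal_length R (carrier R) I)"
definition h :: "nat \<Rightarrow> nat" where "h n = the_enat (ideal_length R (carrier R) (F (int n)))"
definition w :: "nat \<Rightarrow> nat" where "w k = the_enat (v k)"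

lemma len: "ideal_length R (carrier R) I = enat len"
  unfolding len_def by (rule enat_the_enat[symmetric]) (use finite_colength in \<open>simp only: I_eq not_False_eq_True\<close>)

lemma finite_F: "ideal_length R (carrier R) (F (int n + 1)) + (\<Sum>j\<le>n. of_nat ((j + d - 1) choose j) * v (n - j)) \<noteq> \<infinity>"
  unfolding hilbert_function_enat len by (simp add: of_nat_eq_enat)

lemma h: "ideal_length R (carrier R) (F (int n)) = enat (h n)"
proof (cases n)
  case 0
  then show ?thesis
    using ideal_length_self[OF oneideal] by (simp add: h_def F_nonpos zero_enat_def)
next
  case (Suc k)
  then have "int n = int k + 1" by simp
  moreover have "ideal_length R (carrier R) (F (int k + 1)) \<noteq> \<infinity>"
  proof
    assume "ideal_length R (carrier R) (F (int k + 1)) = \<infinity>"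
    then show False using finite_F[of k] by simp
  qed
  ultimately show ?thesis unfolding h_def by (simp add: enat_the_enat)
qed

text \<open>\<open>v k\<close> is the summand \<open>j = 0\<close>, with coefficient one, of a sum
  already known to be finite.\<close>

lemma w: "v k = enat (w k)"
proof -
  have "v k \<le> (\<Sum>j\<le>k. of_nat ((j + d - 1) choose j) * v (k - j))"
    using member_le_sum[of 0 "{..k}" "\<lambda>j. of_nat ((j + d - 1) choose j) * v (k - j)"] by simp
  moreover have "(\<Sum>j\<le>k. of_nat ((j + d - 1) choose j) * v (k - j)) \<noteq> \<infinity>"
  proof
    assume "(\<Sum>j\<le>k. of_nat ((j + d - 1) choose j) * v (k - j)) = \<infinity>"
    then show False using finite_F[of k] by simp
  qed
  ultimately have "v k \<noteq> \<infinity>" by (cases "v k") simp_all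
  then show ?thesis unfolding w_def by (simp add: enat_the_enat)
qed

lemma hilbert_function:
  "h (Suc n) + (\<Sum>j\<le>n. ((j + d - 1) choose j) * w (n - j)) = ((n + d) choose n) * len"
proof -
  have "enat (h (Suc n) + (\<Sum>j\<le>n. ((j + d - 1) choose j) * w (n - j))) = enat (((n + d) choose n) * len)"
  proof -
    have "int n + 1 = int (Suc n)" by simp
    then show ?thesis
      using hilbert_function_enat[of n]
      unfolding of_nat_eq_enat[symmetric] of_nat_add of_nat_sum of_nat_mult
      by (simp only: h w len of_nat_eq_enat)
  qed
  then show ?thesis by simp
qed

lemma w_eq_0: "r \<le> int k \<Longrightarrow> w k = 0"
  unfolding w_def v_def using reduction_number_stable[of "int k"] ideal_length_self[OF F_ideal] by (simp add: zero_enat_def)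

text \<open>The candidate for the coefficients. The sum can stop at \<open>nat r\<close>, where
  \<open>w\<close> becomes zero, and can start at 0, since \<open>k choose (i - 1)\<close> vanishes
  for \<open>k < i - 1\<close>. The value 0 above \<open>d\<close> follows the normalization in
  \<open>hilbert_coeff\<close>.\<close>

definition e :: "nat \<Rightarrow> int" where
  "e i = (if i = 0 then int len else if i \<le> d then (\<Sum>k<nat r. int (k choose (i - 1)) * int (w k)) else 0)"

lemma hilbert_polynomial:
  assumes d: "d = Suc d'" and n: "nat r \<le> n"
  shows "int (h (Suc n)) = (\<Sum>i\<le>d. (-1) ^ i * e i * int ((Suc n + d - 1 - i) choose (d - i)))"
proof -
  have "(\<Sum>j\<le>n. ((j + d - 1) choose j) * w (n - j)) = (\<Sum>k\<le>n. ((n - k + d - 1) choose (n - k)) * w k)"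
    by (rule sum.reindex_bij_witness[of _ "\<lambda>k. n - k" "\<lambda>k. n - k"]) auto
  also have "\<dots> = (\<Sum>k<nat r. ((n - k + d - 1) choose (n - k)) * w k)"
    using n w_eq_0 by (intro sum.mono_neutral_right) auto
  also have "int \<dots> = (\<Sum>k<nat r. (\<Sum>i\<le>d'. (-1) ^ i * int (k choose i) * int ((n + d' - i) choose (d' - i))) * int (w k))"
    unfolding of_nat_sum
  proof (rule sum.cong)
    fix k assume k: "k \<in> {..<nat r}"
    \<comment> \<open>The expansion is applied with \<open>M = n + d'\<close> and
      \<open>m = d'\<close>, so its hypothesis becomes \<open>k \<le> n\<close>, which holds by
      \<open>k < nat r\<close> and \<open>nat r \<le> n\<close>.\<close>
    have "(n - k + d - 1) choose (n - k) = (n + d' - k) choose d'"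
      using binomial_symmetric[of "n - k" "n - k + d'"] k n d by simp
    then show "int (((n - k + d - 1) choose (n - k)) * w k)
        = (\<Sum>i\<le>d'. (-1) ^ i * int (k choose i) * int ((n + d' - i) choose (d' - i))) * int (w k)"
      using binomial_shift_expansion[of k d' "n + d'"] k n by simp
  qed simp
  also have "\<dots> = (\<Sum>i\<le>d'. (-1) ^ i * (\<Sum>k<nat r. int (k choose i) * int (w k)) * int ((n + d' - i) choose (d' - i)))"
    unfolding sum_distrib_left sum_distrib_right
    by (subst sum.swap) (simp add: mult_ac)
  finally have eq: "int (\<Sum>j\<le>n. ((j + d - 1) choose j) * w (n - j)) =
    (\<Sum>i\<le>d'. (-1) ^ i * (\<Sum>k<nat r. int (k choose i) * int (w k)) * int ((n + d' - i) choose (d' - i)))" .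
  \<comment> \<open>Splitting off \<open>i = 0\<close> shifts the remaining indices by one: the
    extra sign is the minus in front of the sum over \<open>k\<close>, and \<open>k choose i\<close>
    becomes part of \<open>e (Suc i)\<close>, whence the \<open>i - 1\<close> in the
    formula.\<close>
  have split: "(\<Sum>i\<le>d. g i) = g 0 + (\<Sum>i\<le>d'. g (Suc i))" for g :: "nat \<Rightarrow> int"
    unfolding d by (rule sum.atMost_Suc_shift)
  have e_0: "e 0 = int len" by (simp add: e_def)
  have e_Suc: "e (Suc i) = (\<Sum>k<nat r. int (k choose i) * int (w k))" if "i \<le> d'" for i
  proof -
    have "Suc i \<le> d" using that d by simp
    then show ?thesis by (simp add: e_def)
  qed
  define c where "c i = int ((Suc n + d - 1 - i) choose (d - i))" for i
  have c: "c 0 = int ((n + d) choose d)" "c (Suc i) = int ((n + d' - i) choose (d' - i))" for i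
    unfolding c_def d by simp_all
  have "(\<Sum>i\<le>d. (-1) ^ i * e i * c i) = int len * int ((n + d) choose d)
      - (\<Sum>i\<le>d'. (-1) ^ i * (\<Sum>k<nat r. int (k choose i) * int (w k)) * int ((n + d' - i) choose (d' - i)))"
    unfolding split c e_0 by (simp add: e_Suc sum_negf)
  also have "\<dots> = int (((n + d) choose n) * len) - int (\<Sum>j\<le>n. ((j + d - 1) choose j) * w (n - j))"
    unfolding eq using binomial_symmetric[of d "n + d"] by simp
  also have "\<dots> = int (h (Suc n))" unfolding hilbert_function[symmetric] by simp
  finally show ?thesis unfolding c_def by simp
qed

lemma hilbert_coeff_eq:
  assumes d: "d = Suc d'"
  shows "hilbert_coeff R d F = e"
  unfolding hilbert_coeff_def
proof (rule the_equality)
  have len_eq: "module_length R (ideal_quot R (carrier R) (F (int n))) = enat (h n)" for n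
    using module_length_ideal_quot[OF oneideal F_ideal ideal_subset_carrier[OF F_ideal]] h by simp
  have "\<forall>\<^sub>F n in sequentially. int (h (Suc n)) = (\<Sum>i\<le>d. (-1) ^ i * e i * int ((Suc n + d - 1 - i) choose (d - i)))"
    unfolding eventually_sequentially using hilbert_polynomial[OF d] by blast
  then have ev: "\<forall>\<^sub>F n in sequentially. int (h n) = (\<Sum>i\<le>d. (-1) ^ i * e i * int ((n + d - 1 - i) choose (d - i)))"
    by (subst (asm) eventually_sequentially_Suc)
  have iff: "ereal_of_enat (module_length R (ideal_quot R (carrier R) (F (int n)))) = ereal (real_of_int z)
    \<longleftrightarrow> int (h n) = z" for n z
    unfolding len_eq by (simp, metis of_int_eq_iff of_int_of_nat_eq)
  show "(\<forall>i>d. e i = 0) \<and> (\<forall>\<^sub>F n in sequentially.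
        ereal_of_enat (module_length R (ideal_quot R (carrier R) (F (int n)))) =
        ereal (real_of_int (\<Sum>i\<le>d. (-1) ^ i * e i * int ((n + d - 1 - i) choose (d - i)))))"
    unfolding iff using ev by (simp add: e_def)
  fix e' assume "(\<forall>i>d. e' i = 0) \<and> (\<forall>\<^sub>F n in sequentially.
        ereal_of_enat (module_length R (ideal_quot R (carrier R) (F (int n)))) =
        ereal (real_of_int (\<Sum>i\<le>d. (-1) ^ i * e' i * int ((n + d - 1 - i) choose (d - i)))))"
  then have e': "\<forall>i>d. e' i = 0"
    "\<forall>\<^sub>F n in sequentially. int (h n) = (\<Sum>i\<le>d. (-1) ^ i * e' i * int ((n + d - 1 - i) choose (d - i)))"
    unfolding iff by simp_all
  have "\<forall>\<^sub>F n in sequentially. (\<Sum>i\<le>d. ((-1) ^ i * (e' i - e i)) * int ((n + d - 1 - i) choose (d - i))) = 0"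
    using ev e'(2)
    by eventually_elim (simp add: algebra_simps sum_subtractf)
  then have "(-1) ^ i * (e' i - e i) = 0" if "i \<le> d" for i
    using binomial_basis_unique[of "\<lambda>i. (-1) ^ i * (e' i - e i)"] that by blast
  then have "e' i = e i" if "i \<le> d" for i using that by simp
  moreover have "e' i = e i" if "\<not> i \<le> d" for i using that e'(1) by (simp add: e_def)
  ultimately show "e' = e" by blast
qed

end

theorem theorem1p2:
  fixes R :: "('a, 'b) ring_scheme" and \<mm> I :: "'a set" and xs :: "'a list"
    and d i :: nat and F :: "int \<Rightarrow> 'a set"
  assumes "cohen_macaulay_local_ring R \<mm>"
    and "krull_dim R = enat d"
    and "regular_sequence R xs"
    and "length xs = d"
    and "I = Idl\<^bsub>R\<^esub> (set xs)"
    and "I_admissible R \<mm> I F"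
    and "\<forall>p. p \<le> reduction_number R I F - 2 \<longrightarrow> HI R I F p"
    and "1 \<le> i" and "i \<le> d"
  shows "ereal (real_of_int (hilbert_coeff R d F i)) =
    (\<Sum>\<^sub>\<infinity>k\<in>{i - 1..}. ereal_of_enat (of_nat (k choose (i - 1)) *
        module_length R (ideal_quot R (F (int k + 1)) (ideal_prod R I (F (int k))))))"
proof -
  interpret cohen_macaulay_local_ring R \<mm> by fact
  obtain d' where d': "d = Suc d'" using assms(8,9) by (cases d) auto
  define K where "K m = Idl\<^bsub>R\<^esub> (set (take m xs))" for m
  \<comment> \<open>This clause of admissibility makes every element of \<open>\<mm>\<close>
    nilpotent modulo \<open>I\<close>, on which the finiteness of all lengths rests.\<close>
  have "radical R I = \<mm>"
    using assms(6) unfolding I_admissible_def I_filtration_def m_primary_def by simp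
  then interpret local_regular_tower R \<mm> K "\<lambda>m. xs ! m" d
    using local_regular_towerI[OF noetherian_local_ring_axioms assms(3)] assms(4,5)
    unfolding K_def by simp
  have "I = K d" unfolding K_def using assms(4,5) by simp
  then interpret filtered_tower R \<mm> K "\<lambda>m. xs ! m" d F I
    using assms(6) by unfold_locales
  interpret HI_filtered_tower R \<mm> K "\<lambda>m. xs ! m" d F I
    using assms(7) by unfold_locales (simp add: r_def)
  have term_eq: "ereal_of_enat (of_nat (k choose (i - 1)) *
        module_length R (ideal_quot R (F (int k + 1)) (I \<cdot>\<^bsub>R\<^esub> F (int k))))
      = ereal (real ((k choose (i - 1)) * w k))" for k
  proof -
    have "module_length R (ideal_quot R (F (int k + 1)) (I \<cdot>\<^bsub>R\<^esub> F (int k))) = enat (w k)"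
      using module_length_ideal_quot[OF F_ideal ideal_prod_is_ideal[OF I_ideal F_ideal] I_mult_F, of "int k"] w[of k]
      unfolding v_def by simp
    then show ?thesis by (simp add: of_nat_eq_enat)
  qed
  have "(\<Sum>\<^sub>\<infinity>k\<in>{i - 1..}. ereal_of_enat (of_nat (k choose (i - 1)) *
        module_length R (ideal_quot R (F (int k + 1)) (I \<cdot>\<^bsub>R\<^esub> F (int k)))))
      = (\<Sum>\<^sub>\<infinity>k\<in>{..<nat r}. ereal (real ((k choose (i - 1)) * w k)))"
    unfolding term_eq
  \<comment> \<open>The two index sets differ only in zero terms: the binomial vanishes below
    \<open>i - 1\<close>, and \<open>w\<close> from \<open>r\<close> on.\<close>
  proof (rule infsum_cong_neutral)
    show "ereal (real ((k choose (i - 1)) * w k)) = 0" if "k \<in> {..<nat r} - {i - 1..}" for k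
      using that by (simp add: binomial_eq_0)
    show "ereal (real ((k choose (i - 1)) * w k)) = 0" if "k \<in> {i - 1..} - {..<nat r}" for k
    proof -
      have "r \<le> int k" using that by (auto simp: not_less nat_le_iff)
      then show ?thesis by (simp add: w_eq_0)
    qed
  qed simp
  also have "\<dots> = ereal (real_of_int (e i))"
    using assms(8,9) by (simp add: e_def)
  finally show ?thesis
    unfolding hilbert_coeff_eq[OF d'] by simp
qed

end
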